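(* Let $\mathbf C$ be a cubical $(\omega,1)$-category. Then the maps $A\mapsto T_iA$ (sending a cell to its $T_i$-inverse) are defined on all of $\mathbf C_n$, for all $n\ge2$ and $1\le i\le n-1$, and equip $\mathbf C$ with a structure of symmetric cubical $\omega$-category.
   Context: Index notation: for positive integers $i,j$, $j^i=j$ if $j<i$ and $j^i=j+1$ if $j\ge i$; for $j\neq i$, $j_i=j$ if $j<i$ and $j_i=j-1$ if $j>i$. Cubical $\omega$-categories (always with connections): a cubical $\omega$-category $\mathbf C$ consists of sets $\mathbf C_n$ ($n\ge0$), maps $\partial_i^\alpha:\mathbf C_n\to\mathbf C_{n-1}$ and $\Gamma_i^\alpha:\mathbf C_n\to\mathbf C_{n+1}$ ($n\ge1$, $1\le i\le n$, $\alpha=\pm$), maps $\epsilon_i:\mathbf C_n\to\mathbf C_{n+1}$ ($n\ge0$, $1\le i\le n+1$), and partial operations $\star_i$ on $\mathbf C_n$ ($1\le i\le n$), with $A\star_iB$ defined exactly when $\partial_i^+A=\partial_i^-B$, subject to (for all indices and cells for which both sides make sense): - $\partial_{j-1}^\alpha\partial_i^\beta=\partial_i^\beta\partial_j^\alpha$ for $i<j$; - $\partial_i^\alpha\epsilon_j=\epsilon_{j_i}\partial_{i_j}^\alpha$ for $i\ne j$, and $\partial_i^\alpha\epsilon_i=\mathrm{id}$; - $\partial_i^\alpha\Gamma_j^\beta=\Gamma_{j_i}^\beta\partial_{i_j}^\alpha$ for $i\ne j,j+1$; for $i\in\{j,j+1\}$, $\partial_i^\alpha\Gamma_j^\alpha=\mathrm{id}$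 and $\partial_i^\alpha\Gamma_j^{-\alpha}=\epsilon_j\partial_j^\alpha$; - $\epsilon_i\epsilon_j=\epsilon_{j+1}\epsilon_i$ for $i\le j$; $\Gamma_i^\alpha\Gamma_j^\beta=\Gamma_{j+1}^\beta\Gamma_i^\alpha$ for $i<j$; $\Gamma_{i+1}^\alpha\Gamma_i^\alpha=\Gamma_i^\alpha\Gamma_i^\alpha$; $\Gamma_i^\alpha\epsilon_j=\epsilon_{j^i}\Gamma_{i_j}^\alpha$ for $i\ne j$; $\Gamma_i^\alpha\epsilon_i=\epsilon_i\epsilon_i$; - $\partial_i^\alpha(A\star_jB)=\partial_i^\alpha A\star_{j_i}\partial_i^\alpha B$ for $i\neq j$; $\partial_i^-(A\star_iB)=\partial_i^-A$; $\partial_i^+(A\star_iB)=\partial_i^+B$; - $\star_i$ is associative; $A\star_i\epsilon_i\partial_i^+A=\epsilon_i\partial_i^-A\star_iA=A$; $(A\star_iB)\star_j(C\star_iD)=(A\star_jC)\star_i(B\star_jD)$ for $i\neq j$; - $\epsilon_i(A\star_jB)=\epsilon_iA\star_{j^i}\epsilon_iB$; $\Gamma_i^\alpha(A\star_jB)=\Gamma_i^\alpha A\star_{j^i}\Gamma_i^\alpha B$ for $i\ne j$; $\Gamma_i^-(A\star_iB)=(\Gamma_i^-A\star_i\epsilon_{i+1}B)\star_{i+1}(\epsilon_iB\star_i\Gamma_i^-B)$; $\Gamma_i^+(A\star_iB)=(\Gamma_i^+A\star_i\epsilon_iA)\star_{i+1}(\epsilon_{i+1}A\star_i\Gamma_i^+B)$;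 - $\Gamma_i^+A\star_i\Gamma_i^-A=\epsilon_{i+1}A$; $\Gamma_i^+A\star_{i+1}\Gamma_i^-A=\epsilon_iA$. Plain invertibility. $A\in\mathbf C_n$ ($n\ge1$) is $R_1$-invertible if there is $B\in\mathbf C_n$ with $A\star_1B=\epsilon_1\partial_1^-A$ and $B\star_1A=\epsilon_1\partial_1^+A$. For $1\le i\le n-1$ put $\psi_iA=\Gamma_i^+\partial_{i+1}^-A\star_{i+1}A\star_{i+1}\Gamma_i^-\partial_{i+1}^+A$. $A\in\mathbf C_n$ is invertible if $\psi_1\cdots\psi_{n-1}A$ is $R_1$-invertible. A cubical $(\omega,1)$-category is a cubical $\omega$-category in which every $n$-cell with $n>1$ is invertible. $T_i$-inverses. For $1\le i<n$, $A\in\mathbf C_n$ is $T_i$-invertible with $T_i$-inverse $B\in\mathbf C_n$ (written $T_iA$; it is unique) if $\partial_i^\alpha A=\partial_{i+1}^\alpha B$ and $\partial_{i+1}^\alpha A=\partial_i^\alpha B$ for $\alpha=\pm$, and $(\Gamma_i^+\partial_{i+1}^-A\star_iB)\star_{i+1}(A\star_i\Gamma_i^-\partial_i^+A)=\Gamma_i^-\partial_i^-A\star_i\Gamma_i^+\partial_{i+1}^+A$, together with the same equation with $A$ and $B$ exchanged. Symmetric cubical $\omega$-categories. A symmetric cubical $\omega$-category is a cubical $\omega$-category with total maps $T_i:\mathbf C_n\to\mathbf C_n$ ($1\le i\le n-1$) satisfying, whenever both sides make sense: - $\partial_i^\alpha T_jA=T_{j_i}\partial_i^\alpha A$ for $i\ne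 j,j+1$; $\partial_j^\alpha T_jA=\partial_{j+1}^\alpha A$; $\partial_{j+1}^\alpha T_jA=\partial_j^\alpha A$; - $T_j\epsilon_jA=\epsilon_{j+1}A$; $T_{j-1}\epsilon_jA=\epsilon_{j-1}A$; $T_{i^j}\epsilon_jA=\epsilon_jT_iA$ for $i\ne j-1$; - $T_j\Gamma_j^\alpha A=\Gamma_j^\alpha A$; $T_{i^j}\Gamma_j^\alpha A=\Gamma_j^\alpha T_iA$ for $j\neq i,i+1$; $T_{i+1}\Gamma_i^\alpha T_iA=T_i\Gamma_{i+1}^\alpha A$; $T_i\Gamma_{i+1}^\alpha T_iA=T_{i+1}\Gamma_i^\alpha A$; - $T_i(A\star_iB)=T_iA\star_{i+1}T_iB$; $T_i(A\star_{i+1}B)=T_iA\star_iT_iB$; $T_i(A\star_jB)=T_iA\star_jT_iB$ for $j\neq i,i+1$; - $T_iT_iA=A$; $T_iT_{i+1}T_iA=T_{i+1}T_iT_{i+1}A$; $T_iT_jA=T_jT_iA$ for $|i-j|\ge2$. *)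

theory Defs
  imports Main
begin

datatype sign = Neg | Pos

fun opp :: "sign \<Rightarrow> sign" where
  "opp Neg = Pos"
| "opp Pos = Neg"

(* up j i is the index j^i; dn j i is the index j_i, used only for j different from i. *)

definition up :: "nat \<Rightarrow> nat \<Rightarrow> nat" where
  "up j i = (if j < i then j else j + 1)"

definition dn :: "nat \<Rightarrow> nat \<Rightarrow> nat" where
  "dn j i = (if j < i then j else j - 1)"

(*
  The sets of cells of different dimensions need not be disjoint, so every operation carries
  the dimension n of its arguments: for A, B in cells n,
    face n i a A  is the face of A in direction i with sign a, in cells (n - 1),
    degen n i A   is the degeneracy epsilon_i A, in cells (n + 1),
    conn n i a A  is the connection Gamma_i^a A, in cells (n + 1),
    comp A n i B  is the composite of A and B in direction i, in cells n.
  The composition is a total function; its value is meaningful only when "composable" holds,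
  and the predicate is required wherever a composite is asserted to be defined.
*)

record 'a cubical =
  cells :: "nat \<Rightarrow> 'a set"
  face  :: "nat \<Rightarrow> nat \<Rightarrow> sign \<Rightarrow> 'a \<Rightarrow> 'a"  ("\<partial>\<index>")
  degen :: "nat \<Rightarrow> nat \<Rightarrow> 'a \<Rightarrow> 'a"  ("\<epsilon>\<index>")
  conn  :: "nat \<Rightarrow> nat \<Rightarrow> sign \<Rightarrow> 'a \<Rightarrow> 'a"  ("\<Gamma>\<index>")
  comp  :: "'a \<Rightarrow> nat \<Rightarrow> nat \<Rightarrow> 'a \<Rightarrow> 'a"  ("(_ \<star>\<index>\<langle>_,_\<rangle> _)" [71, 0, 0, 71] 70)

definition composable :: "'a cubical \<Rightarrow> nat \<Rightarrow> nat \<Rightarrow> 'a \<Rightarrow> 'a \<Rightarrow> bool" where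
  "composable C n i A B \<longleftrightarrow>
     1 \<le> i \<and> i \<le> n \<and> A \<in> cells C n \<and> B \<in> cells C n \<and>
     face C n i Pos A = face C n i Neg B"

locale cubical_omega_category =
  fixes C :: "'a cubical" (structure)
  assumes face_closed:
    "\<lbrakk>A \<in> cells C n; 1 \<le> i; i \<le> n\<rbrakk> \<Longrightarrow> \<partial> n i \<alpha> A \<in> cells C (n - 1)"
  and degen_closed:
    "\<lbrakk>A \<in> cells C n; 1 \<le> i; i \<le> n + 1\<rbrakk> \<Longrightarrow> \<epsilon> n i A \<in> cells C (n + 1)"
  and conn_closed:
    "\<lbrakk>A \<in> cells C n; 1 \<le> i; i \<le> n\<rbrakk> \<Longrightarrow> \<Gamma> n i \<alpha> A \<in> cells C (n + 1)"
  and comp_closed: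
    "composable C n i A B \<Longrightarrow> A \<star>\<langle>n,i\<rangle> B \<in> cells C n"

  and face_face:
    "\<lbrakk>A \<in> cells C n; 1 \<le> i; i < j; j \<le> n\<rbrakk> \<Longrightarrow>
       \<partial> (n - 1) (j - 1) \<alpha> (\<partial> n i \<beta> A) = \<partial> (n - 1) i \<beta> (\<partial> n j \<alpha> A)"
  and face_degen:
    "\<lbrakk>A \<in> cells C n; 1 \<le> i; i \<le> n + 1; 1 \<le> j; j \<le> n + 1; i \<noteq> j\<rbrakk> \<Longrightarrow>
       \<partial> (n + 1) i \<alpha> (\<epsilon> n j A) = \<epsilon> (n - 1) (dn j i) (\<partial> n (dn i j) \<alpha> A)"
  and face_degen_same:
    "\<lbrakk>A \<in> cells C n; 1 \<le> i; i \<le> n + 1\<rbrakk> \<Longrightarrow> \<partial> (n + 1) i \<alpha> (\<epsilon> n i A) = A"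
  and face_conn:
    "\<lbrakk>A \<in> cells C n; 1 \<le> i; i \<le> n + 1; 1 \<le> j; j \<le> n; i \<noteq> j; i \<noteq> j + 1\<rbrakk> \<Longrightarrow>
       \<partial> (n + 1) i \<alpha> (\<Gamma> n j \<beta> A) = \<Gamma> (n - 1) (dn j i) \<beta> (\<partial> n (dn i j) \<alpha> A)"
  and face_conn_same:
    "\<lbrakk>A \<in> cells C n; 1 \<le> j; j \<le> n; i = j \<or> i = j + 1\<rbrakk> \<Longrightarrow>
       \<partial> (n + 1) i \<alpha> (\<Gamma> n j \<alpha> A) = A"
  and face_conn_opp:
    "\<lbrakk>A \<in> cells C n; 1 \<le> j; j \<le> n; i = j \<or> i = j + 1\<rbrakk> \<Longrightarrow>
       \<partial> (n + 1) i \<alpha> (\<Gamma> n j (opp \<alpha>) A) = \<epsilon> (n - 1) j (\<partial> n j \<alpha> A)"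

  and degen_degen:
    "\<lbrakk>A \<in> cells C n; 1 \<le> i; i \<le> j; j \<le> n + 1\<rbrakk> \<Longrightarrow>
       \<epsilon> (n + 1) i (\<epsilon> n j A) = \<epsilon> (n + 1) (j + 1) (\<epsilon> n i A)"
  and conn_conn:
    "\<lbrakk>A \<in> cells C n; 1 \<le> i; i < j; j \<le> n\<rbrakk> \<Longrightarrow>
       \<Gamma> (n + 1) i \<alpha> (\<Gamma> n j \<beta> A) = \<Gamma> (n + 1) (j + 1) \<beta> (\<Gamma> n i \<alpha> A)"
  and conn_conn_same:
    "\<lbrakk>A \<in> cells C n; 1 \<le> i; i \<le> n\<rbrakk> \<Longrightarrow>
       \<Gamma> (n + 1) (i + 1) \<alpha> (\<Gamma> n i \<alpha> A) = \<Gamma> (n + 1) i \<alpha> (\<Gamma> n i \<alpha> A)"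
  and conn_degen:
    "\<lbrakk>A \<in> cells C n; 1 \<le> i; i \<le> n + 1; 1 \<le> j; j \<le> n + 1; i \<noteq> j\<rbrakk> \<Longrightarrow>
       \<Gamma> (n + 1) i \<alpha> (\<epsilon> n j A) = \<epsilon> (n + 1) (up j i) (\<Gamma> n (dn i j) \<alpha> A)"
  and conn_degen_same:
    "\<lbrakk>A \<in> cells C n; 1 \<le> i; i \<le> n + 1\<rbrakk> \<Longrightarrow>
       \<Gamma> (n + 1) i \<alpha> (\<epsilon> n i A) = \<epsilon> (n + 1) i (\<epsilon> n i A)"

  and face_comp:
    "\<lbrakk>composable C n j A B; 1 \<le> i; i \<le> n; i \<noteq> j\<rbrakk> \<Longrightarrow>
       \<partial> n i \<alpha> (A \<star>\<langle>n,j\<rangle> B) = \<partial> n i \<alpha> A \<star>\<langle>n - 1,dn j i\<rangle> \<partial> n i \<alpha> B"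
  and face_comp_neg:
    "composable C n i A B \<Longrightarrow> \<partial> n i Neg (A \<star>\<langle>n,i\<rangle> B) = \<partial> n i Neg A"
  and face_comp_pos:
    "composable C n i A B \<Longrightarrow> \<partial> n i Pos (A \<star>\<langle>n,i\<rangle> B) = \<partial> n i Pos B"

  and comp_assoc:
    "\<lbrakk>composable C n i A B; composable C n i B D\<rbrakk> \<Longrightarrow>
       (A \<star>\<langle>n,i\<rangle> B) \<star>\<langle>n,i\<rangle> D = A \<star>\<langle>n,i\<rangle> (B \<star>\<langle>n,i\<rangle> D)"
  and comp_right_unit:
    "\<lbrakk>A \<in> cells C n; 1 \<le> i; i \<le> n\<rbrakk> \<Longrightarrow>
       A \<star>\<langle>n,i\<rangle> \<epsilon> (n - 1) i (\<partial> n i Pos A) = A"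
  and comp_left_unit:
    "\<lbrakk>A \<in> cells C n; 1 \<le> i; i \<le> n\<rbrakk> \<Longrightarrow>
       \<epsilon> (n - 1) i (\<partial> n i Neg A) \<star>\<langle>n,i\<rangle> A = A"
  and comp_exchange:
    "\<lbrakk>i \<noteq> j; composable C n i A B; composable C n i D E;
      composable C n j A D; composable C n j B E\<rbrakk> \<Longrightarrow>
       (A \<star>\<langle>n,i\<rangle> B) \<star>\<langle>n,j\<rangle> (D \<star>\<langle>n,i\<rangle> E) =
       (A \<star>\<langle>n,j\<rangle> D) \<star>\<langle>n,i\<rangle> (B \<star>\<langle>n,j\<rangle> E)"

  and degen_comp:
    "\<lbrakk>composable C n j A B; 1 \<le> i; i \<le> n + 1\<rbrakk> \<Longrightarrow>
       \<epsilon> n i (A \<star>\<langle>n,j\<rangle> B) = \<epsilon> n i A \<star>\<langle>n + 1,up j i\<rangle> \<epsilon> n i B"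
  and conn_comp:
    "\<lbrakk>composable C n j A B; 1 \<le> i; i \<le> n; i \<noteq> j\<rbrakk> \<Longrightarrow>
       \<Gamma> n i \<alpha> (A \<star>\<langle>n,j\<rangle> B) = \<Gamma> n i \<alpha> A \<star>\<langle>n + 1,up j i\<rangle> \<Gamma> n i \<alpha> B"
  and conn_comp_neg:
    "composable C n i A B \<Longrightarrow>
       \<Gamma> n i Neg (A \<star>\<langle>n,i\<rangle> B) =
       (\<Gamma> n i Neg A \<star>\<langle>n + 1,i\<rangle> \<epsilon> n (i + 1) B) \<star>\<langle>n + 1,i + 1\<rangle>
       (\<epsilon> n i B \<star>\<langle>n + 1,i\<rangle> \<Gamma> n i Neg B)"
  and conn_comp_pos:
    "composable C n i A B \<Longrightarrow>
       \<Gamma> n i Pos (A \<star>\<langle>n,i\<rangle> B) =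
       (\<Gamma> n i Pos A \<star>\<langle>n + 1,i\<rangle> \<epsilon> n i A) \<star>\<langle>n + 1,i + 1\<rangle>
       (\<epsilon> n (i + 1) A \<star>\<langle>n + 1,i\<rangle> \<Gamma> n i Pos B)"
  and conn_cancel:
    "\<lbrakk>A \<in> cells C n; 1 \<le> i; i \<le> n\<rbrakk> \<Longrightarrow>
       \<Gamma> n i Pos A \<star>\<langle>n + 1,i\<rangle> \<Gamma> n i Neg A = \<epsilon> n (i + 1) A"
  and conn_cancel_Suc:
    "\<lbrakk>A \<in> cells C n; 1 \<le> i; i \<le> n\<rbrakk> \<Longrightarrow>
       \<Gamma> n i Pos A \<star>\<langle>n + 1,i + 1\<rangle> \<Gamma> n i Neg A = \<epsilon> n i A"

definition R1_invertible :: "'a cubical \<Rightarrow> nat \<Rightarrow> 'a \<Rightarrow> bool" where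
  "R1_invertible C n A \<longleftrightarrow>
     (\<exists>B. composable C n 1 A B \<and> composable C n 1 B A \<and>
          A \<star>\<^bsub>C\<^esub>\<langle>n,1\<rangle> B = degen C (n - 1) 1 (face C n 1 Neg A) \<and>
          B \<star>\<^bsub>C\<^esub>\<langle>n,1\<rangle> A = degen C (n - 1) 1 (face C n 1 Pos A))"

definition psi :: "'a cubical \<Rightarrow> nat \<Rightarrow> nat \<Rightarrow> 'a \<Rightarrow> 'a" where
  "psi C n i A =
     (conn C (n - 1) i Pos (face C n (i + 1) Neg A) \<star>\<^bsub>C\<^esub>\<langle>n,i + 1\<rangle> A)
       \<star>\<^bsub>C\<^esub>\<langle>n,i + 1\<rangle> conn C (n - 1) i Neg (face C n (i + 1) Pos A)"

(* The fold below is psi_1 (psi_2 (... (psi_(n-1) A))); for n = 1 it is A itself. *)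

definition invertible_cell :: "'a cubical \<Rightarrow> nat \<Rightarrow> 'a \<Rightarrow> bool" where
  "invertible_cell C n A \<longleftrightarrow> R1_invertible C n (foldr (psi C n) [1..<n] A)"

locale cubical_omega_1_category = cubical_omega_category +
  assumes invertible: "\<lbrakk>1 < n; A \<in> cells C n\<rbrakk> \<Longrightarrow> invertible_cell C n A"

definition T_equation :: "'a cubical \<Rightarrow> nat \<Rightarrow> nat \<Rightarrow> 'a \<Rightarrow> 'a \<Rightarrow> bool" where
  "T_equation C n i A B \<longleftrightarrow>
     (conn C (n - 1) i Pos (face C n (i + 1) Neg A) \<star>\<^bsub>C\<^esub>\<langle>n,i\<rangle> B) \<star>\<^bsub>C\<^esub>\<langle>n,i + 1\<rangle>
     (A \<star>\<^bsub>C\<^esub>\<langle>n,i\<rangle> conn C (n - 1) i Neg (face C n i Pos A)) =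
     conn C (n - 1) i Neg (face C n i Neg A) \<star>\<^bsub>C\<^esub>\<langle>n,i\<rangle>
     conn C (n - 1) i Pos (face C n (i + 1) Pos A)"

(* The face conditions make every composite occurring in T_equation defined. *)

definition is_T_inverse :: "'a cubical \<Rightarrow> nat \<Rightarrow> nat \<Rightarrow> 'a \<Rightarrow> 'a \<Rightarrow> bool" where
  "is_T_inverse C n i A B \<longleftrightarrow>
     1 \<le> i \<and> i < n \<and> A \<in> cells C n \<and> B \<in> cells C n \<and>
     (\<forall>\<alpha>. face C n i \<alpha> A = face C n (i + 1) \<alpha> B \<and> face C n (i + 1) \<alpha> A = face C n i \<alpha> B) \<and>
     T_equation C n i A B \<and> T_equation C n i B A"

definition T_inverse :: "'a cubical \<Rightarrow> nat \<Rightarrow> nat \<Rightarrow> 'a \<Rightarrow> 'a" where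
  "T_inverse C n i A = (THE B. is_T_inverse C n i A B)"

locale symmetric_cubical_omega_category = cubical_omega_category +
  fixes T :: "nat \<Rightarrow> nat \<Rightarrow> 'a \<Rightarrow> 'a"
  assumes T_closed:
    "\<lbrakk>A \<in> cells C n; 1 \<le> i; i < n\<rbrakk> \<Longrightarrow> T n i A \<in> cells C n"

  and face_T:
    "\<lbrakk>A \<in> cells C n; 1 \<le> j; j < n; 1 \<le> i; i \<le> n; i \<noteq> j; i \<noteq> j + 1\<rbrakk> \<Longrightarrow>
       \<partial> n i \<alpha> (T n j A) = T (n - 1) (dn j i) (\<partial> n i \<alpha> A)"
  and face_T_same:
    "\<lbrakk>A \<in> cells C n; 1 \<le> j; j < n\<rbrakk> \<Longrightarrow> \<partial> n j \<alpha> (T n j A) = \<partial> n (j + 1) \<alpha> A"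
  and face_T_Suc:
    "\<lbrakk>A \<in> cells C n; 1 \<le> j; j < n\<rbrakk> \<Longrightarrow> \<partial> n (j + 1) \<alpha> (T n j A) = \<partial> n j \<alpha> A"

  and T_degen_same:
    "\<lbrakk>A \<in> cells C n; 1 \<le> j; j \<le> n\<rbrakk> \<Longrightarrow> T (n + 1) j (\<epsilon> n j A) = \<epsilon> n (j + 1) A"
  and T_degen_pred:
    "\<lbrakk>A \<in> cells C n; 2 \<le> j; j \<le> n + 1\<rbrakk> \<Longrightarrow> T (n + 1) (j - 1) (\<epsilon> n j A) = \<epsilon> n (j - 1) A"
  and T_degen:
    "\<lbrakk>A \<in> cells C n; 1 \<le> i; i < n; 1 \<le> j; j \<le> n + 1; i + 1 \<noteq> j\<rbrakk> \<Longrightarrow>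
       T (n + 1) (up i j) (\<epsilon> n j A) = \<epsilon> n j (T n i A)"

  and T_conn_same:
    "\<lbrakk>A \<in> cells C n; 1 \<le> j; j \<le> n\<rbrakk> \<Longrightarrow> T (n + 1) j (\<Gamma> n j \<alpha> A) = \<Gamma> n j \<alpha> A"
  and T_conn:
    "\<lbrakk>A \<in> cells C n; 1 \<le> i; i < n; 1 \<le> j; j \<le> n; j \<noteq> i; j \<noteq> i + 1\<rbrakk> \<Longrightarrow>
       T (n + 1) (up i j) (\<Gamma> n j \<alpha> A) = \<Gamma> n j \<alpha> (T n i A)"
  and T_Suc_conn_T:
    "\<lbrakk>A \<in> cells C n; 1 \<le> i; i < n\<rbrakk> \<Longrightarrow>
       T (n + 1) (i + 1) (\<Gamma> n i \<alpha> (T n i A)) = T (n + 1) i (\<Gamma> n (i + 1) \<alpha> A)"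
  and T_conn_Suc_T:
    "\<lbrakk>A \<in> cells C n; 1 \<le> i; i < n\<rbrakk> \<Longrightarrow>
       T (n + 1) i (\<Gamma> n (i + 1) \<alpha> (T n i A)) = T (n + 1) (i + 1) (\<Gamma> n i \<alpha> A)"

  and T_comp_same:
    "\<lbrakk>composable C n i A B; i < n\<rbrakk> \<Longrightarrow>
       T n i (A \<star>\<langle>n,i\<rangle> B) = T n i A \<star>\<langle>n,i + 1\<rangle> T n i B"
  and T_comp_Suc:
    "\<lbrakk>composable C n (i + 1) A B; 1 \<le> i\<rbrakk> \<Longrightarrow>
       T n i (A \<star>\<langle>n,i + 1\<rangle> B) = T n i A \<star>\<langle>n,i\<rangle> T n i B"
  and T_comp:
    "\<lbrakk>composable C n j A B; 1 \<le> i; i < n; j \<noteq> i; j \<noteq> i + 1\<rbrakk> \<Longrightarrow>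
       T n i (A \<star>\<langle>n,j\<rangle> B) = T n i A \<star>\<langle>n,j\<rangle> T n i B"

  and T_T:
    "\<lbrakk>A \<in> cells C n; 1 \<le> i; i < n\<rbrakk> \<Longrightarrow> T n i (T n i A) = A"
  and T_braid:
    "\<lbrakk>A \<in> cells C n; 1 \<le> i; i + 1 < n\<rbrakk> \<Longrightarrow>
       T n i (T n (i + 1) (T n i A)) = T n (i + 1) (T n i (T n (i + 1) A))"
  and T_commute:
    "\<lbrakk>A \<in> cells C n; 1 \<le> i; i < n; 1 \<le> j; j < n; i + 2 \<le> j \<or> j + 2 \<le> i\<rbrakk> \<Longrightarrow>
       T n i (T n j A) = T n j (T n i A)"

end

theory Submission
  imports Defs
begin

text \<open>
  The cells of dimensions n - 2, n - 1 and n with the structure in the directions i and i + 1 form an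
  edge-symmetric double category with connections. There a square is determined by its boundary and
  by its folding psi_i, and the T_i-equations for a pair of squares with transposed boundaries
  say exactly that the two foldings are inverse to each other for the composition i. So the
  T_i-inverse is unique, it exists as soon as psi_i A is R_i-invertible, and every map that
  preserves the structure in two adjacent directions preserves T-inverses. The latter gives most
  of the axioms at once, the braid relation included, where the map T_i T_(i+1) carries the
  directions i, i + 1 to i + 1, i + 2.

  That psi_i A is R_i-invertible follows by induction on the dimension. By the induction hypothesis all
  faces of psi_i A in directions other than i are R-invertible. If this holds for a cell X and a
  direction, then X can be recovered by unfolding from the psi_k X by composing with
  R-invertible cells, so that R_1-invertibility of psi_1 ... psi_(n-1) X passes to X; whenever
  k = i - 1, transposition turns an R_k-inverse into an R_i-inverse.

  The axiom relating T_i Gamma_(i+1) T_i and T_(i+1) Gamma_i needs three directions. Call a cell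
  thin if psi_i psi_(i+1) sends it to a degenerate cell. A thin cell is determined by its
  boundary. Thin cells contain degenerate cells and connections and are closed under composition and
  under R_i-inverses, hence under T_i by unfolding. The cell T_(i+1) Gamma_i A is thin as well,
  since its folding psi_(i+1) is R_(i+1)-inverse to that of Gamma_i A. So both sides of the axiom
  are thin, and they have the same boundary.
\<close>

section \<open>Double categories with connections\<close>

text \<open>
  In the application, v is the composition in direction i and h the one in direction i + 1; the
  edges are the same in both directions.
\<close>

locale connection_double_category =
  fixes P E S :: "'a set"
    and d :: "sign \<Rightarrow> 'a \<Rightarrow> 'a" and u :: "'a \<Rightarrow> 'a" and m :: "'a \<Rightarrow> 'a \<Rightarrow> 'a" (infixl "\<cdot>" 70)
    and d1 d2 :: "sign \<Rightarrow> 'a \<Rightarrow> 'a" and e1 e2 :: "'a \<Rightarrow> 'a" and g :: "sign \<Rightarrow> 'a \<Rightarrow> 'a"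
    and v :: "'a \<Rightarrow> 'a \<Rightarrow> 'a" (infixl "\<ominus>" 70)
    and h :: "'a \<Rightarrow> 'a \<Rightarrow> 'a" (infixl "\<odot>" 70)
  assumes d_in: "x \<in> E \<Longrightarrow> d \<alpha> x \<in> P"
    and u_in: "p \<in> P \<Longrightarrow> u p \<in> E"
    and m_in: "\<lbrakk>x \<in> E; y \<in> E; d Pos x = d Neg y\<rbrakk> \<Longrightarrow> x \<cdot> y \<in> E"
    and d1_in: "A \<in> S \<Longrightarrow> d1 \<alpha> A \<in> E"
    and d2_in: "A \<in> S \<Longrightarrow> d2 \<alpha> A \<in> E"
    and e1_in: "x \<in> E \<Longrightarrow> e1 x \<in> S"
    and e2_in: "x \<in> E \<Longrightarrow> e2 x \<in> S"
    and g_in: "x \<in> E \<Longrightarrow> g \<alpha> x \<in> S"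
    and v_in: "\<lbrakk>A \<in> S; B \<in> S; d1 Pos A = d1 Neg B\<rbrakk> \<Longrightarrow> A \<ominus> B \<in> S"
    and h_in: "\<lbrakk>A \<in> S; B \<in> S; d2 Pos A = d2 Neg B\<rbrakk> \<Longrightarrow> A \<odot> B \<in> S"
    and d_u: "p \<in> P \<Longrightarrow> d \<alpha> (u p) = p"
    and d_m_neg: "\<lbrakk>x \<in> E; y \<in> E; d Pos x = d Neg y\<rbrakk> \<Longrightarrow> d Neg (x \<cdot> y) = d Neg x"
    and d_m_pos: "\<lbrakk>x \<in> E; y \<in> E; d Pos x = d Neg y\<rbrakk> \<Longrightarrow> d Pos (x \<cdot> y) = d Pos y"
    and m_assoc: "\<lbrakk>x \<in> E; y \<in> E; z \<in> E; d Pos x = d Neg y; d Pos y = d Neg z\<rbrakk> \<Longrightarrow>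
        (x \<cdot> y) \<cdot> z = x \<cdot> (y \<cdot> z)"
    and m_unit_left: "x \<in> E \<Longrightarrow> u (d Neg x) \<cdot> x = x"
    and m_unit_right: "x \<in> E \<Longrightarrow> x \<cdot> u (d Pos x) = x"
    and d_d1: "A \<in> S \<Longrightarrow> d \<alpha> (d1 \<beta> A) = d \<beta> (d2 \<alpha> A)"
    and d1_e1: "x \<in> E \<Longrightarrow> d1 \<alpha> (e1 x) = x"
    and d2_e2: "x \<in> E \<Longrightarrow> d2 \<alpha> (e2 x) = x"
    and d1_e2: "x \<in> E \<Longrightarrow> d1 \<alpha> (e2 x) = u (d \<alpha> x)"
    and d2_e1: "x \<in> E \<Longrightarrow> d2 \<alpha> (e1 x) = u (d \<alpha> x)"
    and d1_g: "x \<in> E \<Longrightarrow> d1 \<alpha> (g \<alpha> x) = x"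
    and d2_g: "x \<in> E \<Longrightarrow> d2 \<alpha> (g \<alpha> x) = x"
    and d1_g_opp: "x \<in> E \<Longrightarrow> d1 \<alpha> (g (opp \<alpha>) x) = u (d \<alpha> x)"
    and d2_g_opp: "x \<in> E \<Longrightarrow> d2 \<alpha> (g (opp \<alpha>) x) = u (d \<alpha> x)"
    and e2_u: "p \<in> P \<Longrightarrow> e2 (u p) = e1 (u p)"
    and g_u: "p \<in> P \<Longrightarrow> g \<alpha> (u p) = e1 (u p)"
    and d1_v_neg: "\<lbrakk>A \<in> S; B \<in> S; d1 Pos A = d1 Neg B\<rbrakk> \<Longrightarrow> d1 Neg (A \<ominus> B) = d1 Neg A"
    and d1_v_pos: "\<lbrakk>A \<in> S; B \<in> S; d1 Pos A = d1 Neg B\<rbrakk> \<Longrightarrow> d1 Pos (A \<ominus> B) = d1 Pos B"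
    and d2_v: "\<lbrakk>A \<in> S; B \<in> S; d1 Pos A = d1 Neg B\<rbrakk> \<Longrightarrow> d2 \<alpha> (A \<ominus> B) = d2 \<alpha> A \<cdot> d2 \<alpha> B"
    and d2_h_neg: "\<lbrakk>A \<in> S; B \<in> S; d2 Pos A = d2 Neg B\<rbrakk> \<Longrightarrow> d2 Neg (A \<odot> B) = d2 Neg A"
    and d2_h_pos: "\<lbrakk>A \<in> S; B \<in> S; d2 Pos A = d2 Neg B\<rbrakk> \<Longrightarrow> d2 Pos (A \<odot> B) = d2 Pos B"
    and d1_h: "\<lbrakk>A \<in> S; B \<in> S; d2 Pos A = d2 Neg B\<rbrakk> \<Longrightarrow> d1 \<alpha> (A \<odot> B) = d1 \<alpha> A \<cdot> d1 \<alpha> B"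
    and v_assoc: "\<lbrakk>A \<in> S; B \<in> S; D \<in> S; d1 Pos A = d1 Neg B; d1 Pos B = d1 Neg D\<rbrakk> \<Longrightarrow>
        (A \<ominus> B) \<ominus> D = A \<ominus> (B \<ominus> D)"
    and h_assoc: "\<lbrakk>A \<in> S; B \<in> S; D \<in> S; d2 Pos A = d2 Neg B; d2 Pos B = d2 Neg D\<rbrakk> \<Longrightarrow>
        (A \<odot> B) \<odot> D = A \<odot> (B \<odot> D)"
    and v_unit_left: "A \<in> S \<Longrightarrow> e1 (d1 Neg A) \<ominus> A = A"
    and v_unit_right: "A \<in> S \<Longrightarrow> A \<ominus> e1 (d1 Pos A) = A"
    and h_unit_left: "A \<in> S \<Longrightarrow> e2 (d2 Neg A) \<odot> A = A"
    and h_unit_right: "A \<in> S \<Longrightarrow> A \<odot> e2 (d2 Pos A) = A"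
    and exchange: "\<lbrakk>A \<in> S; B \<in> S; D \<in> S; F \<in> S; d2 Pos A = d2 Neg B; d2 Pos D = d2 Neg F;
        d1 Pos A = d1 Neg D; d1 Pos B = d1 Neg F\<rbrakk> \<Longrightarrow>
        (A \<odot> B) \<ominus> (D \<odot> F) = (A \<ominus> D) \<odot> (B \<ominus> F)"
    and e1_m: "\<lbrakk>x \<in> E; y \<in> E; d Pos x = d Neg y\<rbrakk> \<Longrightarrow> e1 (x \<cdot> y) = e1 x \<odot> e1 y"
    and e2_m: "\<lbrakk>x \<in> E; y \<in> E; d Pos x = d Neg y\<rbrakk> \<Longrightarrow> e2 (x \<cdot> y) = e2 x \<ominus> e2 y"
    and g_neg_m: "\<lbrakk>x \<in> E; y \<in> E; d Pos x = d Neg y\<rbrakk> \<Longrightarrow>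
        g Neg (x \<cdot> y) = (g Neg x \<ominus> e2 y) \<odot> (e1 y \<ominus> g Neg y)"
    and g_pos_m: "\<lbrakk>x \<in> E; y \<in> E; d Pos x = d Neg y\<rbrakk> \<Longrightarrow>
        g Pos (x \<cdot> y) = (g Pos x \<ominus> e1 x) \<odot> (e2 x \<ominus> g Pos y)"
    and g_v_cancel: "x \<in> E \<Longrightarrow> g Pos x \<ominus> g Neg x = e2 x"
    and g_h_cancel: "x \<in> E \<Longrightarrow> g Pos x \<odot> g Neg x = e1 x"
begin

text \<open>The term \<open>opp \<alpha>\<close> in the locale assumptions does not match a concrete
  sign under rewriting, so the four instances are recorded separately.\<close>

lemma d1_g_neg_pos: "x \<in> E \<Longrightarrow> d1 Neg (g Pos x) = u (d Neg x)"
  and d1_g_pos_neg: "x \<in> E \<Longrightarrow> d1 Pos (g Neg x) = u (d Pos x)"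
  and d2_g_neg_pos: "x \<in> E \<Longrightarrow> d2 Neg (g Pos x) = u (d Neg x)"
  and d2_g_pos_neg: "x \<in> E \<Longrightarrow> d2 Pos (g Neg x) = u (d Pos x)"
  using d1_g_opp[of x Neg] d1_g_opp[of x Pos] d2_g_opp[of x Neg] d2_g_opp[of x Pos] by simp_all

text \<open>With the edge as a separate premise, rewriting recognises a unit whose edge is known
  only up to equality. The last two rules use \<open>e1 (u p)\<close> because \<open>e2_u\<close>
  rewrites the horizontal unit on a degenerate edge to that form.\<close>

lemma m_unit_left': "\<lbrakk>x \<in> E; d Neg x = p\<rbrakk> \<Longrightarrow> u p \<cdot> x = x"
  and m_unit_right': "\<lbrakk>x \<in> E; d Pos x = p\<rbrakk> \<Longrightarrow> x \<cdot> u p = x"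
  and v_unit_left': "\<lbrakk>A \<in> S; d1 Neg A = x\<rbrakk> \<Longrightarrow> e1 x \<ominus> A = A"
  and v_unit_right': "\<lbrakk>A \<in> S; d1 Pos A = x\<rbrakk> \<Longrightarrow> A \<ominus> e1 x = A"
  and h_unit_left': "\<lbrakk>A \<in> S; d2 Neg A = x\<rbrakk> \<Longrightarrow> e2 x \<odot> A = A"
  and h_unit_right': "\<lbrakk>A \<in> S; d2 Pos A = x\<rbrakk> \<Longrightarrow> A \<odot> e2 x = A"
  and h_unit_left_u: "\<lbrakk>A \<in> S; p \<in> P; d2 Neg A = u p\<rbrakk> \<Longrightarrow> e1 (u p) \<odot> A = A"
  and h_unit_right_u: "\<lbrakk>A \<in> S; p \<in> P; d2 Pos A = u p\<rbrakk> \<Longrightarrow> A \<odot> e1 (u p) = A"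
  using m_unit_left m_unit_right v_unit_left v_unit_right
    h_unit_left h_unit_right e2_u by (force+)

lemmas cell_simps =
  d_in u_in m_in d1_in d2_in e1_in e2_in g_in v_in h_in
  d_u d_m_neg d_m_pos d_d1 d1_e1 d2_e2 d1_e2 d2_e1 d1_g d2_g
  d1_g_neg_pos d1_g_pos_neg d2_g_neg_pos d2_g_pos_neg e2_u g_u
  d1_v_neg d1_v_pos d2_v d2_h_neg d2_h_pos d1_h
  m_unit_left' m_unit_right' v_unit_left' v_unit_right' h_unit_left' h_unit_right'
  h_unit_left_u h_unit_right_u

section \<open>The folding of a square\<close>

text \<open>Gluing connections to both \<open>d2\<close>-faces makes these faces degenerate and
  moves their edges into the \<open>d1\<close>-faces. In a cubical category this is the map
  \<open>psi\<close>, see \<open>psi_eq_fold\<close>.\<close>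

definition fold :: "'a \<Rightarrow> 'a" where
  "fold A = (g Pos (d2 Neg A) \<odot> A) \<odot> g Neg (d2 Pos A)"

lemma fold_in: "A \<in> S \<Longrightarrow> fold A \<in> S"
  and d1_neg_fold: "A \<in> S \<Longrightarrow> d1 Neg (fold A) = d1 Neg A \<cdot> d2 Pos A"
  and d1_pos_fold: "A \<in> S \<Longrightarrow> d1 Pos (fold A) = d2 Neg A \<cdot> d1 Pos A"
  and d2_neg_fold: "A \<in> S \<Longrightarrow> d2 Neg (fold A) = u (d Neg (d2 Neg A))"
  and d2_pos_fold: "A \<in> S \<Longrightarrow> d2 Pos (fold A) = u (d Pos (d2 Pos A))"
  by (simp_all add: fold_def cell_simps)

lemmas fold_simps = fold_in d1_neg_fold d1_pos_fold d2_neg_fold d2_pos_fold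

text \<open>A connection stacked on its opposite is a unit for \<open>\<odot>\<close> by
  \<open>g_v_cancel\<close>. The lower factor removes in this way the connection on the left of
  \<open>fold A\<close>, the upper factor the one on its right.\<close>

lemma fold_unfold:
  assumes "A \<in> S"
  shows "(e1 (d1 Neg A) \<odot> g Pos (d2 Pos A)) \<ominus> (fold A \<ominus> (g Neg (d2 Neg A) \<odot> e1 (d1 Pos A))) = A"
proof -
  \<comment> \<open>The lower row is padded with a unit so that it has three columns like
    \<open>fold A\<close>. The unit law that would collapse the padding is deleted in the next step,
    where \<open>exchange\<close> needs it.\<close>
  have "fold A \<ominus> (g Neg (d2 Neg A) \<odot> e1 (d1 Pos A)) =
     (g Pos (d2 Neg A) \<odot> (A \<odot> g Neg (d2 Pos A))) \<ominus>
       (g Neg (d2 Neg A) \<odot> (e1 (d1 Pos A) \<odot> e1 (u (d Pos (d2 Pos A)))))"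
    using assms by (simp add: fold_def cell_simps m_assoc v_assoc h_assoc)
  also have "\<dots> = e2 (d2 Neg A) \<odot> (A \<odot> g Neg (d2 Pos A))"
    using assms by (simp add: cell_simps exchange g_v_cancel del: h_unit_right_u h_unit_left')
  also have "\<dots> = A \<odot> g Neg (d2 Pos A)"
    using assms by (simp add: cell_simps)
  finally show ?thesis
    using assms by (simp add: cell_simps exchange g_v_cancel)
qed

text \<open>By \<open>fold_unfold\<close> a square is a fixed expression in its folding and its
  boundary.\<close>

lemma fold_eqI:
  assumes "A \<in> S" "B \<in> S" "fold A = fold B" "\<And>\<alpha>. d1 \<alpha> A = d1 \<alpha> B" "\<And>\<alpha>. d2 \<alpha> A = d2 \<alpha> B"
  shows "A = B"
  using assms fold_unfold by metis

text \<open>The laws \<open>g_pos_m\<close> and \<open>g_neg_m\<close> split the connections on the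
  two composite edges, so that \<open>fold (A \<ominus> B)\<close> becomes an array with two rows
  and five columns. Reading it by rows instead of columns gives the right-hand side.\<close>

lemma fold_v:
  assumes "A \<in> S" "B \<in> S" "d1 Pos A = d1 Neg B"
  shows "fold (A \<ominus> B) = (fold A \<odot> e1 (d2 Pos B)) \<ominus> (e1 (d2 Neg A) \<odot> fold B)"
proof -
  let ?c = "d2 Neg A" and ?c' = "d2 Neg B" and ?d = "d2 Pos A" and ?d' = "d2 Pos B"
  have eq: "d Pos ?c = d Neg ?c'" "d Pos ?d = d Neg ?d'"
    using assms d_d1 by metis+
  have "(fold A \<odot> e1 ?d') \<ominus> (e1 ?c \<odot> fold B) =
    (g Pos ?c \<odot> (e2 ?c \<odot> (A \<odot> (g Neg ?d \<odot> e1 ?d')))) \<ominus>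
    (e1 ?c \<odot> (g Pos ?c' \<odot> (B \<odot> (e2 ?d' \<odot> g Neg ?d'))))"
    using assms eq by (simp add: fold_def cell_simps m_assoc v_assoc h_assoc)
  also have "\<dots> = (g Pos ?c \<ominus> e1 ?c) \<odot> ((e2 ?c \<ominus> g Pos ?c') \<odot> ((A \<ominus> B) \<odot>
     ((g Neg ?d \<ominus> e2 ?d') \<odot> (e1 ?d' \<ominus> g Neg ?d'))))"
    using assms eq
    by (simp add: cell_simps exchange del: h_unit_left' h_unit_right' v_unit_right' v_unit_left')
  finally show ?thesis
    using assms eq by (simp add: fold_def cell_simps m_assoc v_assoc h_assoc g_neg_m g_pos_m)
qed

text \<open>In the array on the right-hand side the two connections on the common edge
  \<open>d2 Neg B\<close> lie above each other and cancel.\<close>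

lemma fold_h:
  assumes "A \<in> S" "B \<in> S" "d2 Pos A = d2 Neg B"
  shows "fold (A \<odot> B) = (e1 (d1 Neg A) \<odot> fold B) \<ominus> (fold A \<odot> e1 (d1 Pos B))"
proof -
  let ?c = "d2 Neg A" and ?f = "d2 Neg B" and ?d = "d2 Pos B"
  have eq: "d Pos (d1 Neg A) = d Neg (d1 Neg B)" "d Pos (d1 Pos A) = d Neg (d1 Pos B)"
    using assms by (simp_all add: d_d1)
  have "(e1 (d1 Neg A) \<odot> fold B) \<ominus> (fold A \<odot> e1 (d1 Pos B)) =
    (e1 (u (d Neg ?c)) \<odot> (e1 (d1 Neg A) \<odot> (g Pos ?f \<odot> (B \<odot> g Neg ?d)))) \<ominus>
    (g Pos ?c \<odot> (A \<odot> (g Neg ?f \<odot> (e1 (d1 Pos B) \<odot> e1 (u (d Pos ?d))))))"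
    using assms eq by (simp add: fold_def cell_simps m_assoc v_assoc h_assoc)
  also have "\<dots> = g Pos ?c \<odot> (A \<odot> (e2 ?f \<odot> (B \<odot> g Neg ?d)))"
    using assms eq
    by (simp add: cell_simps exchange g_v_cancel del: h_unit_left' h_unit_right' h_unit_left_u h_unit_right_u)
  finally show ?thesis
    using assms eq by (simp add: fold_def cell_simps m_assoc v_assoc h_assoc)
qed

lemma fold_e1: "x \<in> E \<Longrightarrow> fold (e1 x) = e1 x"
  and fold_e2: "x \<in> E \<Longrightarrow> fold (e2 x) = e1 x"
  and fold_g: "x \<in> E \<Longrightarrow> fold (g \<alpha> x) = e1 x"
proof -
  show "x \<in> E \<Longrightarrow> fold (e1 x) = e1 x"
    by (simp add: fold_def cell_simps)
  show "x \<in> E \<Longrightarrow> fold (e2 x) = e1 x"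
    by (simp add: fold_def cell_simps g_h_cancel)
  show "x \<in> E \<Longrightarrow> fold (g \<alpha> x) = e1 x"
    by (cases \<alpha>; simp add: fold_def cell_simps g_h_cancel)
qed

text \<open>Connections on degenerate edges are units, so gluing them on changes nothing.\<close>

lemma fold_globular:
  assumes "A \<in> S" "p \<in> P" "q \<in> P" "d2 Neg A = u p" "d2 Pos A = u q"
  shows "fold A = A"
  using assms by (simp add: fold_def cell_simps)

section \<open>Inverses of edges and squares\<close>

definition m_inverse :: "'a \<Rightarrow> 'a \<Rightarrow> bool" where
  "m_inverse x y \<longleftrightarrow> x \<in> E \<and> y \<in> E \<and> d Pos x = d Neg y \<and> d Pos y = d Neg x \<and>
     x \<cdot> y = u (d Neg x) \<and> y \<cdot> x = u (d Pos x)"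

definition v_inverse :: "'a \<Rightarrow> 'a \<Rightarrow> bool" where
  "v_inverse A B \<longleftrightarrow> A \<in> S \<and> B \<in> S \<and> d1 Pos A = d1 Neg B \<and> d1 Pos B = d1 Neg A \<and>
     A \<ominus> B = e1 (d1 Neg A) \<and> B \<ominus> A = e1 (d1 Pos A)"

definition h_inverse :: "'a \<Rightarrow> 'a \<Rightarrow> bool" where
  "h_inverse A B \<longleftrightarrow> A \<in> S \<and> B \<in> S \<and> d2 Pos A = d2 Neg B \<and> d2 Pos B = d2 Neg A \<and>
     A \<odot> B = e2 (d2 Neg A) \<and> B \<odot> A = e2 (d2 Pos A)"

lemma v_inverse_sym: "v_inverse A B \<Longrightarrow> v_inverse B A"
  by (simp add: v_inverse_def)

lemma v_inverse_unique:
  assumes "v_inverse A B" "v_inverse A B'"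
  shows "B = B'"
proof -
  have "B = B \<ominus> (A \<ominus> B')"
    using assms by (simp add: v_inverse_def cell_simps)
  also have "\<dots> = (B \<ominus> A) \<ominus> B'"
    using assms v_assoc[of B A B'] by (auto simp: v_inverse_def)
  also have "\<dots> = B'"
    using assms by (simp add: v_inverse_def cell_simps)
  finally show ?thesis .
qed

lemma v_inverse_e1: "x \<in> E \<Longrightarrow> v_inverse (e1 x) (e1 x)"
  by (simp add: v_inverse_def cell_simps)

lemma v_inverse_v:
  assumes "v_inverse A A'" "v_inverse B B'" "d1 Pos A = d1 Neg B"
  shows "v_inverse (A \<ominus> B) (B' \<ominus> A')"
proof -
  have "(A \<ominus> B) \<ominus> (B' \<ominus> A') = A \<ominus> ((B \<ominus> B') \<ominus> A')" "(B' \<ominus> A') \<ominus> (A \<ominus> B) = B' \<ominus> ((A' \<ominus> A) \<ominus> B)"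
    using assms v_assoc[of A B "B' \<ominus> A'"] v_assoc[of B B' A'] v_assoc[of B' A' "A \<ominus> B"] v_assoc[of A' A B]
    unfolding v_inverse_def by (auto simp: v_in d1_v_neg d1_v_pos)
  then show ?thesis
    using assms by (simp add: v_inverse_def cell_simps)
qed

section \<open>T-inverses as inverse foldings\<close>

definition transposed :: "'a \<Rightarrow> 'a \<Rightarrow> bool" where
  "transposed A B \<longleftrightarrow> A \<in> S \<and> B \<in> S \<and> (\<forall>\<alpha>. d1 \<alpha> A = d2 \<alpha> B \<and> d2 \<alpha> A = d1 \<alpha> B)"

definition T_eq :: "'a \<Rightarrow> 'a \<Rightarrow> bool" where
  "T_eq A B \<longleftrightarrow> (g Pos (d2 Neg A) \<ominus> B) \<odot> (A \<ominus> g Neg (d1 Pos A)) =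
     g Neg (d1 Neg A) \<ominus> g Pos (d2 Pos A)"

definition T_inv :: "'a \<Rightarrow> 'a \<Rightarrow> bool" where
  "T_inv A B \<longleftrightarrow> transposed A B \<and> T_eq A B \<and> T_eq B A"

text \<open>Both sides of \<open>T_eq\<close> have the same boundary, so by \<open>fold_eqI\<close>
  they agree as soon as their foldings do. The left side folds to
  \<open>fold A \<ominus> fold B\<close>, the right side to a degenerate square.\<close>

lemma T_eq_iff:
  assumes "transposed A B"
  shows "T_eq A B \<longleftrightarrow> fold A \<ominus> fold B = e1 (d1 Neg (fold A))"
proof -
  let ?L = "(g Pos (d2 Neg A) \<ominus> B) \<odot> (A \<ominus> g Neg (d1 Pos A))"
  let ?R = "g Neg (d1 Neg A) \<ominus> g Pos (d2 Pos A)"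
  have A: "A \<in> S" "B \<in> S" and
    t: "d1 Neg B = d2 Neg A" "d1 Pos B = d2 Pos A" "d2 Neg B = d1 Neg A" "d2 Pos B = d1 Pos A"
    using assms by (auto simp: transposed_def)
  \<comment> \<open>Corners are expressed here through \<open>d1\<close>-faces. Since
    \<open>d_d1\<close> rewrites the other way, it is removed below to avoid a loop.\<close>
  have t': "d Neg (d2 Neg A) = d Neg (d1 Neg A)" "d Neg (d2 Pos A) = d Pos (d1 Neg A)"
    "d Pos (d2 Neg A) = d Neg (d1 Pos A)" "d Pos (d2 Pos A) = d Pos (d1 Pos A)"
    using A d_d1 by metis+
  \<comment> \<open>Connections fold to degenerate squares, so stacking one of them on a square
    leaves the folding unchanged here.\<close>
  have "fold (g Pos (d2 Neg A) \<ominus> B) = fold B" "fold (A \<ominus> g Neg (d1 Pos A)) = fold A"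
    using A t t' by (simp_all add: fold_v fold_g fold_simps cell_simps e1_m[symmetric] del: d_d1)
  then have L: "fold ?L = fold A \<ominus> fold B"
    using A t t' by (simp add: fold_h fold_simps cell_simps del: d_d1)
  have R: "fold ?R = e1 (d1 Neg (fold A))"
    using A t t' by (simp add: fold_v fold_g fold_simps cell_simps e1_m[symmetric] del: d_d1)
  have "?L \<in> S" "?R \<in> S"
    using A t t' by (simp_all add: cell_simps del: d_d1)
  moreover have "d1 \<alpha> ?L = d1 \<alpha> ?R" "d2 \<alpha> ?L = d2 \<alpha> ?R" for \<alpha>
    using A t t' by (cases \<alpha>; simp add: cell_simps del: d_d1)+
  ultimately show ?thesis
    unfolding T_eq_def using fold_eqI L R by metis
qed

text \<open>Applying \<open>T_eq_iff\<close> to both orders of the pair gives the two equations of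
  \<open>v_inverse\<close>. Composability is automatic, because transposed squares have foldings
  with opposite \<open>d1\<close>-boundaries.\<close>

lemma T_inv_iff: "T_inv A B \<longleftrightarrow> transposed A B \<and> v_inverse (fold A) (fold B)"
proof (cases "transposed A B")
  case True
  then have "transposed B A"
    by (auto simp: transposed_def)
  have d: "d1 Neg (fold B) = d1 Pos (fold A)" "d1 Pos (fold B) = d1 Neg (fold A)"
    using True by (auto simp: transposed_def fold_simps)
  with True \<open>transposed B A\<close> show ?thesis
    by (auto simp: T_inv_def v_inverse_def T_eq_iff fold_in transposed_def)
qed (simp add: T_inv_def)

lemma T_inv_sym: "T_inv A B \<Longrightarrow> T_inv B A"
  by (auto simp: T_inv_def transposed_def)

lemma T_inv_unique:
  assumes "T_inv A B" "T_inv A B'"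
  shows "B = B'"
proof (rule fold_eqI)
  show "fold B = fold B'"
    using assms v_inverse_unique by (auto simp: T_inv_iff)
qed (use assms in \<open>auto simp: T_inv_def transposed_def\<close>)

text \<open>Unfolding \<open>F\<close> along the transposed boundary of \<open>A\<close> yields a
  square whose folding is \<open>F\<close>, and \<open>T_inv_iff\<close> applies.\<close>

lemma T_inv_exists:
  assumes "A \<in> S" "v_inverse (fold A) F"
  shows "\<exists>B. T_inv A B"
proof -
  let ?a = "d1 Neg A" and ?b = "d1 Pos A" and ?c = "d2 Neg A" and ?d = "d2 Pos A"
  \<comment> \<open>This is the expression of \<open>fold_unfold\<close> with \<open>F\<close> as
    the folding and the faces of \<open>A\<close> exchanged between the two directions.\<close>
  let ?B = "(e1 ?c \<odot> g Pos ?b) \<ominus> (F \<ominus> (g Neg ?a \<odot> e1 ?d))"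
  have t': "d Neg ?c = d Neg ?a" "d Neg ?d = d Pos ?a" "d Pos ?c = d Neg ?b" "d Pos ?d = d Pos ?b"
    using assms d_d1 by metis+
  have F: "F \<in> S" "d1 Neg F = ?c \<cdot> ?b" "d1 Pos F = ?a \<cdot> ?d" and
     FF: "fold A \<ominus> F = e1 (?a \<cdot> ?d)"
    using assms by (simp_all add: v_inverse_def fold_simps)
  have dd: "d \<beta> (d2 \<alpha> F) = d \<alpha> (d1 \<beta> F)" for \<alpha> \<beta>
    using F d_d1 by metis
  \<comment> \<open>The \<open>d2\<close>-faces of \<open>fold A\<close> are units, so comparing
    \<open>d2\<close>-faces of the degenerate composite shows that those of \<open>F\<close> are
    units too. Hence \<open>fold_globular\<close> applies to \<open>F\<close>.\<close>
  have "d2 \<alpha> (fold A \<ominus> F) = d2 \<alpha> (e1 (?a \<cdot> ?d))" for \<alpha>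
    using FF by simp
  then have "d2 \<alpha> (fold A) \<cdot> d2 \<alpha> F = u (d \<alpha> (?a \<cdot> ?d))" for \<alpha>
    using assms F t' by (simp add: d2_v fold_simps d2_e1 m_in d1_in d2_in)
  from this[of Neg] this[of Pos] have G: "d2 Neg F = u (d Neg ?a)" "d2 Pos F = u (d Pos ?b)"
    using assms F t' by (simp_all add: fold_simps cell_simps dd del: d_d1)
  have fF: "fold F = F"
    using assms F G by (intro fold_globular) (auto simp: d_in d1_in)
  have "fold ?B = F"
    using assms F G t' fF
    by (simp add: fold_v fold_h fold_e1 fold_g fold_simps cell_simps e1_m[symmetric] del: d_d1)
  moreover have "transposed A ?B"
    unfolding transposed_def
  proof (intro conjI allI)
    show "?B \<in> S"
      using assms F G t' by (simp add: cell_simps del: d_d1)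
    fix \<alpha>
    show "d1 \<alpha> A = d2 \<alpha> ?B"
      using assms F G t' by (cases \<alpha>; simp add: cell_simps del: d_d1)
    show "d2 \<alpha> A = d1 \<alpha> ?B"
      using assms F G t' by (cases \<alpha>; simp add: cell_simps del: d_d1)
  qed fact
  ultimately show ?thesis
    using assms by (auto simp: T_inv_iff)
qed

lemma T_inv_e: "x \<in> E \<Longrightarrow> T_inv (e1 x) (e2 x)"
  by (simp add: T_inv_iff transposed_def fold_e1 fold_e2 v_inverse_e1 cell_simps)

lemma T_inv_g: "x \<in> E \<Longrightarrow> T_inv (g \<alpha> x) (g \<alpha> x)"
proof -
  assume x: "x \<in> E"
  have "d1 \<beta> (g \<alpha> x) = d2 \<beta> (g \<alpha> x)" for \<beta>
    using x by (cases \<alpha>; cases \<beta>) (simp_all add: cell_simps)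
  then show ?thesis
    using x by (simp add: T_inv_iff transposed_def fold_g v_inverse_e1 g_in)
qed

lemma v_inverse_h:
  assumes "v_inverse A A'" "v_inverse B B'" "d2 Pos A = d2 Neg B" "d2 Pos A' = d2 Neg B'"
  shows "v_inverse (A \<odot> B) (A' \<odot> B')"
proof -
  have *: "d Pos (d1 Neg A) = d Neg (d1 Neg B)" "d Pos (d1 Pos A) = d Neg (d1 Pos B)"
    using assms by (simp_all add: d_d1 v_inverse_def)
  show ?thesis
    using assms * by (simp add: v_inverse_def exchange h_in d1_h e1_m d1_in)
qed

text \<open>By \<open>fold_v\<close> and \<open>fold_h\<close> the foldings of the two composites
  consist of two padded factors each, in opposite orders, and corresponding factors are inverse to
  each other.\<close>

lemma T_inv_v:
  assumes "T_inv A A'" "T_inv B B'" "d1 Pos A = d1 Neg B"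
  shows "T_inv (A \<ominus> B) (A' \<odot> B')"
proof -
  have S: "A \<in> S" "A' \<in> S" "B \<in> S" "B' \<in> S" and
    t: "d1 \<alpha> A' = d2 \<alpha> A" "d2 \<alpha> A' = d1 \<alpha> A" "d1 \<alpha> B' = d2 \<alpha> B" "d2 \<alpha> B' = d1 \<alpha> B" and
    v: "v_inverse (fold A) (fold A')" "v_inverse (fold B) (fold B')" for \<alpha>
    using assms by (auto simp: T_inv_iff transposed_def)
  have t': "d Neg (d2 \<alpha> B) = d Pos (d2 \<alpha> A)" for \<alpha>
    using assms(3) S d_d1 by metis
  have "v_inverse ((fold A \<odot> e1 (d2 Pos B)) \<ominus> (e1 (d2 Neg A) \<odot> fold B))
     ((e1 (d2 Neg A) \<odot> fold B') \<ominus> (fold A' \<odot> e1 (d2 Pos B)))"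
    by (intro v_inverse_v v_inverse_h v v_inverse_e1)
      (use S t t' assms in \<open>simp_all add: fold_simps cell_simps m_assoc\<close>)
  moreover have "fold (A \<ominus> B) = (fold A \<odot> e1 (d2 Pos B)) \<ominus> (e1 (d2 Neg A) \<odot> fold B)"
    "fold (A' \<odot> B') = (e1 (d2 Neg A) \<odot> fold B') \<ominus> (fold A' \<odot> e1 (d2 Pos B))"
    using S t assms by (simp_all add: fold_v fold_h)
  ultimately have "v_inverse (fold (A \<ominus> B)) (fold (A' \<odot> B'))"
    by simp
  moreover have "transposed (A \<ominus> B) (A' \<odot> B')"
  proof -
    have "d1 \<alpha> (A \<ominus> B) = d2 \<alpha> (A' \<odot> B')" for \<alpha>
      using S t assms by (cases \<alpha>; simp add: cell_simps)
    then show ?thesis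
      using S t assms by (simp add: transposed_def cell_simps)
  qed
  ultimately show ?thesis
    by (simp add: T_inv_iff)
qed

lemma T_inv_h:
  assumes "T_inv A A'" "T_inv B B'" "d2 Pos A = d2 Neg B"
  shows "T_inv (A \<odot> B) (A' \<ominus> B')"
proof -
  have "d1 Pos A' = d1 Neg B'"
    using assms by (auto simp: T_inv_def transposed_def)
  then show ?thesis
    using assms T_inv_v T_inv_sym by metis
qed

section \<open>Inverting connections and unfolded squares\<close>

text \<open>One composite reduces to \<open>e2 (z \<cdot> x)\<close> by cancelling connections. The
  other has the boundary and the folding of \<open>e1 x\<close>, so \<open>fold_eqI\<close>
  identifies them.\<close>

lemma v_inverse_g_neg:
  assumes "m_inverse x z"
  shows "v_inverse (g Neg x) (e2 z \<ominus> g Pos x)"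
proof -
  let ?A = "g Neg x" and ?B = "e2 z \<ominus> g Pos x"
  have x: "x \<in> E" "z \<in> E" "d Neg z = d Pos x" "d Pos z = d Neg x" "x \<cdot> z = u (d Neg x)" "z \<cdot> x = u (d Pos x)"
    using assms by (simp_all add: m_inverse_def)
  have B: "fold ?B = e1 (u (d Pos x))"
    using x by (simp add: fold_v fold_g fold_e2 cell_simps e1_m[symmetric])
  have "fold (?A \<ominus> ?B) = fold (e1 x)"
    using x B by (simp add: fold_v[of "g Neg x" "e2 z \<ominus> g Pos x"] fold_g fold_e1 cell_simps)
  then have 1: "?A \<ominus> ?B = e1 x"
  proof (rule fold_eqI[rotated 2])
    show "d1 \<alpha> (?A \<ominus> ?B) = d1 \<alpha> (e1 x)" "d2 \<alpha> (?A \<ominus> ?B) = d2 \<alpha> (e1 x)" for \<alpha>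
      using x by (cases \<alpha>; simp add: cell_simps)+
  qed (use x in \<open>simp_all add: cell_simps\<close>)
  have "?B \<ominus> ?A = e2 z \<ominus> (g Pos x \<ominus> g Neg x)"
    using x by (simp add: v_assoc cell_simps)
  also have "\<dots> = e2 (z \<cdot> x)"
    using x by (simp add: g_v_cancel e2_m[symmetric])
  finally show ?thesis
    using x 1 by (simp add: v_inverse_def cell_simps)
qed

lemma v_inverse_g_pos:
  assumes "m_inverse x z"
  shows "v_inverse (g Pos x) (g Neg x \<ominus> e2 z)"
proof -
  let ?A = "g Pos x" and ?B = "g Neg x \<ominus> e2 z"
  have x: "x \<in> E" "z \<in> E" "d Neg z = d Pos x" "d Pos z = d Neg x" "x \<cdot> z = u (d Neg x)" "z \<cdot> x = u (d Pos x)"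
    using assms by (simp_all add: m_inverse_def)
  have B: "fold ?B = e1 (u (d Neg x))"
    using x by (simp add: fold_v fold_g fold_e2 cell_simps e1_m[symmetric])
  have "fold (?B \<ominus> ?A) = fold (e1 x)"
    using x B by (simp add: fold_v[of "g Neg x \<ominus> e2 z" "g Pos x"] fold_g fold_e1 cell_simps)
  then have 1: "?B \<ominus> ?A = e1 x"
  proof (rule fold_eqI[rotated 2])
    show "d1 \<alpha> (?B \<ominus> ?A) = d1 \<alpha> (e1 x)" "d2 \<alpha> (?B \<ominus> ?A) = d2 \<alpha> (e1 x)" for \<alpha>
      using x by (cases \<alpha>; simp add: cell_simps)+
  qed (use x in \<open>simp_all add: cell_simps\<close>)
  have "?A \<ominus> ?B = (g Pos x \<ominus> g Neg x) \<ominus> e2 z"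
    using x by (simp add: v_assoc cell_simps)
  also have "\<dots> = e2 (x \<cdot> z)"
    using x by (simp add: g_v_cancel e2_m[symmetric])
  finally show ?thesis
    using x 1 by (simp add: v_inverse_def cell_simps)
qed

text \<open>\<open>fold_unfold\<close> writes \<open>A\<close> as a vertical composite of three
  factors. The middle one is invertible by assumption, the outer two because their connections lie
  on invertible edges.\<close>

lemma v_inverse_unfold:
  assumes "A \<in> S" "v_inverse (fold A) F" "m_inverse (d2 Neg A) y" "m_inverse (d2 Pos A) z"
  shows "\<exists>A'. v_inverse A A'"
proof -
  let ?a = "d1 Neg A" and ?b = "d1 Pos A" and ?c = "d2 Neg A" and ?d = "d2 Pos A"
  have in_E: "?a \<in> E" "?b \<in> E" "?c \<in> E" "?d \<in> E"
    using assms by (simp_all add: cell_simps)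
  have y: "y \<in> E" "d Neg y = d Pos ?c" "d Pos y = d Neg ?c" "?c \<cdot> y = u (d Neg ?c)"
    and z: "z \<in> E" "d Neg z = d Pos ?d" "d Pos z = d Neg ?d" "?d \<cdot> z = u (d Neg ?d)"
    using assms by (simp_all add: m_inverse_def)
  have t': "d Neg ?c = d Neg ?a" "d Neg ?d = d Pos ?a" "d Pos ?c = d Neg ?b" "d Pos ?d = d Pos ?b"
    using assms d_d1 by metis+
  have F: "d1 Neg F = ?c \<cdot> ?b" "d1 Pos (fold A) = ?c \<cdot> ?b" "d1 Neg (fold A) = ?a \<cdot> ?d"
    using assms by (auto simp: v_inverse_def fold_simps)
  have 1: "v_inverse (e1 ?a \<odot> g Pos ?d) (e1 ?a \<odot> (g Neg ?d \<ominus> e2 z))"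
    by (intro v_inverse_h v_inverse_e1 v_inverse_g_pos assms)
      (use in_E y z t' in \<open>simp_all add: cell_simps del: d_d1\<close>)
  have 2: "v_inverse (g Neg ?c \<odot> e1 ?b) ((e2 y \<ominus> g Pos ?c) \<odot> e1 ?b)"
    by (intro v_inverse_h v_inverse_e1 v_inverse_g_neg assms)
      (use in_E y z t' assms(3) in \<open>simp_all add: cell_simps m_inverse_def del: d_d1\<close>)
  have 3: "d1 Pos (fold A) = d1 Neg (g Neg ?c \<odot> e1 ?b)"
    "d1 Pos (e1 ?a \<odot> g Pos ?d) = d1 Neg (fold A \<ominus> (g Neg ?c \<odot> e1 ?b))"
    using in_E t' assms(1) by (simp_all add: F fold_simps cell_simps del: d_d1)
  show ?thesis
    using v_inverse_v[OF 1 v_inverse_v[OF assms(2) 2 3(1)] 3(2)] fold_unfold[OF assms(1)] by auto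
qed

text \<open>Folding \<open>B \<ominus> B'\<close> gives a degenerate composite of a padded
  \<open>fold B\<close> and a padded \<open>fold B'\<close>. The first factor is invertible, hence
  so is the second, and its padding can be removed.\<close>

lemma v_inverse_fold_inverse:
  assumes "v_inverse B B'" "v_inverse (fold B) (fold A)" "transposed A B"
  shows "\<exists>F. v_inverse (fold B') F"
proof -
  have B: "B \<in> S" "B' \<in> S" "d1 Pos B = d1 Neg B'" "d1 Pos B' = d1 Neg B"
    "B \<ominus> B' = e1 (d1 Neg B)" "B' \<ominus> B = e1 (d1 Pos B)" and
    A: "A \<in> S" "d1 \<alpha> A = d2 \<alpha> B" "d2 \<alpha> A = d1 \<alpha> B" for \<alpha>
    using assms by (auto simp: v_inverse_def transposed_def)
  have dd: "d \<beta> (d2 \<alpha> B) = d \<alpha> (d1 \<beta> B)" "d \<beta> (d2 \<alpha> B') = d \<alpha> (d1 \<beta> B')" for \<alpha> \<beta>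
    using B d_d1 by metis+
  \<comment> \<open>Taking \<open>d2\<close>-faces of the degenerate composite
    \<open>B' \<ominus> B\<close> gives the relation that removes the padding at the end.\<close>
  have edge: "d2 Neg B' \<cdot> d2 Neg B = u (d Neg (d1 Pos B))"
    using B d2_v[of B' B Neg] d2_e1[of "d1 Pos B" Neg] d1_in by metis
  let ?X = "fold B \<odot> e1 (d2 Pos B')" and ?Y = "e1 (d2 Neg B) \<odot> fold B'" and
    ?X' = "fold A \<odot> e1 (d2 Pos B')"
  have "fold (e1 (d1 Neg B)) = e1 (d1 Neg B)"
    using B by (simp add: fold_e1 d1_in)
  then have XY: "?X \<ominus> ?Y = e1 (d1 Neg B)"
    using fold_v[OF B(1,2,3)] B(5) by simp
  have X: "v_inverse ?X ?X'"
    by (intro v_inverse_h v_inverse_e1 assms)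
     (use A B in \<open>simp_all add: fold_simps cell_simps dd del: d_d1\<close>)
  have Y: "?Y \<in> S" "d1 Pos ?X = d1 Neg ?Y" "d1 Neg ?X = d1 Neg B"
    "d1 Pos ?Y = d1 Neg ?X"
  proof -
    show Y: "?Y \<in> S"
      using A B by (simp add: fold_simps cell_simps dd del: d_d1)
    show Y': "d1 Pos ?X = d1 Neg ?Y"
      using A B by (simp add: fold_simps cell_simps dd m_assoc del: d_d1)
    have "?X \<in> S"
      using X by (simp add: v_inverse_def)
    then have "d1 Neg ?X = d1 Neg (?X \<ominus> ?Y)" "d1 Pos ?Y = d1 Pos (?X \<ominus> ?Y)"
      using Y Y' by (simp_all only: d1_v_neg d1_v_pos)
    then show "d1 Neg ?X = d1 Neg B" "d1 Pos ?Y = d1 Neg ?X"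
      using B by (simp_all only: XY d1_e1 d1_in)
  qed
  \<comment> \<open>\<open>?X'\<close> inverts \<open>?X\<close> and \<open>?X \<ominus> ?Y\<close>
    is degenerate, so \<open>?Y\<close> must be that inverse.\<close>
  have "?X' = ?X' \<ominus> (?X \<ominus> ?Y)"
    using X Y B unfolding XY by (simp add: v_inverse_def v_unit_right')
  also have "\<dots> = (?X' \<ominus> ?X) \<ominus> ?Y"
    using X Y B v_assoc[of ?X' ?X ?Y] by (auto simp: v_inverse_def)
  also have "\<dots> = ?Y"
    using X Y by (simp add: v_inverse_def v_unit_left')
  finally have inv: "v_inverse ?Y ?X"
    using X v_inverse_sym by metis
  have "v_inverse (e1 (d2 Neg B') \<odot> ?Y) (e1 (d2 Neg B') \<odot> ?X)"
    by (intro v_inverse_h v_inverse_e1 inv)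
     (use A B in \<open>simp_all add: fold_simps cell_simps dd del: d_d1\<close>)
  moreover have "e1 (d2 Neg B') \<odot> ?Y = (e1 (d2 Neg B') \<odot> e1 (d2 Neg B)) \<odot> fold B'"
    using A B by (simp add: h_assoc fold_simps cell_simps dd del: d_d1)
  moreover have "\<dots> = fold B'"
    using A B edge by (simp add: e1_m[symmetric] fold_simps cell_simps dd del: d_d1)
  ultimately show ?thesis
    by auto
qed

text \<open>The transpose \<open>A'\<close> of \<open>B'\<close> exists by
  \<open>v_inverse_fold_inverse\<close>. Transposing the degenerate composites of \<open>B\<close>
  and \<open>B'\<close> and using uniqueness of T-inverses turns the vertical inverse laws into
  horizontal ones.\<close>

lemma h_inverse_transpose:
  assumes "T_inv A B" "v_inverse B B'"
  shows "\<exists>A'. h_inverse A A'"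
proof -
  have B: "B \<in> S" "B' \<in> S" "d1 Pos B = d1 Neg B'" "d1 Pos B' = d1 Neg B"
    "B \<ominus> B' = e1 (d1 Neg B)" "B' \<ominus> B = e1 (d1 Pos B)" and
    A: "A \<in> S" "d1 \<alpha> A = d2 \<alpha> B" "d2 \<alpha> A = d1 \<alpha> B" for \<alpha>
    using assms by (auto simp: v_inverse_def T_inv_def transposed_def)
  obtain A' where A': "T_inv B' A'"
    using v_inverse_fold_inverse T_inv_exists assms B v_inverse_sym unfolding T_inv_iff by metis
  then have e: "A' \<in> S" "d2 \<alpha> A' = d1 \<alpha> B'" for \<alpha>
    by (auto simp: T_inv_def transposed_def)
  have "T_inv (B \<ominus> B') (A \<odot> A')" "T_inv (B' \<ominus> B) (A' \<odot> A)"
    using B T_inv_v[OF T_inv_sym[OF assms(1)] A'] T_inv_v[OF A' T_inv_sym[OF assms(1)]] by simp_all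
  then have "A \<odot> A' = e2 (d1 Neg B)" "A' \<odot> A = e2 (d1 Pos B)"
    using B T_inv_e T_inv_unique d1_in by metis+
  then show ?thesis
    using A B e by (auto simp: h_inverse_def)
qed

section \<open>Squares with degenerate folding\<close>

lemma e1_image_h: "\<lbrakk>A \<in> e1 ` E; B \<in> e1 ` E; d2 Pos A = d2 Neg B\<rbrakk> \<Longrightarrow> A \<odot> B \<in> e1 ` E"
proof (clarsimp, goal_cases)
  case (1 x y)
  then have "d Pos x = d Neg y"
    using d_u d2_e1 d_in by metis
  with 1 show ?case
    by (intro image_eqI[of _ _ "x \<cdot> y"]) (simp_all add: e1_m m_in)
qed

lemma e1_image_v: "\<lbrakk>A \<in> e1 ` E; B \<in> e1 ` E; d1 Pos A = d1 Neg B\<rbrakk> \<Longrightarrow> A \<ominus> B \<in> e1 ` E"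
  by (auto simp: d1_e1 v_unit_left' e1_in)

lemma fold_thin_v:
  assumes "A \<in> S" "B \<in> S" "d1 Pos A = d1 Neg B" "fold A \<in> e1 ` E" "fold B \<in> e1 ` E"
  shows "fold (A \<ominus> B) \<in> e1 ` E"
proof -
  have eq: "d Neg (d2 \<alpha> B) = d Pos (d2 \<alpha> A)" for \<alpha>
    using assms d_d1 by metis
  have "(fold A \<odot> e1 (d2 Pos B)) \<ominus> (e1 (d2 Neg A) \<odot> fold B) \<in> e1 ` E"
    by (intro e1_image_v e1_image_h assms imageI)
      (use assms eq in \<open>simp_all add: fold_simps cell_simps m_assoc\<close>)
  then show ?thesis
    using assms by (simp add: fold_v)
qed

lemma fold_thin_h:
  assumes "A \<in> S" "B \<in> S" "d2 Pos A = d2 Neg B" "fold A \<in> e1 ` E" "fold B \<in> e1 ` E"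
  shows "fold (A \<odot> B) \<in> e1 ` E"
proof -
  have eq: "d \<alpha> (d2 Neg B) = d Pos (d1 \<alpha> A)" "d Neg (d1 \<alpha> B) = d Pos (d1 \<alpha> A)" for \<alpha>
    using assms d_d1 by metis+
  have "(e1 (d1 Neg A) \<odot> fold B) \<ominus> (fold A \<odot> e1 (d1 Pos B)) \<in> e1 ` E"
    by (intro e1_image_v e1_image_h assms imageI)
      (use assms eq in \<open>simp_all add: fold_simps cell_simps m_assoc\<close>)
  then show ?thesis
    using assms by (simp add: fold_h)
qed

text \<open>Folding \<open>A \<odot> B = e2 (d2 Neg A)\<close> with \<open>fold_h\<close> gives a
  degenerate composite whose factor \<open>?X\<close>, coming from \<open>A\<close>, is degenerate.
  So the factor \<open>?Y\<close>, coming from \<open>B\<close>, is degenerate too; its padding is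
  removed by a degenerate square on the inverse edge.\<close>

lemma fold_thin_h_inverse:
  assumes "h_inverse A B" "fold A \<in> e1 ` E"
  shows "fold B \<in> e1 ` E"
proof -
  have B: "A \<in> S" "B \<in> S" "d2 Pos A = d2 Neg B" "d2 Pos B = d2 Neg A"
    "A \<odot> B = e2 (d2 Neg A)" "B \<odot> A = e2 (d2 Pos A)"
    using assms by (auto simp: h_inverse_def)
  have dd: "d \<beta> (d2 \<alpha> A) = d \<alpha> (d1 \<beta> A)" "d \<beta> (d2 \<alpha> B) = d \<alpha> (d1 \<beta> B)" for \<alpha> \<beta>
    using B d_d1 by metis+
  have eq: "d Neg (d1 \<alpha> B) = d Pos (d1 \<alpha> A)" "d Pos (d1 \<alpha> B) = d Neg (d1 \<alpha> A)" for \<alpha>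
    using B dd by metis+
  have edge: "d1 Neg B \<cdot> d1 Neg A = u (d Neg (d1 Neg B))"
    using B eq d1_h[of B A Neg] d1_e2[of "d2 Pos A" Neg] d2_in dd by metis
  let ?Y = "e1 (d1 Neg A) \<odot> fold B" and ?X = "fold A \<odot> e1 (d1 Pos B)"
  have Y: "?Y \<in> S" "d1 Pos ?Y = d1 Neg ?X"
    using B eq by (simp_all add: fold_simps cell_simps dd m_assoc del: d_d1)
  have "?X \<in> e1 ` E"
    by (intro e1_image_h assms imageI) (use B eq in \<open>simp_all add: fold_simps cell_simps dd del: d_d1\<close>)
  then have "?Y \<ominus> ?X = ?Y"
    using Y by (auto simp: d1_e1 v_unit_right')
  also have "?Y \<ominus> ?X = e1 (d2 Neg A)"
    using B fold_h[of A B] by (simp add: fold_e2 d2_in)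
  finally have "?Y \<in> e1 ` E"
    using B(1) d2_in by (metis imageI)
  then have "e1 (d1 Neg B) \<odot> ?Y \<in> e1 ` E"
    by (rule e1_image_h[rotated]) (use B eq in \<open>simp_all add: fold_simps cell_simps dd del: d_d1\<close>)
  moreover have "e1 (d1 Neg B) \<odot> ?Y = (e1 (d1 Neg B) \<odot> e1 (d1 Neg A)) \<odot> fold B"
    using B eq by (simp add: h_assoc fold_simps cell_simps dd del: d_d1)
  moreover have "\<dots> = fold B"
    using B edge eq by (simp add: e1_m[symmetric] fold_simps cell_simps dd del: d_d1)
  ultimately show ?thesis
    by simp
qed

text \<open>The argument of \<open>fold_thin_h_inverse\<close> with \<open>fold_v\<close> in place
  of \<open>fold_h\<close>; the degenerate factor \<open>?X\<close> now comes first.\<close>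

lemma fold_thin_v_inverse:
  assumes "v_inverse A B" "fold A \<in> e1 ` E"
  shows "fold B \<in> e1 ` E"
proof -
  have B: "A \<in> S" "B \<in> S" "d1 Pos A = d1 Neg B" "d1 Pos B = d1 Neg A"
    "A \<ominus> B = e1 (d1 Neg A)" "B \<ominus> A = e1 (d1 Pos A)"
    using assms by (auto simp: v_inverse_def)
  have dd: "d \<beta> (d2 \<alpha> A) = d \<alpha> (d1 \<beta> A)" "d \<beta> (d2 \<alpha> B) = d \<alpha> (d1 \<beta> B)" for \<alpha> \<beta>
    using B d_d1 by metis+
  have edge: "d2 Neg B \<cdot> d2 Neg A = u (d Neg (d1 Neg B))"
    using B d2_v[of B A Neg] d2_e1[of "d1 Pos A" Neg] d1_in by metis
  let ?X = "fold A \<odot> e1 (d2 Pos B)" and ?Y = "e1 (d2 Neg A) \<odot> fold B"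
  have Y: "?Y \<in> S" "d1 Pos ?X = d1 Neg ?Y"
    using B by (simp_all add: fold_simps cell_simps dd m_assoc del: d_d1)
  have "?X \<in> e1 ` E"
    by (intro e1_image_h assms imageI) (use B in \<open>simp_all add: fold_simps cell_simps dd del: d_d1\<close>)
  then have "?X \<ominus> ?Y = ?Y"
    using Y by (auto simp: d1_e1 v_unit_left')
  also have "?X \<ominus> ?Y = e1 (d1 Neg A)"
    using B fold_v[of A B] by (simp add: fold_e1 d1_in)
  finally have "?Y \<in> e1 ` E"
    using B(1) d1_in by (metis imageI)
  then have "e1 (d2 Neg B) \<odot> ?Y \<in> e1 ` E"
    by (rule e1_image_h[rotated]) (use B in \<open>simp_all add: fold_simps cell_simps dd del: d_d1\<close>)
  moreover have "e1 (d2 Neg B) \<odot> ?Y = (e1 (d2 Neg B) \<odot> e1 (d2 Neg A)) \<odot> fold B"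
    using B by (simp add: h_assoc fold_simps cell_simps dd del: d_d1)
  moreover have "\<dots> = fold B"
    using B edge by (simp add: e1_m[symmetric] fold_simps cell_simps dd del: d_d1)
  ultimately show ?thesis
    by simp
qed

end

section \<open>Adjacent directions of a cubical category\<close>

context cubical_omega_category
begin

section \<open>The axioms as rewrite rules\<close>

text \<open>From here on the axioms are restated with successors instead of \<open>n + 1\<close> and
  \<open>n - 1\<close>, and with the cases of \<open>up\<close> and \<open>dn\<close> separated, so
  that simplification can compute boundaries.\<close>

lemma face_in: "\<lbrakk>A \<in> cells C (Suc n); 1 \<le> i; i \<le> Suc n\<rbrakk> \<Longrightarrow> \<partial> (Suc n) i \<alpha> A \<in> cells C n"
  using face_closed[of A "Suc n" i \<alpha>] by simp

lemma degen_in: "\<lbrakk>A \<in> cells C n; 1 \<le> i; i \<le> Suc n\<rbrakk> \<Longrightarrow> \<epsilon> n i A \<in> cells C (Suc n)"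
  using degen_closed[of A n i] by simp

lemma conn_in: "\<lbrakk>A \<in> cells C n; 1 \<le> i; i \<le> n\<rbrakk> \<Longrightarrow> \<Gamma> n i \<alpha> A \<in> cells C (Suc n)"
  using conn_closed[of A n i] by simp

lemma comp_in: "\<lbrakk>A \<in> cells C n; B \<in> cells C n; \<partial> n i Pos A = \<partial> n i Neg B; 1 \<le> i; i \<le> n\<rbrakk> \<Longrightarrow>
    A \<star>\<langle>n,i\<rangle> B \<in> cells C n"
  using comp_closed[of n i A B] by (simp add: composable_def)

lemma face_face': "\<lbrakk>A \<in> cells C (Suc (Suc n)); 1 \<le> i; i \<le> j; j \<le> Suc n\<rbrakk> \<Longrightarrow>
    \<partial> (Suc n) j \<alpha> (\<partial> (Suc (Suc n)) i \<beta> A) = \<partial> (Suc n) i \<beta> (\<partial> (Suc (Suc n)) (Suc j) \<alpha> A)"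
  using face_face[of A "Suc (Suc n)" i "Suc j" \<alpha> \<beta>] by simp

lemma face_degen': "\<lbrakk>A \<in> cells C n; 1 \<le> i; i \<le> Suc n\<rbrakk> \<Longrightarrow> \<partial> (Suc n) i \<alpha> (\<epsilon> n i A) = A"
  using face_degen_same[of A n i] by simp

lemma face_degen_less: "\<lbrakk>A \<in> cells C (Suc n); 1 \<le> i; i \<le> j; j \<le> Suc n\<rbrakk> \<Longrightarrow>
    \<partial> (Suc (Suc n)) i \<alpha> (\<epsilon> (Suc n) (Suc j) A) = \<epsilon> n j (\<partial> (Suc n) i \<alpha> A)"
  using face_degen[of A "Suc n" i "Suc j"] by (simp add: dn_def)

lemma face_degen_greater: "\<lbrakk>A \<in> cells C (Suc n); 1 \<le> j; j \<le> i; i \<le> Suc n\<rbrakk> \<Longrightarrow>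
    \<partial> (Suc (Suc n)) (Suc i) \<alpha> (\<epsilon> (Suc n) j A) = \<epsilon> n j (\<partial> (Suc n) i \<alpha> A)"
  using face_degen[of A "Suc n" "Suc i" j] by (simp add: dn_def)

lemma face_conn_less: "\<lbrakk>A \<in> cells C (Suc n); 1 \<le> i; i \<le> j; j \<le> n\<rbrakk> \<Longrightarrow>
    \<partial> (Suc (Suc n)) i \<alpha> (\<Gamma> (Suc n) (Suc j) \<beta> A) = \<Gamma> n j \<beta> (\<partial> (Suc n) i \<alpha> A)"
  using face_conn[of A "Suc n" i "Suc j"] by (simp add: dn_def)

lemma face_conn_greater: "\<lbrakk>A \<in> cells C (Suc n); 1 \<le> j; j < i; i \<le> Suc n\<rbrakk> \<Longrightarrow>
    \<partial> (Suc (Suc n)) (Suc i) \<alpha> (\<Gamma> (Suc n) j \<beta> A) = \<Gamma> n j \<beta> (\<partial> (Suc n) i \<alpha> A)"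
  using face_conn[of A "Suc n" "Suc i" j] by (simp add: dn_def)

lemma face_conn_same':
  "\<lbrakk>A \<in> cells C n; 1 \<le> j; j \<le> n\<rbrakk> \<Longrightarrow> \<partial> (Suc n) j \<alpha> (\<Gamma> n j \<alpha> A) = A"
  "\<lbrakk>A \<in> cells C n; 1 \<le> j; j \<le> n\<rbrakk> \<Longrightarrow> \<partial> (Suc n) (Suc j) \<alpha> (\<Gamma> n j \<alpha> A) = A"
  using face_conn_same[of A n j] by simp_all

text \<open>The premise \<open>\<alpha> \<noteq> \<beta>\<close> replaces the term
  \<open>opp \<alpha>\<close>, which a concrete sign would not match.\<close>

lemma face_conn_opp':
  assumes "A \<in> cells C (Suc n)" "1 \<le> j" "j \<le> Suc n" "\<alpha> \<noteq> \<beta>"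
  shows "\<partial> (Suc (Suc n)) j \<alpha> (\<Gamma> (Suc n) j \<beta> A) = \<epsilon> n j (\<partial> (Suc n) j \<alpha> A)"
  "\<partial> (Suc (Suc n)) (Suc j) \<alpha> (\<Gamma> (Suc n) j \<beta> A) = \<epsilon> n j (\<partial> (Suc n) j \<alpha> A)"
proof -
  have "\<beta> = opp \<alpha>"
    using assms(4) by (cases \<alpha>; cases \<beta>) simp_all
  with assms show "\<partial> (Suc (Suc n)) j \<alpha> (\<Gamma> (Suc n) j \<beta> A) = \<epsilon> n j (\<partial> (Suc n) j \<alpha> A)"
  "\<partial> (Suc (Suc n)) (Suc j) \<alpha> (\<Gamma> (Suc n) j \<beta> A) = \<epsilon> n j (\<partial> (Suc n) j \<alpha> A)"
    using face_conn_opp[of A "Suc n" j _ \<alpha>] by simp_all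
qed

lemma degen_degen': "\<lbrakk>A \<in> cells C n; 1 \<le> i; i \<le> j; j \<le> Suc n\<rbrakk> \<Longrightarrow>
    \<epsilon> (Suc n) (Suc j) (\<epsilon> n i A) = \<epsilon> (Suc n) i (\<epsilon> n j A)"
  using degen_degen[of A n i j] by simp

lemma conn_conn': "\<lbrakk>A \<in> cells C n; 1 \<le> i; i < j; j \<le> n\<rbrakk> \<Longrightarrow>
    \<Gamma> (Suc n) (Suc j) \<beta> (\<Gamma> n i \<alpha> A) = \<Gamma> (Suc n) i \<alpha> (\<Gamma> n j \<beta> A)"
  using conn_conn[of A n i j] by simp

lemma conn_conn_same': "\<lbrakk>A \<in> cells C n; 1 \<le> i; i \<le> n\<rbrakk> \<Longrightarrow>
    \<Gamma> (Suc n) (Suc i) \<alpha> (\<Gamma> n i \<alpha> A) = \<Gamma> (Suc n) i \<alpha> (\<Gamma> n i \<alpha> A)"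
  using conn_conn_same[of A n i] by simp

lemma conn_degen_less: "\<lbrakk>A \<in> cells C n; 1 \<le> i; i \<le> j; j \<le> n\<rbrakk> \<Longrightarrow>
    \<Gamma> (Suc n) i \<alpha> (\<epsilon> n (Suc j) A) = \<epsilon> (Suc n) (Suc (Suc j)) (\<Gamma> n i \<alpha> A)"
  using conn_degen[of A n i "Suc j"] by (simp add: dn_def up_def)

lemma conn_degen_greater: "\<lbrakk>A \<in> cells C n; 1 \<le> j; j \<le> i; i \<le> n\<rbrakk> \<Longrightarrow>
    \<Gamma> (Suc n) (Suc i) \<alpha> (\<epsilon> n j A) = \<epsilon> (Suc n) j (\<Gamma> n i \<alpha> A)"
  using conn_degen[of A n "Suc i" j] by (simp add: dn_def up_def)

lemma conn_degen_same': "\<lbrakk>A \<in> cells C n; 1 \<le> i; i \<le> Suc n\<rbrakk> \<Longrightarrow>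
    \<Gamma> (Suc n) i \<alpha> (\<epsilon> n i A) = \<epsilon> (Suc n) i (\<epsilon> n i A)"
  using conn_degen_same[of A n i] by simp

lemma face_comp_less: "\<lbrakk>A \<in> cells C (Suc n); B \<in> cells C (Suc n);
    \<partial> (Suc n) (Suc j) Pos A = \<partial> (Suc n) (Suc j) Neg B; 1 \<le> i; i \<le> j; j \<le> n\<rbrakk> \<Longrightarrow>
    \<partial> (Suc n) i \<alpha> (A \<star>\<langle>Suc n,Suc j\<rangle> B) = \<partial> (Suc n) i \<alpha> A \<star>\<langle>n,j\<rangle> \<partial> (Suc n) i \<alpha> B"
  using face_comp[of "Suc n" "Suc j" A B i] by (simp add: dn_def composable_def)

lemma face_comp_greater: "\<lbrakk>A \<in> cells C (Suc n); B \<in> cells C (Suc n);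
    \<partial> (Suc n) j Pos A = \<partial> (Suc n) j Neg B; 1 \<le> j; j \<le> i; i \<le> n\<rbrakk> \<Longrightarrow>
    \<partial> (Suc n) (Suc i) \<alpha> (A \<star>\<langle>Suc n,j\<rangle> B) = \<partial> (Suc n) (Suc i) \<alpha> A \<star>\<langle>n,j\<rangle> \<partial> (Suc n) (Suc i) \<alpha> B"
  using face_comp[of "Suc n" j A B "Suc i"] by (simp add: dn_def composable_def)

lemma face_comp_neg': "\<lbrakk>A \<in> cells C n; B \<in> cells C n; \<partial> n i Pos A = \<partial> n i Neg B; 1 \<le> i; i \<le> n\<rbrakk> \<Longrightarrow>
    \<partial> n i Neg (A \<star>\<langle>n,i\<rangle> B) = \<partial> n i Neg A"
  and face_comp_pos': "\<lbrakk>A \<in> cells C n; B \<in> cells C n; \<partial> n i Pos A = \<partial> n i Neg B; 1 \<le> i; i \<le> n\<rbrakk> \<Longrightarrow>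
    \<partial> n i Pos (A \<star>\<langle>n,i\<rangle> B) = \<partial> n i Pos B"
  using face_comp_neg[of n i A B] face_comp_pos[of n i A B] by (simp_all add: composable_def)

lemma comp_assoc': "\<lbrakk>A \<in> cells C n; B \<in> cells C n; D \<in> cells C n; \<partial> n i Pos A = \<partial> n i Neg B;
     \<partial> n i Pos B = \<partial> n i Neg D; 1 \<le> i; i \<le> n\<rbrakk> \<Longrightarrow>
    (A \<star>\<langle>n,i\<rangle> B) \<star>\<langle>n,i\<rangle> D = A \<star>\<langle>n,i\<rangle> (B \<star>\<langle>n,i\<rangle> D)"
  using comp_assoc[of n i A B D] by (simp add: composable_def)

lemma comp_unit_right: "\<lbrakk>A \<in> cells C (Suc n); 1 \<le> i; i \<le> Suc n; \<partial> (Suc n) i Pos A = x\<rbrakk> \<Longrightarrow>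
    A \<star>\<langle>Suc n,i\<rangle> \<epsilon> n i x = A"
  and comp_unit_left: "\<lbrakk>A \<in> cells C (Suc n); 1 \<le> i; i \<le> Suc n; \<partial> (Suc n) i Neg A = x\<rbrakk> \<Longrightarrow>
    \<epsilon> n i x \<star>\<langle>Suc n,i\<rangle> A = A"
  using comp_right_unit[of A "Suc n" i] comp_left_unit[of A "Suc n" i] by auto

lemma exchange: "\<lbrakk>A \<in> cells C n; B \<in> cells C n; D \<in> cells C n; F \<in> cells C n;
    \<partial> n i Pos A = \<partial> n i Neg B; \<partial> n i Pos D = \<partial> n i Neg F;
    \<partial> n j Pos A = \<partial> n j Neg D; \<partial> n j Pos B = \<partial> n j Neg F; i \<noteq> j; 1 \<le> i; i \<le> n; 1 \<le> j; j \<le> n\<rbrakk> \<Longrightarrow>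
    (A \<star>\<langle>n,i\<rangle> B) \<star>\<langle>n,j\<rangle> (D \<star>\<langle>n,i\<rangle> F) = (A \<star>\<langle>n,j\<rangle> D) \<star>\<langle>n,i\<rangle> (B \<star>\<langle>n,j\<rangle> F)"
  using comp_exchange[of i j n A B D F] by (simp add: composable_def)

lemma degen_comp_le: "\<lbrakk>A \<in> cells C n; B \<in> cells C n; \<partial> n j Pos A = \<partial> n j Neg B; 1 \<le> i; i \<le> j; j \<le> n\<rbrakk> \<Longrightarrow>
    \<epsilon> n i (A \<star>\<langle>n,j\<rangle> B) = \<epsilon> n i A \<star>\<langle>Suc n,Suc j\<rangle> \<epsilon> n i B"
  using degen_comp[of n j A B i] by (simp add: composable_def up_def)

lemma degen_comp_greater: "\<lbrakk>A \<in> cells C n; B \<in> cells C n; \<partial> n j Pos A = \<partial> n j Neg B; 1 \<le> j; j < i; i \<le> Suc n\<rbrakk> \<Longrightarrow>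
    \<epsilon> n i (A \<star>\<langle>n,j\<rangle> B) = \<epsilon> n i A \<star>\<langle>Suc n,j\<rangle> \<epsilon> n i B"
  using degen_comp[of n j A B i] by (simp add: composable_def up_def)

lemma conn_comp_less: "\<lbrakk>A \<in> cells C n; B \<in> cells C n; \<partial> n j Pos A = \<partial> n j Neg B; 1 \<le> i; i < j; j \<le> n\<rbrakk> \<Longrightarrow>
    \<Gamma> n i \<alpha> (A \<star>\<langle>n,j\<rangle> B) = \<Gamma> n i \<alpha> A \<star>\<langle>Suc n,Suc j\<rangle> \<Gamma> n i \<alpha> B"
  using conn_comp[of n j A B i] by (simp add: composable_def up_def)

lemma conn_comp_greater: "\<lbrakk>A \<in> cells C n; B \<in> cells C n; \<partial> n j Pos A = \<partial> n j Neg B; 1 \<le> j; j < i; i \<le> n\<rbrakk> \<Longrightarrow>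
    \<Gamma> n i \<alpha> (A \<star>\<langle>n,j\<rangle> B) = \<Gamma> n i \<alpha> A \<star>\<langle>Suc n,j\<rangle> \<Gamma> n i \<alpha> B"
  using conn_comp[of n j A B i] by (simp add: composable_def up_def)

text \<open>Whichever of the directions \<open>i\<close> and \<open>i + 1\<close> is removed by a
  face, the other one is numbered \<open>i\<close> afterwards. Therefore one category of edges
  serves both directions.\<close>

lemma connection_double_category:
  assumes "1 \<le> i" "i \<le> Suc n"
  shows "connection_double_category (cells C n) (cells C (Suc n)) (cells C (Suc (Suc n)))
    (\<partial> (Suc n) i) (\<epsilon> n i) (\<lambda>x y. x \<star>\<langle>Suc n,i\<rangle> y)
    (\<partial> (Suc (Suc n)) i) (\<partial> (Suc (Suc n)) (Suc i)) (\<epsilon> (Suc n) i) (\<epsilon> (Suc n) (Suc i)) (\<Gamma> (Suc n) i)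
    (\<lambda>A B. A \<star>\<langle>Suc (Suc n),i\<rangle> B) (\<lambda>A B. A \<star>\<langle>Suc (Suc n),Suc i\<rangle> B)"
proof
  show "\<Gamma> (Suc n) i Neg (x \<star>\<langle>Suc n,i\<rangle> y) =
     (\<Gamma> (Suc n) i Neg x \<star>\<langle>Suc (Suc n),i\<rangle> \<epsilon> (Suc n) (Suc i) y) \<star>\<langle>Suc (Suc n),Suc i\<rangle>
     (\<epsilon> (Suc n) i y \<star>\<langle>Suc (Suc n),i\<rangle> \<Gamma> (Suc n) i Neg y)"
    "\<Gamma> (Suc n) i Pos (x \<star>\<langle>Suc n,i\<rangle> y) =
     (\<Gamma> (Suc n) i Pos x \<star>\<langle>Suc (Suc n),i\<rangle> \<epsilon> (Suc n) i x) \<star>\<langle>Suc (Suc n),Suc i\<rangle>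
     (\<epsilon> (Suc n) (Suc i) x \<star>\<langle>Suc (Suc n),i\<rangle> \<Gamma> (Suc n) i Pos y)"
    if "x \<in> cells C (Suc n)" "y \<in> cells C (Suc n)" "\<partial> (Suc n) i Pos x = \<partial> (Suc n) i Neg y" for x y
    using conn_comp_neg[of "Suc n" i x y] conn_comp_pos[of "Suc n" i x y] that assms
    by (simp_all add: composable_def)
  show "\<Gamma> (Suc n) i Pos x \<star>\<langle>Suc (Suc n),i\<rangle> \<Gamma> (Suc n) i Neg x = \<epsilon> (Suc n) (Suc i) x"
    "\<Gamma> (Suc n) i Pos x \<star>\<langle>Suc (Suc n),Suc i\<rangle> \<Gamma> (Suc n) i Neg x = \<epsilon> (Suc n) i x"
    if "x \<in> cells C (Suc n)" for x
    using conn_cancel[of x "Suc n" i] conn_cancel_Suc[of x "Suc n" i] that assms by simp_all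
  show "\<partial> (Suc (Suc n)) i \<alpha> (\<Gamma> (Suc n) i (opp \<alpha>) x) = \<epsilon> n i (\<partial> (Suc n) i \<alpha> x)"
    "\<partial> (Suc (Suc n)) (Suc i) \<alpha> (\<Gamma> (Suc n) i (opp \<alpha>) x) = \<epsilon> n i (\<partial> (Suc n) i \<alpha> x)"
    if "x \<in> cells C (Suc n)" for x \<alpha>
    using that assms by (cases \<alpha>; simp add: face_conn_opp')+
qed (use assms in \<open>simp_all add: face_in degen_in conn_in comp_in face_face' face_degen'
    face_degen_less face_degen_greater face_conn_same' degen_degen' conn_degen_same'
    face_comp_neg' face_comp_pos' face_comp_less face_comp_greater comp_assoc' comp_unit_right comp_unit_left
    exchange degen_comp_le degen_comp_greater\<close>)

abbreviation \<psi> :: "nat \<Rightarrow> nat \<Rightarrow> 'a \<Rightarrow> 'a" where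
  "\<psi> \<equiv> psi C"

text \<open>This extends the notion behind \<open>R1_invertible\<close> to all directions, as the
  induction on foldings requires.\<close>

definition R_inverse :: "nat \<Rightarrow> nat \<Rightarrow> 'a \<Rightarrow> 'a \<Rightarrow> bool" where
  "R_inverse n i A B \<longleftrightarrow> A \<in> cells C n \<and> B \<in> cells C n \<and>
     \<partial> n i Pos A = \<partial> n i Neg B \<and> \<partial> n i Pos B = \<partial> n i Neg A \<and>
     A \<star>\<langle>n,i\<rangle> B = \<epsilon> (n - 1) i (\<partial> n i Neg A) \<and> B \<star>\<langle>n,i\<rangle> A = \<epsilon> (n - 1) i (\<partial> n i Pos A)"

definition R_invertible :: "nat \<Rightarrow> nat \<Rightarrow> 'a \<Rightarrow> bool" where
  "R_invertible n i A \<longleftrightarrow> (\<exists>B. R_inverse n i A B)"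

lemmas boundary_simps = face_in degen_in conn_in comp_in face_face' face_degen' face_degen_less face_degen_greater
  face_conn_less face_conn_greater face_conn_same' face_conn_opp'
  face_comp_less face_comp_greater face_comp_neg' face_comp_pos' comp_unit_right comp_unit_left

definition fold_thin :: "nat \<Rightarrow> nat \<Rightarrow> 'a \<Rightarrow> bool" where
  "fold_thin n i A \<longleftrightarrow> A \<in> cells C n \<and> \<psi> n i A \<in> \<epsilon> (n - 1) i ` cells C (n - 1)"

text \<open>The two foldings involve only the directions \<open>i\<close>, \<open>i + 1\<close> and
  \<open>i + 2\<close>, which are those of the axiom relating symmetries and connections.\<close>

definition thin :: "nat \<Rightarrow> nat \<Rightarrow> 'a \<Rightarrow> bool" where
  "thin n i A \<longleftrightarrow> A \<in> cells C n \<and> fold_thin n i (\<psi> n (Suc i) A)"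

section \<open>Transfer of the results on double categories\<close>

context
  fixes n i :: nat
  assumes i: "1 \<le> i" "i \<le> Suc n"
begin

interpretation D: connection_double_category "cells C n" "cells C (Suc n)" "cells C (Suc (Suc n))"
    "\<partial> (Suc n) i" "\<epsilon> n i" "\<lambda>x y. x \<star>\<langle>Suc n,i\<rangle> y"
    "\<partial> (Suc (Suc n)) i" "\<partial> (Suc (Suc n)) (Suc i)" "\<epsilon> (Suc n) i" "\<epsilon> (Suc n) (Suc i)" "\<Gamma> (Suc n) i"
    "\<lambda>A B. A \<star>\<langle>Suc (Suc n),i\<rangle> B" "\<lambda>A B. A \<star>\<langle>Suc (Suc n),Suc i\<rangle> B"
  by (rule connection_double_category[OF i])

lemma psi_eq_fold: "\<psi> (Suc (Suc n)) i = D.fold"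
  by (simp add: fun_eq_iff psi_def D.fold_def)

lemma R_inverse_eq_v_inverse: "R_inverse (Suc (Suc n)) i = D.v_inverse"
  and R_inverse_eq_h_inverse: "R_inverse (Suc (Suc n)) (Suc i) = D.h_inverse"
  and R_inverse_eq_m_inverse: "R_inverse (Suc n) i = D.m_inverse"
  by (simp_all add: fun_eq_iff R_inverse_def D.v_inverse_def D.h_inverse_def D.m_inverse_def)

lemmas fold_eqs = psi_eq_fold R_inverse_eq_v_inverse R_inverse_eq_h_inverse R_inverse_eq_m_inverse

lemma T_inv_eq: "is_T_inverse C (Suc (Suc n)) i = D.T_inv"
  using i by (auto simp: fun_eq_iff is_T_inverse_def T_equation_def D.T_inv_def D.transposed_def D.T_eq_def)

lemma psi_unfold:
  assumes "A \<in> cells C (Suc (Suc n))"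
  shows "A = (\<epsilon> (Suc n) i (\<partial> (Suc (Suc n)) i Neg A)
       \<star>\<langle>Suc (Suc n),Suc i\<rangle> \<Gamma> (Suc n) i Pos (\<partial> (Suc (Suc n)) (Suc i) Pos A)) \<star>\<langle>Suc (Suc n),i\<rangle>
     (\<psi> (Suc (Suc n)) i A \<star>\<langle>Suc (Suc n),i\<rangle>
      (\<Gamma> (Suc n) i Neg (\<partial> (Suc (Suc n)) (Suc i) Neg A)
       \<star>\<langle>Suc (Suc n),Suc i\<rangle> \<epsilon> (Suc n) i (\<partial> (Suc (Suc n)) i Pos A)))"
  using D.fold_unfold[OF assms(1)] by (simp add: psi_eq_fold)

lemma psi_eqI:
  assumes "A \<in> cells C (Suc (Suc n))" "B \<in> cells C (Suc (Suc n))"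
    "\<psi> (Suc (Suc n)) i A = \<psi> (Suc (Suc n)) i B"
    "\<And>\<alpha>. \<partial> (Suc (Suc n)) i \<alpha> A = \<partial> (Suc (Suc n)) i \<alpha> B"
    "\<And>\<alpha>. \<partial> (Suc (Suc n)) (Suc i) \<alpha> A = \<partial> (Suc (Suc n)) (Suc i) \<alpha> B"
  shows "A = B"
  using assms D.fold_eqI unfolding psi_eq_fold by blast

lemma psi_degen: "A \<in> cells C (Suc n) \<Longrightarrow> \<psi> (Suc (Suc n)) i (\<epsilon> (Suc n) i A) = \<epsilon> (Suc n) i A"
  and psi_degen_Suc: "A \<in> cells C (Suc n) \<Longrightarrow> \<psi> (Suc (Suc n)) i (\<epsilon> (Suc n) (Suc i) A) = \<epsilon> (Suc n) i A"
  and psi_conn: "A \<in> cells C (Suc n) \<Longrightarrow> \<psi> (Suc (Suc n)) i (\<Gamma> (Suc n) i \<alpha> A) = \<epsilon> (Suc n) i A"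
  using D.fold_e1 D.fold_e2 D.fold_g unfolding psi_eq_fold by simp_all

lemma psi_comp_same: "\<lbrakk>A \<in> cells C (Suc (Suc n)); B \<in> cells C (Suc (Suc n));
    \<partial> (Suc (Suc n)) i Pos A = \<partial> (Suc (Suc n)) i Neg B\<rbrakk> \<Longrightarrow>
  \<psi> (Suc (Suc n)) i (A \<star>\<langle>Suc (Suc n),i\<rangle> B) =
   (\<psi> (Suc (Suc n)) i A \<star>\<langle>Suc (Suc n),Suc i\<rangle> \<epsilon> (Suc n) i (\<partial> (Suc (Suc n)) (Suc i) Pos B))
   \<star>\<langle>Suc (Suc n),i\<rangle>
   (\<epsilon> (Suc n) i (\<partial> (Suc (Suc n)) (Suc i) Neg A) \<star>\<langle>Suc (Suc n),Suc i\<rangle> \<psi> (Suc (Suc n)) i B)"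
  and psi_comp_Suc: "\<lbrakk>A \<in> cells C (Suc (Suc n)); B \<in> cells C (Suc (Suc n));
    \<partial> (Suc (Suc n)) (Suc i) Pos A = \<partial> (Suc (Suc n)) (Suc i) Neg B\<rbrakk> \<Longrightarrow>
  \<psi> (Suc (Suc n)) i (A \<star>\<langle>Suc (Suc n),Suc i\<rangle> B) =
   (\<epsilon> (Suc n) i (\<partial> (Suc (Suc n)) i Neg A) \<star>\<langle>Suc (Suc n),Suc i\<rangle> \<psi> (Suc (Suc n)) i B)
   \<star>\<langle>Suc (Suc n),i\<rangle>
   (\<psi> (Suc (Suc n)) i A \<star>\<langle>Suc (Suc n),Suc i\<rangle> \<epsilon> (Suc n) i (\<partial> (Suc (Suc n)) i Pos B))"
  using D.fold_v D.fold_h unfolding psi_eq_fold by simp_all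

lemma R_invertible_unfold_same:
  assumes A: "A \<in> cells C (Suc (Suc n))" "R_invertible (Suc (Suc n)) i (\<psi> (Suc (Suc n)) i A)"
    and faces: "\<And>\<alpha>. R_invertible (Suc n) i (\<partial> (Suc (Suc n)) (Suc i) \<alpha> A)"
  shows "R_invertible (Suc (Suc n)) i A"
proof -
  show ?thesis
    using assms D.v_inverse_unfold unfolding R_invertible_def fold_eqs by metis
qed

text \<open>The faces of \<open>A\<close> in direction \<open>i\<close> are the faces in direction
  \<open>i + 1\<close> of its T-inverse \<open>B\<close>. So \<open>B\<close> can be inverted in
  direction \<open>i\<close> by unfolding, and transposition gives an inverse of \<open>A\<close> in
  direction \<open>i + 1\<close>.\<close>

lemma R_invertible_unfold_less:
  assumes A: "A \<in> cells C (Suc (Suc n))" "R_invertible (Suc (Suc n)) i (\<psi> (Suc (Suc n)) i A)"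
    and faces: "\<And>\<alpha>. R_invertible (Suc n) i (\<partial> (Suc (Suc n)) i \<alpha> A)"
  shows "R_invertible (Suc (Suc n)) (Suc i) A"
proof -
  obtain B where B: "D.T_inv A B"
    using A D.T_inv_exists unfolding R_invertible_def fold_eqs by blast
  then have "B \<in> cells C (Suc (Suc n))" "D.v_inverse (D.fold B) (D.fold A)"
    "\<And>\<alpha>. \<exists>y. D.m_inverse (\<partial> (Suc (Suc n)) (Suc i) \<alpha> B) y"
    using faces D.v_inverse_sym by (auto simp: D.T_inv_iff D.transposed_def R_invertible_def fold_eqs)
  then obtain B' where "D.v_inverse B B'"
    using D.v_inverse_unfold by metis
  then show ?thesis
    using B D.h_inverse_transpose unfolding R_invertible_def fold_eqs by blast
qed

lemma is_T_inverse_psi: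
  "is_T_inverse C (Suc (Suc n)) i A B \<Longrightarrow>
   R_inverse (Suc (Suc n)) i (\<psi> (Suc (Suc n)) i A) (\<psi> (Suc (Suc n)) i B)"
  by (simp add: T_inv_eq D.T_inv_iff fold_eqs)

lemma is_T_inverse_exists:
  "\<lbrakk>A \<in> cells C (Suc (Suc n)); R_invertible (Suc (Suc n)) i (\<psi> (Suc (Suc n)) i A)\<rbrakk> \<Longrightarrow>
   \<exists>B. is_T_inverse C (Suc (Suc n)) i A B"
  using D.T_inv_exists unfolding T_inv_eq R_invertible_def fold_eqs by blast

lemma is_T_inverse_unique_Suc:
  "\<lbrakk>is_T_inverse C (Suc (Suc n)) i A B; is_T_inverse C (Suc (Suc n)) i A B'\<rbrakk> \<Longrightarrow> B = B'"
  using D.T_inv_unique unfolding T_inv_eq by blast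

lemma is_T_inverse_degen: "A \<in> cells C (Suc n) \<Longrightarrow>
      is_T_inverse C (Suc (Suc n)) i (\<epsilon> (Suc n) i A) (\<epsilon> (Suc n) (Suc i) A)"
  and is_T_inverse_conn: "A \<in> cells C (Suc n) \<Longrightarrow>
      is_T_inverse C (Suc (Suc n)) i (\<Gamma> (Suc n) i \<alpha> A) (\<Gamma> (Suc n) i \<alpha> A)"
  and is_T_inverse_comp_same: "\<lbrakk>is_T_inverse C (Suc (Suc n)) i A A'; is_T_inverse C (Suc (Suc n)) i B B';
       \<partial> (Suc (Suc n)) i Pos A = \<partial> (Suc (Suc n)) i Neg B\<rbrakk> \<Longrightarrow>
      is_T_inverse C (Suc (Suc n)) i (A \<star>\<langle>Suc (Suc n),i\<rangle> B) (A' \<star>\<langle>Suc (Suc n),Suc i\<rangle> B')"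
  and is_T_inverse_comp_Suc: "\<lbrakk>is_T_inverse C (Suc (Suc n)) i A A'; is_T_inverse C (Suc (Suc n)) i B B';
       \<partial> (Suc (Suc n)) (Suc i) Pos A = \<partial> (Suc (Suc n)) (Suc i) Neg B\<rbrakk> \<Longrightarrow>
      is_T_inverse C (Suc (Suc n)) i (A \<star>\<langle>Suc (Suc n),Suc i\<rangle> B) (A' \<star>\<langle>Suc (Suc n),i\<rangle> B')"
  using D.T_inv_e D.T_inv_g D.T_inv_v D.T_inv_h by (simp_all add: T_inv_eq)

lemma degen_image_eqI:
  assumes "A \<in> \<epsilon> (Suc n) i ` cells C (Suc n)" "B \<in> \<epsilon> (Suc n) i ` cells C (Suc n)"
    "\<partial> (Suc (Suc n)) i \<alpha> A = \<partial> (Suc (Suc n)) i \<alpha> B"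
  shows "A = B"
  using assms i by (auto simp: face_degen')

lemma fold_thin_degen: "A \<in> cells C (Suc n) \<Longrightarrow> fold_thin (Suc (Suc n)) i (\<epsilon> (Suc n) i A)"
  and fold_thin_degen_Suc: "A \<in> cells C (Suc n) \<Longrightarrow> fold_thin (Suc (Suc n)) i (\<epsilon> (Suc n) (Suc i) A)"
  and fold_thin_conn: "A \<in> cells C (Suc n) \<Longrightarrow> fold_thin (Suc (Suc n)) i (\<Gamma> (Suc n) i \<alpha> A)"
  using i by (simp_all add: fold_thin_def psi_degen psi_degen_Suc psi_conn degen_in conn_in)

lemma fold_thin_comp_same:
  "\<lbrakk>fold_thin (Suc (Suc n)) i A; fold_thin (Suc (Suc n)) i B; \<partial> (Suc (Suc n)) i Pos A = \<partial> (Suc (Suc n)) i Neg B\<rbrakk> \<Longrightarrow>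
   fold_thin (Suc (Suc n)) i (A \<star>\<langle>Suc (Suc n),i\<rangle> B)"
  and fold_thin_comp_Suc:
  "\<lbrakk>fold_thin (Suc (Suc n)) i A; fold_thin (Suc (Suc n)) i B; \<partial> (Suc (Suc n)) (Suc i) Pos A = \<partial> (Suc (Suc n)) (Suc i) Neg B\<rbrakk> \<Longrightarrow>
   fold_thin (Suc (Suc n)) i (A \<star>\<langle>Suc (Suc n),Suc i\<rangle> B)"
  and fold_thin_R_inverse:
  "\<lbrakk>R_inverse (Suc (Suc n)) i A B; fold_thin (Suc (Suc n)) i A\<rbrakk> \<Longrightarrow> fold_thin (Suc (Suc n)) i B"
  and fold_thin_R_inverse_Suc:
  "\<lbrakk>R_inverse (Suc (Suc n)) (Suc i) A B; fold_thin (Suc (Suc n)) i A\<rbrakk> \<Longrightarrow> fold_thin (Suc (Suc n)) i B"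
  using i D.fold_thin_v[of A B] D.fold_thin_h[of A B] D.fold_thin_v_inverse[of A B] D.fold_thin_h_inverse[of A B]
  by (auto simp: fold_thin_def fold_eqs comp_in R_inverse_def D.v_inverse_def D.h_inverse_def)

end

section \<open>Invertibility of foldings\<close>

lemma psi_in: "\<lbrakk>A \<in> cells C (Suc (Suc n)); 1 \<le> i; i \<le> Suc n\<rbrakk> \<Longrightarrow> \<psi> (Suc (Suc n)) i A \<in> cells C (Suc (Suc n))"
  by (simp add: psi_def boundary_simps)

lemma face_psi:
  assumes "A \<in> cells C (Suc (Suc n))" "1 \<le> i" "i \<le> Suc n"
  shows "\<partial> (Suc (Suc n)) i Neg (\<psi> (Suc (Suc n)) i A) =
      \<partial> (Suc (Suc n)) i Neg A \<star>\<langle>Suc n,i\<rangle> \<partial> (Suc (Suc n)) (Suc i) Pos A"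
    and "\<partial> (Suc (Suc n)) i Pos (\<psi> (Suc (Suc n)) i A) =
      \<partial> (Suc (Suc n)) (Suc i) Neg A \<star>\<langle>Suc n,i\<rangle> \<partial> (Suc (Suc n)) i Pos A"
    and "\<partial> (Suc (Suc n)) (Suc i) \<alpha> (\<psi> (Suc (Suc n)) i A) =
      \<epsilon> n i (\<partial> (Suc n) i \<alpha> (\<partial> (Suc (Suc n)) (Suc i) \<alpha> A))"
  using assms by (cases \<alpha>; simp add: psi_def boundary_simps)+

lemma face_psi_less:
  assumes "A \<in> cells C (Suc (Suc (Suc n)))" "1 \<le> j" "j \<le> i" "i \<le> Suc n"
  shows "\<partial> (Suc (Suc (Suc n))) j \<alpha> (\<psi> (Suc (Suc (Suc n))) (Suc i) A) =
    \<psi> (Suc (Suc n)) i (\<partial> (Suc (Suc (Suc n))) j \<alpha> A)"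
  using assms by (simp add: psi_def boundary_simps)

lemma face_psi_greater:
  assumes "A \<in> cells C (Suc (Suc (Suc n)))" "1 \<le> i" "i < j" "j \<le> Suc (Suc n)"
  shows "\<partial> (Suc (Suc (Suc n))) (Suc j) \<alpha> (\<psi> (Suc (Suc (Suc n))) i A) =
    \<psi> (Suc (Suc n)) i (\<partial> (Suc (Suc (Suc n))) (Suc j) \<alpha> A)"
proof -
  \<comment> \<open>Faces must be commuted against the orientation of \<open>face_face'\<close>,
    which is therefore removed below.\<close>
  have "\<partial> (Suc (Suc n)) (Suc i) \<beta> (\<partial> (Suc (Suc (Suc n))) (Suc j) \<alpha> A) =
     \<partial> (Suc (Suc n)) j \<alpha> (\<partial> (Suc (Suc (Suc n))) (Suc i) \<beta> A)" for \<beta>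
    using assms by (simp add: face_face')
  then show ?thesis
    using assms by (simp add: psi_def boundary_simps del: face_face')
qed

section \<open>Inverses under the structure maps\<close>

lemma R_inverse_sym: "R_inverse n i A B \<Longrightarrow> R_inverse n i B A"
  by (simp add: R_inverse_def)

lemma R_inverse_unique:
  assumes "R_inverse (Suc n) i A B" "R_inverse (Suc n) i A B'" "1 \<le> i" "i \<le> Suc n"
  shows "B = B'"
proof -
  have "B = B \<star>\<langle>Suc n,i\<rangle> (A \<star>\<langle>Suc n,i\<rangle> B')"
    using assms by (simp add: R_inverse_def comp_unit_right)
  also have "\<dots> = (B \<star>\<langle>Suc n,i\<rangle> A) \<star>\<langle>Suc n,i\<rangle> B'"
    using assms comp_assoc'[of B "Suc n" A B' i] by (auto simp: R_inverse_def)
  also have "\<dots> = B'"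
    using assms by (simp add: R_inverse_def comp_unit_left)
  finally show ?thesis .
qed

lemma R_inverse_face_less:
  assumes "R_inverse (Suc (Suc n)) (Suc i) A B" "1 \<le> j" "j \<le> i" "i \<le> Suc n"
  shows "R_inverse (Suc n) i (\<partial> (Suc (Suc n)) j \<alpha> A) (\<partial> (Suc (Suc n)) j \<alpha> B)"
proof -
  have *: "\<partial> (Suc (Suc n)) j \<alpha> X \<star>\<langle>Suc n,i\<rangle> \<partial> (Suc (Suc n)) j \<alpha> Y = \<epsilon> n i (\<partial> (Suc n) i Neg (\<partial> (Suc (Suc n)) j \<alpha> X))"
    if "R_inverse (Suc (Suc n)) (Suc i) X Y" for X Y
    using face_comp_less[of X "Suc n" Y i j \<alpha>] assms that
    by (simp add: R_inverse_def face_degen_less face_face' face_in)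
  show ?thesis
    using assms *[OF assms(1)] *[OF R_inverse_sym[OF assms(1)]]
    by (simp add: R_inverse_def face_face' face_in)
qed

lemma R_inverse_face_greater:
  assumes "R_inverse (Suc (Suc n)) i A B" "1 \<le> i" "i \<le> j" "j \<le> Suc n"
  shows "R_inverse (Suc n) i (\<partial> (Suc (Suc n)) (Suc j) \<alpha> A) (\<partial> (Suc (Suc n)) (Suc j) \<alpha> B)"
proof -
  have *: "\<partial> (Suc (Suc n)) (Suc j) \<alpha> X \<star>\<langle>Suc n,i\<rangle> \<partial> (Suc (Suc n)) (Suc j) \<alpha> Y =
      \<epsilon> n i (\<partial> (Suc n) i Neg (\<partial> (Suc (Suc n)) (Suc j) \<alpha> X))"
    if "R_inverse (Suc (Suc n)) i X Y" for X Y
    using face_comp_greater[of X "Suc n" Y i j \<alpha>] assms that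
    by (simp add: R_inverse_def face_degen_greater face_face'[symmetric] face_in)
  show ?thesis
    using assms *[OF assms(1)] *[OF R_inverse_sym[OF assms(1)]]
    by (simp add: R_inverse_def face_face'[symmetric] face_in)
qed

lemma R_inverse_degen_greater:
  assumes "R_inverse (Suc n) i A B" "1 \<le> i" "i \<le> j" "j \<le> Suc n"
  shows "R_inverse (Suc (Suc n)) i (\<epsilon> (Suc n) (Suc j) A) (\<epsilon> (Suc n) (Suc j) B)"
  using assms by (simp add: R_inverse_def boundary_simps degen_comp_greater[symmetric] degen_degen')

lemma R_inverse_conn_greater:
  assumes "R_inverse (Suc n) i A B" "1 \<le> i" "i \<le> j" "j \<le> n"
  shows "R_inverse (Suc (Suc n)) i (\<Gamma> (Suc n) (Suc j) \<alpha> A) (\<Gamma> (Suc n) (Suc j) \<alpha> B)"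
  using assms by (simp add: R_inverse_def boundary_simps conn_comp_greater[symmetric] conn_degen_greater)

text \<open>The exchange law multiplies the inverses componentwise. The two cases differ only in
  which of the two directions is renumbered on faces.\<close>

lemma R_inverse_comp:
  assumes inv: "R_inverse (Suc (Suc n)) i A A'" "R_inverse (Suc (Suc n)) i B B'"
    and eq: "\<partial> (Suc (Suc n)) j Pos A = \<partial> (Suc (Suc n)) j Neg B"
    and i: "1 \<le> i" "i \<le> Suc (Suc n)" "1 \<le> j" "j \<le> Suc (Suc n)" "i \<noteq> j"
  shows "R_inverse (Suc (Suc n)) i (A \<star>\<langle>Suc (Suc n),j\<rangle> B) (A' \<star>\<langle>Suc (Suc n),j\<rangle> B')"
proof -
  consider "j < i" | "i < j"
    using i by linarith
  then show ?thesis
  proof cases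
    case 1
    then obtain i' where 1: "i = Suc i'" "j \<le> i'"
      by (cases i) auto
    \<comment> \<open>Both sides are inverse to the common face of \<open>A\<close> and
      \<open>B\<close>, so uniqueness of inverses makes \<open>A'\<close> and \<open>B'\<close>
      composable.\<close>
    have eq': "\<partial> (Suc (Suc n)) j Pos A' = \<partial> (Suc (Suc n)) j Neg B'"
    proof (rule R_inverse_unique[of n i' "\<partial> (Suc (Suc n)) j Pos A"])
      show "R_inverse (Suc n) i' (\<partial> (Suc (Suc n)) j Pos A) (\<partial> (Suc (Suc n)) j Pos A')"
        using inv i 1 by (auto intro!: R_inverse_face_less)
      show "R_inverse (Suc n) i' (\<partial> (Suc (Suc n)) j Pos A) (\<partial> (Suc (Suc n)) j Neg B')"
        unfolding eq using inv i 1 by (auto intro!: R_inverse_face_less)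
    qed (use i 1 in auto)
    have "\<partial> (Suc n) i' \<alpha> (\<partial> (Suc (Suc n)) j Pos X) = \<partial> (Suc n) j Pos (\<partial> (Suc (Suc n)) (Suc i') \<alpha> X)"
      "\<partial> (Suc n) i' \<alpha> (\<partial> (Suc (Suc n)) j Neg X) = \<partial> (Suc n) j Neg (\<partial> (Suc (Suc n)) (Suc i') \<alpha> X)"
      if "X \<in> cells C (Suc (Suc n))" for X \<alpha>
      using 1 i that by (simp_all add: face_face')
    then have "\<partial> (Suc n) j Pos (\<partial> (Suc (Suc n)) (Suc i') \<alpha> A) = \<partial> (Suc n) j Neg (\<partial> (Suc (Suc n)) (Suc i') \<alpha> B)"
      "\<partial> (Suc n) j Pos (\<partial> (Suc (Suc n)) (Suc i') \<alpha> A') = \<partial> (Suc n) j Neg (\<partial> (Suc (Suc n)) (Suc i') \<alpha> B')" for \<alpha>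
      using eq eq' inv by (metis R_inverse_def)+
    note d = this
    have "(A \<star>\<langle>Suc (Suc n),j\<rangle> B) \<star>\<langle>Suc (Suc n),i\<rangle> (A' \<star>\<langle>Suc (Suc n),j\<rangle> B') =
      (A \<star>\<langle>Suc (Suc n),i\<rangle> A') \<star>\<langle>Suc (Suc n),j\<rangle> (B \<star>\<langle>Suc (Suc n),i\<rangle> B')"
      "(A' \<star>\<langle>Suc (Suc n),j\<rangle> B') \<star>\<langle>Suc (Suc n),i\<rangle> (A \<star>\<langle>Suc (Suc n),j\<rangle> B) =
      (A' \<star>\<langle>Suc (Suc n),i\<rangle> A) \<star>\<langle>Suc (Suc n),j\<rangle> (B' \<star>\<langle>Suc (Suc n),i\<rangle> B)"
      using inv eq eq' i by (intro exchange; simp add: R_inverse_def)+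
    with d show ?thesis
      using 1 i inv eq eq' unfolding 1
      by (simp add: R_inverse_def comp_in face_comp_greater degen_comp_greater face_in)
  next
    case 2
    then obtain j' where 2: "j = Suc j'" "i \<le> j'"
      by (cases j) auto
    have eq': "\<partial> (Suc (Suc n)) j Pos A' = \<partial> (Suc (Suc n)) j Neg B'"
    proof (rule R_inverse_unique[of n i "\<partial> (Suc (Suc n)) j Pos A"])
      show "R_inverse (Suc n) i (\<partial> (Suc (Suc n)) j Pos A) (\<partial> (Suc (Suc n)) j Pos A')"
        using inv i 2 by (auto intro!: R_inverse_face_greater)
      show "R_inverse (Suc n) i (\<partial> (Suc (Suc n)) j Pos A) (\<partial> (Suc (Suc n)) j Neg B')"
        unfolding eq using inv i 2 by (auto intro!: R_inverse_face_greater)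
    qed (use i 2 in auto)
    have "\<partial> (Suc n) j' Pos (\<partial> (Suc (Suc n)) i \<alpha> X) = \<partial> (Suc n) i \<alpha> (\<partial> (Suc (Suc n)) (Suc j') Pos X)"
      "\<partial> (Suc n) j' Neg (\<partial> (Suc (Suc n)) i \<alpha> X) = \<partial> (Suc n) i \<alpha> (\<partial> (Suc (Suc n)) (Suc j') Neg X)"
      if "X \<in> cells C (Suc (Suc n))" for X \<alpha>
      using 2 i that by (simp_all add: face_face')
    then have "\<partial> (Suc n) j' Pos (\<partial> (Suc (Suc n)) i \<alpha> A) = \<partial> (Suc n) j' Neg (\<partial> (Suc (Suc n)) i \<alpha> B)"
      "\<partial> (Suc n) j' Pos (\<partial> (Suc (Suc n)) i \<alpha> A') = \<partial> (Suc n) j' Neg (\<partial> (Suc (Suc n)) i \<alpha> B')" for \<alpha>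
      using eq eq' inv 2 by (metis R_inverse_def)+
    note d = this
    have "(A \<star>\<langle>Suc (Suc n),j\<rangle> B) \<star>\<langle>Suc (Suc n),i\<rangle> (A' \<star>\<langle>Suc (Suc n),j\<rangle> B') =
      (A \<star>\<langle>Suc (Suc n),i\<rangle> A') \<star>\<langle>Suc (Suc n),j\<rangle> (B \<star>\<langle>Suc (Suc n),i\<rangle> B')"
      "(A' \<star>\<langle>Suc (Suc n),j\<rangle> B') \<star>\<langle>Suc (Suc n),i\<rangle> (A \<star>\<langle>Suc (Suc n),j\<rangle> B) =
      (A' \<star>\<langle>Suc (Suc n),i\<rangle> A) \<star>\<langle>Suc (Suc n),j\<rangle> (B' \<star>\<langle>Suc (Suc n),i\<rangle> B)"
      using inv eq eq' i by (intro exchange; simp add: R_inverse_def)+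
    with d show ?thesis
      using 2 i inv eq eq' unfolding 2
      by (simp add: R_inverse_def comp_in face_comp_less degen_comp_le face_in)
  qed
qed

lemma R_invertible_comp:
  "\<lbrakk>R_invertible (Suc (Suc n)) i A; R_invertible (Suc (Suc n)) i B;
    \<partial> (Suc (Suc n)) j Pos A = \<partial> (Suc (Suc n)) j Neg B;
    1 \<le> i; i \<le> Suc (Suc n); 1 \<le> j; j \<le> Suc (Suc n); i \<noteq> j\<rbrakk> \<Longrightarrow>
   R_invertible (Suc (Suc n)) i (A \<star>\<langle>Suc (Suc n),j\<rangle> B)"
  using R_inverse_comp unfolding R_invertible_def by blast

lemma R_invertible_degen_same:
  "\<lbrakk>A \<in> cells C n; 1 \<le> i; i \<le> Suc n\<rbrakk> \<Longrightarrow> R_invertible (Suc n) i (\<epsilon> n i A)"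
  unfolding R_invertible_def R_inverse_def
  by (rule exI[of _ "\<epsilon> n i A"]) (simp add: boundary_simps)

text \<open>The connections glued on in direction \<open>k + 1\<close> are formed on faces of
  \<open>A\<close>, which inherit invertibility in direction \<open>i\<close>; then
  \<open>R_invertible_comp\<close> applies.\<close>

lemma R_invertible_psi_greater:
  assumes A: "A \<in> cells C (Suc (Suc n))" "R_invertible (Suc (Suc n)) i A"
    and i: "1 \<le> i" "i < k" "k \<le> Suc n"
  shows "R_invertible (Suc (Suc n)) i (\<psi> (Suc (Suc n)) k A)"
proof -
  obtain k' where k: "k = Suc k'"
    using i by (cases k) auto
  have *: "R_invertible (Suc (Suc n)) i (\<Gamma> (Suc n) k \<beta> (\<partial> (Suc (Suc n)) (Suc k) \<alpha> A))" for \<alpha> \<beta>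
    using assms R_inverse_conn_greater[of n i _ _ k'] R_inverse_face_greater[of n i _ _ k]
    unfolding R_invertible_def k by fastforce
  show ?thesis
    unfolding psi_def using i assms *
    by (simp, intro R_invertible_comp) (simp_all add: boundary_simps)
qed

text \<open>\<open>psi_unfold\<close> composes \<open>A\<close> in the directions \<open>k\<close>
  and \<open>k + 1\<close>, both different from \<open>i\<close>, from cells invertible in direction
  \<open>i\<close>.\<close>

lemma R_invertible_unfold_greater:
  assumes A: "A \<in> cells C (Suc (Suc n))" "R_invertible (Suc (Suc n)) i (\<psi> (Suc (Suc n)) k A)"
    and i: "1 \<le> i" "i < k" "k \<le> Suc n"
    and faces: "\<And>\<alpha>. R_invertible (Suc n) i (\<partial> (Suc (Suc n)) k \<alpha> A)"
      "\<And>\<alpha>. R_invertible (Suc n) i (\<partial> (Suc (Suc n)) (Suc k) \<alpha> A)"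
  shows "R_invertible (Suc (Suc n)) i A"
proof -
  obtain k' where k: "k = Suc k'"
    using i by (cases k) auto
  have *: "R_invertible (Suc (Suc n)) i (\<Gamma> (Suc n) k \<beta> (\<partial> (Suc (Suc n)) (Suc k) \<alpha> A))"
     "R_invertible (Suc (Suc n)) i (\<epsilon> (Suc n) k (\<partial> (Suc (Suc n)) k \<alpha> A))" for \<alpha> \<beta>
    using faces i R_inverse_conn_greater[of n i _ _ k'] R_inverse_degen_greater[of n i _ _ k']
    unfolding R_invertible_def k by fastforce+
  have "1 \<le> k"
    using i by simp
  show ?thesis
    apply (subst psi_unfold[OF \<open>1 \<le> k\<close> i(3) A(1)])
    using i assms * by (intro R_invertible_comp) (simp_all add: boundary_simps face_psi psi_in)
qed

text \<open>On a face in direction \<open>j\<close> the direction \<open>i\<close> is renumbered to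
  \<open>dn i j\<close>.\<close>

definition faces_invertible :: "nat \<Rightarrow> nat \<Rightarrow> 'a \<Rightarrow> bool" where
  "faces_invertible n i A \<longleftrightarrow>
     (\<forall>j \<alpha>. 1 \<le> j \<longrightarrow> j \<le> n \<longrightarrow> j \<noteq> i \<longrightarrow> R_invertible (n - 1) (dn i j) (\<partial> n j \<alpha> A))"

text \<open>A face in direction \<open>k + 1\<close> is degenerate. In the remaining directions a
  face of the folding is a folding of a face of \<open>A\<close>, which \<open>IH\<close> covers one
  dimension lower.\<close>

lemma faces_invertible_psi_same:
  assumes IH: "\<And>A i. \<lbrakk>A \<in> cells C (Suc n); 1 \<le> i; i < Suc n\<rbrakk> \<Longrightarrow> R_invertible (Suc n) i (\<psi> (Suc n) i A)"
    and A: "A \<in> cells C (Suc (Suc n))" "1 \<le> k" "k \<le> Suc n"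
  shows "faces_invertible (Suc (Suc n)) k (\<psi> (Suc (Suc n)) k A)"
  unfolding faces_invertible_def
proof (intro allI impI, goal_cases)
  case (1 j \<alpha>)
  consider "j < k" | "j = Suc k" | "j > Suc k"
    using 1 by linarith
  then show ?case
  proof cases
    case 1
    with A \<open>1 \<le> j\<close> obtain n' k' where n: "n = Suc n'" and k: "k = Suc k'"
      by (cases n; cases k) auto
    show ?thesis
      using A 1 \<open>1 \<le> j\<close> IH[of "\<partial> (Suc (Suc (Suc n'))) j \<alpha> A" k']
      unfolding n k by (simp add: face_psi_less face_in dn_def)
  next
    case 2
    then show ?thesis
      using A by (simp add: dn_def face_psi R_invertible_degen_same face_in)
  next
    case 3
    with \<open>j \<le> Suc (Suc n)\<close> A(2) obtain n' j' where n: "n = Suc n'" and j: "j = Suc j'"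
      by (cases n; cases j) auto
    show ?thesis
      using A 3 \<open>j \<le> Suc (Suc n)\<close> IH[of "\<partial> (Suc (Suc (Suc n'))) j \<alpha> A" k]
      unfolding n j by (simp add: face_psi_greater face_in dn_def)
  qed
qed

text \<open>A face in direction \<open>k\<close> is a composite of two faces of \<open>A\<close>,
  and one in direction \<open>k + 1\<close> is a degeneracy of an iterated face. All others are
  foldings of faces of \<open>A\<close>, handled by \<open>R_invertible_psi_greater\<close>.\<close>

lemma faces_invertible_psi_greater:
  assumes A: "A \<in> cells C (Suc (Suc n))" "1 \<le> i" "i < k" "k \<le> Suc n"
    and inv: "faces_invertible (Suc (Suc n)) i A"
  shows "faces_invertible (Suc (Suc n)) i (\<psi> (Suc (Suc n)) k A)"
  unfolding faces_invertible_def
proof (intro allI impI, goal_cases)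
  case (1 j \<alpha>)
  obtain n' k' where n: "n = Suc n'" and k: "k = Suc k'"
    using A by (cases n; cases k) auto
  have inv: "R_invertible (Suc n) (dn i j) (\<partial> (Suc (Suc n)) j \<alpha> A)"
    if "1 \<le> j" "j \<le> Suc (Suc n)" "j \<noteq> i" for j \<alpha>
    using inv that by (simp add: faces_invertible_def)
  have k_inv: "R_invertible (Suc n) i (\<partial> (Suc (Suc n)) k \<alpha> A)"
      "R_invertible (Suc n) i (\<partial> (Suc (Suc n)) (Suc k) \<alpha> A)" for \<alpha>
    using inv[of k \<alpha>] inv[of "Suc k" \<alpha>] A by (simp_all add: dn_def)
  consider "j < k" | "j = k" | "j = Suc k" | j' where "j = Suc j'" "k < j'"
    using 1 by (cases j) fastforce+
  then show ?case
  proof cases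
    case 1
    then show ?thesis
      using A inv[of j \<alpha>] \<open>1 \<le> j\<close> \<open>j \<noteq> i\<close> R_invertible_psi_greater[of "\<partial> (Suc (Suc (Suc n'))) j \<alpha> A" n' "dn i j" k']
      unfolding n k by (auto simp: face_psi_less face_in dn_def)
  next
    case 2
    show ?thesis
      unfolding 2 using A k_inv
      by (cases \<alpha>) (simp_all add: face_psi dn_def n R_invertible_comp face_in face_face')
  next
    case 3
    then show ?thesis
      using A k_inv(2)[of \<alpha>] R_inverse_face_greater[of n' i "\<partial> (Suc (Suc n)) (Suc k) \<alpha> A" _ k' \<alpha>]
       R_inverse_degen_greater[of n' i "\<partial> (Suc n) k \<alpha> (\<partial> (Suc (Suc n)) (Suc k) \<alpha> A)" _ k']
      unfolding R_invertible_def n k by (auto simp: face_psi dn_def)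
  next
    case 4
    then show ?thesis
      using A inv[of j \<alpha>] \<open>j \<le> Suc (Suc n)\<close> R_invertible_psi_greater[of "\<partial> (Suc (Suc (Suc n'))) j \<alpha> A" n' i k]
      unfolding n by (auto simp: face_psi_greater face_in dn_def)
  qed
qed

section \<open>Transport of T-inverses\<close>

lemma is_T_inverse_sym: "is_T_inverse C n i A B \<Longrightarrow> is_T_inverse C n i B A"
  by (auto simp: is_T_inverse_def)

lemma is_T_inverse_unique:
  assumes "is_T_inverse C n i A B" "is_T_inverse C n i A B'"
  shows "B = B'"
proof -
  obtain m where "n = Suc (Suc m)" "1 \<le> i" "i \<le> Suc m"
    using assms(1) by (cases n; cases "n - 1") (auto simp: is_T_inverse_def)
  with assms show ?thesis
    using is_T_inverse_unique_Suc by blast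
qed

text \<open>The T-equations are built from faces, connections and the two compositions, so a map
  preserving these preserves T-inverses. \<open>G\<close> is the corresponding map one dimension
  lower; dimension and direction may change, which covers faces, degeneracies, connections and the
  symmetries themselves.\<close>

lemma is_T_inverse_map:
  assumes AB: "is_T_inverse C (Suc (Suc n)) i A B"
    and k: "1 \<le> k" "k \<le> Suc m"
    and F: "\<And>X. X \<in> cells C (Suc (Suc n)) \<Longrightarrow> F X \<in> cells C (Suc (Suc m))"
    and face: "\<And>X \<alpha>. X \<in> cells C (Suc (Suc n)) \<Longrightarrow> \<partial> (Suc (Suc m)) k \<alpha> (F X) = G (\<partial> (Suc (Suc n)) i \<alpha> X)"
    and face_Suc: "\<And>X \<alpha>. X \<in> cells C (Suc (Suc n)) \<Longrightarrow>
        \<partial> (Suc (Suc m)) (Suc k) \<alpha> (F X) = G (\<partial> (Suc (Suc n)) (Suc i) \<alpha> X)"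
    and conn: "\<And>x \<alpha>. x \<in> cells C (Suc n) \<Longrightarrow> F (\<Gamma> (Suc n) i \<alpha> x) = \<Gamma> (Suc m) k \<alpha> (G x)"
    and comp: "\<And>X Y. \<lbrakk>X \<in> cells C (Suc (Suc n)); Y \<in> cells C (Suc (Suc n));
        \<partial> (Suc (Suc n)) i Pos X = \<partial> (Suc (Suc n)) i Neg Y\<rbrakk> \<Longrightarrow>
        F (X \<star>\<langle>Suc (Suc n),i\<rangle> Y) = F X \<star>\<langle>Suc (Suc m),k\<rangle> F Y"
    and comp_Suc: "\<And>X Y. \<lbrakk>X \<in> cells C (Suc (Suc n)); Y \<in> cells C (Suc (Suc n));
        \<partial> (Suc (Suc n)) (Suc i) Pos X = \<partial> (Suc (Suc n)) (Suc i) Neg Y\<rbrakk> \<Longrightarrow>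
        F (X \<star>\<langle>Suc (Suc n),Suc i\<rangle> Y) = F X \<star>\<langle>Suc (Suc m),Suc k\<rangle> F Y"
  shows "is_T_inverse C (Suc (Suc m)) k (F A) (F B)"
proof -
  have i: "1 \<le> i" "i \<le> Suc n"
    using AB by (simp_all add: is_T_inverse_def)
  have eq: "T_equation C (Suc (Suc m)) k (F X) (F Y)" if "is_T_inverse C (Suc (Suc n)) i X Y" for X Y
  proof -
    let ?L = "(\<Gamma> (Suc n) i Pos (\<partial> (Suc (Suc n)) (Suc i) Neg X) \<star>\<langle>Suc (Suc n),i\<rangle> Y) \<star>\<langle>Suc (Suc n),Suc i\<rangle>
      (X \<star>\<langle>Suc (Suc n),i\<rangle> \<Gamma> (Suc n) i Neg (\<partial> (Suc (Suc n)) i Pos X))"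
    let ?R = "\<Gamma> (Suc n) i Neg (\<partial> (Suc (Suc n)) i Neg X) \<star>\<langle>Suc (Suc n),i\<rangle>
     \<Gamma> (Suc n) i Pos (\<partial> (Suc (Suc n)) (Suc i) Pos X)"
    have X: "X \<in> cells C (Suc (Suc n))" "Y \<in> cells C (Suc (Suc n))"
      "\<And>\<alpha>. \<partial> (Suc (Suc n)) i \<alpha> Y = \<partial> (Suc (Suc n)) (Suc i) \<alpha> X"
      "\<And>\<alpha>. \<partial> (Suc (Suc n)) (Suc i) \<alpha> Y = \<partial> (Suc (Suc n)) i \<alpha> X" and
      LR: "?L = ?R"
      using that by (auto simp: is_T_inverse_def T_equation_def)
    have "F ?L = F ?R"
      using LR by simp
    then show ?thesis
      using X i unfolding T_equation_def
      by (simp add: boundary_simps comp comp_Suc conn F face face_Suc)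
  qed
  show ?thesis
    using AB eq[OF AB] eq[OF is_T_inverse_sym[OF AB]] k F
    by (auto simp: is_T_inverse_def face face_Suc)
qed

section \<open>Transport along faces, degeneracies and connections\<close>

lemma is_T_inverse_face_less:
  assumes "is_T_inverse C (Suc (Suc (Suc n))) (Suc i) A B" "1 \<le> j" "j \<le> i"
  shows "is_T_inverse C (Suc (Suc n)) i (\<partial> (Suc (Suc (Suc n))) j \<alpha> A) (\<partial> (Suc (Suc (Suc n))) j \<alpha> B)"
  using assms(1)
proof (rule is_T_inverse_map[where G = "\<partial> (Suc (Suc n)) j \<alpha>"])
  show "i \<le> Suc n"
    using assms(1) by (simp add: is_T_inverse_def)
qed (use assms in \<open>auto simp: boundary_simps is_T_inverse_def\<close>)

lemma is_T_inverse_face_greater: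
  assumes "is_T_inverse C (Suc (Suc (Suc n))) i A B" "i < j" "j \<le> Suc (Suc n)"
  shows "is_T_inverse C (Suc (Suc n)) i (\<partial> (Suc (Suc (Suc n))) (Suc j) \<alpha> A) (\<partial> (Suc (Suc (Suc n))) (Suc j) \<alpha> B)"
  using assms(1)
\<comment> \<open>After a face in direction \<open>i\<close> or \<open>i + 1\<close> the direction
  \<open>Suc j\<close> is numbered \<open>j\<close>.\<close>
proof (rule is_T_inverse_map[where G = "\<partial> (Suc (Suc n)) j \<alpha>"])
qed (use assms in \<open>auto simp: boundary_simps is_T_inverse_def\<close>)

lemma is_T_inverse_degen_le:
  assumes "is_T_inverse C (Suc (Suc n)) i A B" "1 \<le> j" "j \<le> i"
  shows "is_T_inverse C (Suc (Suc (Suc n))) (Suc i) (\<epsilon> (Suc (Suc n)) j A) (\<epsilon> (Suc (Suc n)) j B)"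
  using assms(1)
proof (rule is_T_inverse_map[where G = "\<epsilon> (Suc n) j"])
qed (use assms in \<open>auto simp: boundary_simps degen_comp_le conn_degen_greater is_T_inverse_def\<close>)

lemma is_T_inverse_degen_greater:
  assumes "is_T_inverse C (Suc (Suc n)) i A B" "i < j" "j \<le> Suc (Suc n)"
  shows "is_T_inverse C (Suc (Suc (Suc n))) i (\<epsilon> (Suc (Suc n)) (Suc j) A) (\<epsilon> (Suc (Suc n)) (Suc j) B)"
proof -
  obtain j' where j: "j = Suc j'"
    using assms by (cases j) auto
  show ?thesis
    using assms(1) unfolding j
  proof (rule is_T_inverse_map[where G = "\<epsilon> (Suc n) (Suc j')"])
  qed (use assms j in \<open>auto simp: boundary_simps degen_comp_greater conn_degen_less is_T_inverse_def\<close>)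
qed

lemma is_T_inverse_conn_less:
  assumes "is_T_inverse C (Suc (Suc n)) i A B" "1 \<le> j" "j < i"
  shows "is_T_inverse C (Suc (Suc (Suc n))) (Suc i) (\<Gamma> (Suc (Suc n)) j \<alpha> A) (\<Gamma> (Suc (Suc n)) j \<alpha> B)"
proof -
  obtain i' where i: "i = Suc i'"
    using assms by (cases i) auto
  show ?thesis
    using assms(1) unfolding i
  proof (rule is_T_inverse_map[where G = "\<Gamma> (Suc n) j \<alpha>"])
  qed (use assms i in \<open>auto simp: boundary_simps conn_comp_less conn_conn' is_T_inverse_def\<close>)
qed

lemma is_T_inverse_conn_greater:
  assumes "is_T_inverse C (Suc (Suc n)) i A B" "i < j" "j \<le> Suc n"
  shows "is_T_inverse C (Suc (Suc (Suc n))) i (\<Gamma> (Suc (Suc n)) (Suc j) \<alpha> A) (\<Gamma> (Suc (Suc n)) (Suc j) \<alpha> B)"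
proof -
  show ?thesis
    using assms(1)
  proof (rule is_T_inverse_map[where G = "\<Gamma> (Suc n) j \<alpha>"])
  qed (use assms in \<open>auto simp: boundary_simps conn_comp_greater conn_conn' is_T_inverse_def\<close>)
qed

text \<open>Composition takes two arguments, so \<open>is_T_inverse_map\<close> does not apply.
  Instead the T-equations of the two pairs are composed in direction \<open>Suc j\<close> by the
  exchange law.\<close>

lemma is_T_inverse_comp_greater:
  assumes A: "is_T_inverse C (Suc (Suc n)) i A A'" and B: "is_T_inverse C (Suc (Suc n)) i B B'"
    and eq: "\<partial> (Suc (Suc n)) (Suc j) Pos A = \<partial> (Suc (Suc n)) (Suc j) Neg B"
      "\<partial> (Suc (Suc n)) (Suc j) Pos A' = \<partial> (Suc (Suc n)) (Suc j) Neg B'"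
    and j: "i < j" "j \<le> Suc n"
  shows "is_T_inverse C (Suc (Suc n)) i (A \<star>\<langle>Suc (Suc n),(Suc j)\<rangle> B) (A' \<star>\<langle>Suc (Suc n),(Suc j)\<rangle> B')"
proof -
  have i: "1 \<le> i" "i \<le> Suc n"
    using A by (simp_all add: is_T_inverse_def)
  \<comment> \<open>Fixing the directions orients the exchange law; in general form it would rewrite
    its own result back.\<close>
  note exchange_i = exchange[of _ "Suc (Suc n)" _ _ _ "Suc j" i]
    and exchange_Suc = exchange[of _ "Suc (Suc n)" _ _ _ "(Suc j)" "Suc i"]
  have face: "\<partial> (Suc n) j Pos (\<partial> (Suc (Suc n)) i \<alpha> X) = \<partial> (Suc n) j Neg (\<partial> (Suc (Suc n)) i \<alpha> Y)"
     "\<partial> (Suc n) j Pos (\<partial> (Suc (Suc n)) (Suc i) \<alpha> X) = \<partial> (Suc n) j Neg (\<partial> (Suc (Suc n)) (Suc i) \<alpha> Y)"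
    if "X \<in> cells C (Suc (Suc n))" "Y \<in> cells C (Suc (Suc n))" "\<partial> (Suc (Suc n)) (Suc j) Pos X = \<partial> (Suc (Suc n)) (Suc j) Neg Y" for X Y \<alpha>
    using that i j by (simp_all add: face_face')
  have main: "T_equation C (Suc (Suc n)) i (X \<star>\<langle>Suc (Suc n),(Suc j)\<rangle> Y) (X' \<star>\<langle>Suc (Suc n),(Suc j)\<rangle> Y')"
    if X: "is_T_inverse C (Suc (Suc n)) i X X'" and Y: "is_T_inverse C (Suc (Suc n)) i Y Y'"
      and eq: "\<partial> (Suc (Suc n)) (Suc j) Pos X = \<partial> (Suc (Suc n)) (Suc j) Neg Y"
      "\<partial> (Suc (Suc n)) (Suc j) Pos X' = \<partial> (Suc (Suc n)) (Suc j) Neg Y'" for X X' Y Y'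
  proof -
    have X: "X \<in> cells C (Suc (Suc n))" "X' \<in> cells C (Suc (Suc n))"
      "\<And>\<alpha>. \<partial> (Suc (Suc n)) i \<alpha> X' = \<partial> (Suc (Suc n)) (Suc i) \<alpha> X"
      "\<And>\<alpha>. \<partial> (Suc (Suc n)) (Suc i) \<alpha> X' = \<partial> (Suc (Suc n)) i \<alpha> X"
      "T_equation C (Suc (Suc n)) i X X'"
      using X by (auto simp: is_T_inverse_def)
    have Y: "Y \<in> cells C (Suc (Suc n))" "Y' \<in> cells C (Suc (Suc n))"
      "\<And>\<alpha>. \<partial> (Suc (Suc n)) i \<alpha> Y' = \<partial> (Suc (Suc n)) (Suc i) \<alpha> Y"
      "\<And>\<alpha>. \<partial> (Suc (Suc n)) (Suc i) \<alpha> Y' = \<partial> (Suc (Suc n)) i \<alpha> Y"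
      "T_equation C (Suc (Suc n)) i Y Y'"
      using Y by (auto simp: is_T_inverse_def)
    show ?thesis
      using X Y eq face[OF X(1) Y(1) eq(1)] i j unfolding T_equation_def
      by (simp add: boundary_simps conn_comp_less exchange_i exchange_Suc)
  qed
  have AB: "A \<in> cells C (Suc (Suc n))" "A' \<in> cells C (Suc (Suc n))" "B \<in> cells C (Suc (Suc n))" "B' \<in> cells C (Suc (Suc n))"
    "\<And>\<alpha>. \<partial> (Suc (Suc n)) i \<alpha> A = \<partial> (Suc (Suc n)) (Suc i) \<alpha> A'"
    "\<And>\<alpha>. \<partial> (Suc (Suc n)) (Suc i) \<alpha> A = \<partial> (Suc (Suc n)) i \<alpha> A'"
    "\<And>\<alpha>. \<partial> (Suc (Suc n)) i \<alpha> B = \<partial> (Suc (Suc n)) (Suc i) \<alpha> B'"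
    "\<And>\<alpha>. \<partial> (Suc (Suc n)) (Suc i) \<alpha> B = \<partial> (Suc (Suc n)) i \<alpha> B'"
    using A B by (auto simp: is_T_inverse_def)
  have "T_equation C (Suc (Suc n)) i (A \<star>\<langle>Suc (Suc n),(Suc j)\<rangle> B) (A' \<star>\<langle>Suc (Suc n),(Suc j)\<rangle> B')"
    "T_equation C (Suc (Suc n)) i (A' \<star>\<langle>Suc (Suc n),(Suc j)\<rangle> B') (A \<star>\<langle>Suc (Suc n),(Suc j)\<rangle> B)"
    using main A B eq is_T_inverse_sym by blast+
  then show ?thesis
    using i j AB eq unfolding is_T_inverse_def
    by (simp add: comp_in face_comp_less)
qed

lemma is_T_inverse_comp_less:
  assumes A: "is_T_inverse C (Suc (Suc n)) (Suc i) A A'" and B: "is_T_inverse C (Suc (Suc n)) (Suc i) B B'"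
    and eq: "\<partial> (Suc (Suc n)) j Pos A = \<partial> (Suc (Suc n)) j Neg B"
      "\<partial> (Suc (Suc n)) j Pos A' = \<partial> (Suc (Suc n)) j Neg B'"
    and j: "1 \<le> j" "j \<le> i"
  shows "is_T_inverse C (Suc (Suc n)) (Suc i) (A \<star>\<langle>Suc (Suc n),j\<rangle> B) (A' \<star>\<langle>Suc (Suc n),j\<rangle> B')"
proof -
  have i: "1 \<le> (Suc i)" "(Suc i) \<le> Suc n"
    using A by (simp_all add: is_T_inverse_def)
  note exchange_i = exchange[of _ "Suc (Suc n)" _ _ _ "j" "(Suc i)"]
    and exchange_Suc = exchange[of _ "Suc (Suc n)" _ _ _ "j" "Suc ((Suc i))"]
  have face: "\<partial> (Suc n) j Pos (\<partial> (Suc (Suc n)) (Suc i) \<alpha> X) = \<partial> (Suc n) j Neg (\<partial> (Suc (Suc n)) (Suc i) \<alpha> Y)"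
     "\<partial> (Suc n) j Pos (\<partial> (Suc (Suc n)) (Suc (Suc i)) \<alpha> X) = \<partial> (Suc n) j Neg (\<partial> (Suc (Suc n)) (Suc (Suc i)) \<alpha> Y)"
    if "X \<in> cells C (Suc (Suc n))" "Y \<in> cells C (Suc (Suc n))" "\<partial> (Suc (Suc n)) j Pos X = \<partial> (Suc (Suc n)) j Neg Y" for X Y \<alpha>
    using that i j by (simp_all add: face_face'[symmetric])
  have main: "T_equation C (Suc (Suc n)) (Suc i) (X \<star>\<langle>Suc (Suc n),j\<rangle> Y) (X' \<star>\<langle>Suc (Suc n),j\<rangle> Y')"
    if X: "is_T_inverse C (Suc (Suc n)) (Suc i) X X'" and Y: "is_T_inverse C (Suc (Suc n)) (Suc i) Y Y'"
      and eq: "\<partial> (Suc (Suc n)) j Pos X = \<partial> (Suc (Suc n)) j Neg Y"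
      "\<partial> (Suc (Suc n)) j Pos X' = \<partial> (Suc (Suc n)) j Neg Y'" for X X' Y Y'
  proof -
    have X: "X \<in> cells C (Suc (Suc n))" "X' \<in> cells C (Suc (Suc n))"
      "\<And>\<alpha>. \<partial> (Suc (Suc n)) (Suc i) \<alpha> X' = \<partial> (Suc (Suc n)) (Suc (Suc i)) \<alpha> X"
      "\<And>\<alpha>. \<partial> (Suc (Suc n)) (Suc (Suc i)) \<alpha> X' = \<partial> (Suc (Suc n)) (Suc i) \<alpha> X"
      "T_equation C (Suc (Suc n)) (Suc i) X X'"
      using X by (auto simp: is_T_inverse_def)
    have Y: "Y \<in> cells C (Suc (Suc n))" "Y' \<in> cells C (Suc (Suc n))"
      "\<And>\<alpha>. \<partial> (Suc (Suc n)) (Suc i) \<alpha> Y' = \<partial> (Suc (Suc n)) (Suc (Suc i)) \<alpha> Y"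
      "\<And>\<alpha>. \<partial> (Suc (Suc n)) (Suc (Suc i)) \<alpha> Y' = \<partial> (Suc (Suc n)) (Suc i) \<alpha> Y"
      "T_equation C (Suc (Suc n)) (Suc i) Y Y'"
      using Y by (auto simp: is_T_inverse_def)
    show ?thesis
      using X Y eq face[OF X(1) Y(1) eq(1)] i j unfolding T_equation_def
      by (simp add: boundary_simps conn_comp_greater exchange_i exchange_Suc)
  qed
  have AB: "A \<in> cells C (Suc (Suc n))" "A' \<in> cells C (Suc (Suc n))" "B \<in> cells C (Suc (Suc n))" "B' \<in> cells C (Suc (Suc n))"
    "\<And>\<alpha>. \<partial> (Suc (Suc n)) (Suc i) \<alpha> A = \<partial> (Suc (Suc n)) (Suc (Suc i)) \<alpha> A'"
    "\<And>\<alpha>. \<partial> (Suc (Suc n)) (Suc (Suc i)) \<alpha> A = \<partial> (Suc (Suc n)) (Suc i) \<alpha> A'"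
    "\<And>\<alpha>. \<partial> (Suc (Suc n)) (Suc i) \<alpha> B = \<partial> (Suc (Suc n)) (Suc (Suc i)) \<alpha> B'"
    "\<And>\<alpha>. \<partial> (Suc (Suc n)) (Suc (Suc i)) \<alpha> B = \<partial> (Suc (Suc n)) (Suc i) \<alpha> B'"
    using A B by (auto simp: is_T_inverse_def)
  have "T_equation C (Suc (Suc n)) (Suc i) (A \<star>\<langle>Suc (Suc n),j\<rangle> B) (A' \<star>\<langle>Suc (Suc n),j\<rangle> B')"
    "T_equation C (Suc (Suc n)) (Suc i) (A' \<star>\<langle>Suc (Suc n),j\<rangle> B') (A \<star>\<langle>Suc (Suc n),j\<rangle> B)"
    using main A B eq is_T_inverse_sym by blast+
  then show ?thesis
    using i j AB eq unfolding is_T_inverse_def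
    by (simp add: comp_in face_comp_greater)
qed

section \<open>Thin cells\<close>

lemma psi_comp_less:
  assumes "A \<in> cells C (Suc (Suc n))" "B \<in> cells C (Suc (Suc n))"
    "\<partial> (Suc (Suc n)) j Pos A = \<partial> (Suc (Suc n)) j Neg B"
    and j: "1 \<le> j" "j < i" "i \<le> Suc n"
  shows "\<psi> (Suc (Suc n)) i (A \<star>\<langle>Suc (Suc n),j\<rangle> B) =
    \<psi> (Suc (Suc n)) i A \<star>\<langle>Suc (Suc n),j\<rangle> \<psi> (Suc (Suc n)) i B"
proof -
  obtain i' n' where i: "i = Suc i'" and n: "n = Suc n'"
    using j by (cases i; cases n) auto
  note exchange_Suc = exchange[of _ "Suc (Suc (Suc n'))" _ _ _ j "Suc (Suc i')"]
  have face: "\<partial> (Suc n) j Pos (\<partial> (Suc (Suc n)) (Suc i) \<alpha> A) = \<partial> (Suc n) j Neg (\<partial> (Suc (Suc n)) (Suc i) \<alpha> B)" for \<alpha>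
    using assms by (simp add: face_face'[symmetric])
  show ?thesis
    using assms face unfolding psi_def i n
    by (simp add: boundary_simps conn_comp_greater exchange_Suc)
qed

lemma psi_comp_greater:
  assumes "A \<in> cells C (Suc (Suc n))" "B \<in> cells C (Suc (Suc n))"
    "\<partial> (Suc (Suc n)) (Suc j) Pos A = \<partial> (Suc (Suc n)) (Suc j) Neg B"
    and j: "1 \<le> i" "i < j" "j \<le> Suc n"
  shows "\<psi> (Suc (Suc n)) i (A \<star>\<langle>Suc (Suc n),Suc j\<rangle> B) =
    \<psi> (Suc (Suc n)) i A \<star>\<langle>Suc (Suc n),Suc j\<rangle> \<psi> (Suc (Suc n)) i B"
proof -
  note exchange_Suc = exchange[of _ "Suc (Suc n)" _ _ _ "Suc j" "Suc i"]
  have face: "\<partial> (Suc n) j Pos (\<partial> (Suc (Suc n)) (Suc i) \<alpha> A) = \<partial> (Suc n) j Neg (\<partial> (Suc (Suc n)) (Suc i) \<alpha> B)" for \<alpha>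
    using assms by (simp add: face_face')
  show ?thesis
    using assms face unfolding psi_def
    by (simp add: boundary_simps conn_comp_less exchange_Suc)
qed

lemma psi_degen_le:
  assumes "A \<in> cells C (Suc (Suc n))" "1 \<le> j" "j \<le> i" "i \<le> Suc n"
  shows "\<psi> (Suc (Suc (Suc n))) (Suc i) (\<epsilon> (Suc (Suc n)) j A) = \<epsilon> (Suc (Suc n)) j (\<psi> (Suc (Suc n)) i A)"
  using assms unfolding psi_def
  by (simp add: boundary_simps degen_comp_le conn_degen_greater)

lemma degen_image_comp_greater:
  assumes "A \<in> \<epsilon> (Suc n) i ` cells C (Suc n)" "B \<in> \<epsilon> (Suc n) i ` cells C (Suc n)"
    "\<partial> (Suc (Suc n)) (Suc j) Pos A = \<partial> (Suc (Suc n)) (Suc j) Neg B" "1 \<le> i" "i < j" "j \<le> Suc n"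
  shows "A \<star>\<langle>Suc (Suc n),Suc j\<rangle> B \<in> \<epsilon> (Suc n) i ` cells C (Suc n)"
proof -
  obtain n' where n: "n = Suc n'"
    using assms by (cases n) auto
  obtain x y where x: "A = \<epsilon> (Suc n) i x" "x \<in> cells C (Suc n)" and y: "B = \<epsilon> (Suc n) i y" "y \<in> cells C (Suc n)"
    using assms by auto
  have "\<epsilon> n i (\<partial> (Suc n) j Pos x) = \<epsilon> n i (\<partial> (Suc n) j Neg y)"
    using assms x y by (simp add: face_degen_greater)
  \<comment> \<open>A face in direction \<open>i\<close> cancels the degeneracy, which is thus
    injective.\<close>
  then have "\<partial> (Suc n) i Pos (\<epsilon> n i (\<partial> (Suc n) j Pos x)) = \<partial> (Suc n) i Pos (\<epsilon> n i (\<partial> (Suc n) j Neg y))"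
    by simp
  then have "\<partial> (Suc n) j Pos x = \<partial> (Suc n) j Neg y"
    using assms x y by (simp add: face_degen' face_in)
  then show ?thesis
    using assms x y by (intro image_eqI[of _ _ "x \<star>\<langle>Suc n,j\<rangle> y"]) (simp_all add: degen_comp_le comp_in)
qed

lemma fold_thin_comp_greater:
  assumes "fold_thin (Suc (Suc n)) i A" "fold_thin (Suc (Suc n)) i B"
    "\<partial> (Suc (Suc n)) (Suc j) Pos A = \<partial> (Suc (Suc n)) (Suc j) Neg B" "1 \<le> i" "i < j" "j \<le> Suc n"
  shows "fold_thin (Suc (Suc n)) i (A \<star>\<langle>Suc (Suc n),Suc j\<rangle> B)"
proof -
  obtain n' where n: "n = Suc n'"
    using assms by (cases n) auto
  have "\<psi> (Suc (Suc n)) i A \<star>\<langle>Suc (Suc n),Suc j\<rangle> \<psi> (Suc (Suc n)) i B \<in> \<epsilon> (Suc n) i ` cells C (Suc n)"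
    using assms by (intro degen_image_comp_greater) (simp_all add: fold_thin_def n face_psi_greater)
  then show ?thesis
    using assms by (simp add: fold_thin_def psi_comp_greater comp_in)
qed

section \<open>Closure properties of thin cells\<close>

context
  fixes n i :: nat
  assumes i: "1 \<le> i" "i \<le> Suc n"
begin

lemmas thin_simps = boundary_simps psi_in face_psi face_psi_less face_psi_greater

lemma thin_comp_same:
  assumes "thin (Suc (Suc (Suc n))) i A" "thin (Suc (Suc (Suc n))) i B"
    "\<partial> (Suc (Suc (Suc n))) i Pos A = \<partial> (Suc (Suc (Suc n))) i Neg B"
  shows "thin (Suc (Suc (Suc n))) i (A \<star>\<langle>Suc (Suc (Suc n)),i\<rangle> B)"
  using assms i by (simp add: thin_def psi_comp_less fold_thin_comp_same thin_simps)

text \<open>By \<open>psi_comp_same\<close> the folding in direction \<open>i + 1\<close> is a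
  composite, in the directions \<open>i + 1\<close> and \<open>i + 2\<close>, of the foldings of
  \<open>A\<close> and \<open>B\<close> with degenerate cells. \<open>fold_thin\<close> in direction
  \<open>i\<close> is closed under both compositions.\<close>

lemma thin_comp_Suc:
  assumes "thin (Suc (Suc (Suc n))) i A" "thin (Suc (Suc (Suc n))) i B"
    "\<partial> (Suc (Suc (Suc n))) (Suc i) Pos A = \<partial> (Suc (Suc (Suc n))) (Suc i) Neg B"
  shows "thin (Suc (Suc (Suc n))) i (A \<star>\<langle>Suc (Suc (Suc n)),Suc i\<rangle> B)"
proof -
  have AB: "A \<in> cells C (Suc (Suc (Suc n)))" "B \<in> cells C (Suc (Suc (Suc n)))"
    "fold_thin (Suc (Suc (Suc n))) i (\<psi> (Suc (Suc (Suc n))) (Suc i) A)"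
    "fold_thin (Suc (Suc (Suc n))) i (\<psi> (Suc (Suc (Suc n))) (Suc i) B)"
    using assms by (simp_all add: thin_def)
  have d: "\<partial> (Suc (Suc n)) (Suc i) Pos (\<partial> (Suc (Suc (Suc n))) (Suc (Suc i)) \<alpha> A) =
      \<partial> (Suc (Suc n)) (Suc i) Neg (\<partial> (Suc (Suc (Suc n))) (Suc (Suc i)) \<alpha> B)" for \<alpha>
    using AB assms(3) i by (simp flip: face_face')
  show ?thesis
    unfolding thin_def using i AB assms(3) d
    by (simp add: comp_in psi_comp_same, intro fold_thin_comp_Suc fold_thin_comp_greater fold_thin_degen_Suc)
      (simp_all add: thin_simps comp_assoc')
qed

lemma thin_degen:
  assumes "A \<in> cells C (Suc (Suc n))"
  shows "thin (Suc (Suc (Suc n))) i (\<epsilon> (Suc (Suc n)) i A)"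
  using assms i by (simp add: thin_def degen_in psi_degen_le fold_thin_degen psi_in)

lemma thin_conn_Suc:
  assumes "A \<in> cells C (Suc (Suc n))"
  shows "thin (Suc (Suc (Suc n))) i (\<Gamma> (Suc (Suc n)) (Suc i) \<alpha> A)"
  using assms i by (simp add: thin_def conn_in psi_conn fold_thin_degen_Suc)

text \<open>For equal signs \<open>conn_conn_same'\<close> turns the cell into a connection in
  direction \<open>i\<close>. For different signs the cell cancels against one of the two
  connections of its folding, and two degeneracies of connections remain.\<close>

lemma fold_thin_conn_Suc_conn:
  assumes A: "A \<in> cells C (Suc n)"
  shows "fold_thin (Suc (Suc (Suc n))) i (\<Gamma> (Suc (Suc n)) (Suc i) \<alpha> (\<Gamma> (Suc n) i \<beta> A))"
proof (cases "\<alpha> = \<beta>")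
  case True
  then show ?thesis
    using i A fold_thin_conn[of i "Suc n" "\<Gamma> (Suc n) i \<beta> A"] by (simp add: conn_conn_same' conn_in)
next
  case False
  let ?G = "\<Gamma> (Suc (Suc n)) (Suc i) \<alpha> (\<Gamma> (Suc n) i \<beta> A)"
  have cancel: "\<Gamma> (Suc (Suc n)) (Suc i) Pos (\<Gamma> (Suc n) i \<gamma> A) \<star>\<langle>Suc (Suc (Suc n)),Suc i\<rangle>
      \<Gamma> (Suc (Suc n)) (Suc i) Neg (\<Gamma> (Suc n) i \<gamma> A) = \<epsilon> (Suc (Suc n)) (Suc (Suc i)) (\<Gamma> (Suc n) i \<gamma> A)" for \<gamma>
    using i A conn_cancel[of "\<Gamma> (Suc n) i \<gamma> A" "Suc (Suc n)" "Suc i"] by (simp add: conn_in)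
  \<comment> \<open>The remaining composite is a degeneracy of a cancelling pair of connections,
    hence degenerate in direction \<open>i\<close>.\<close>
  have cancel': "\<epsilon> (Suc (Suc n)) (Suc (Suc i)) (\<Gamma> (Suc n) i Pos A) \<star>\<langle>Suc (Suc (Suc n)),Suc i\<rangle>
       \<epsilon> (Suc (Suc n)) (Suc (Suc i)) (\<Gamma> (Suc n) i Neg A) = \<epsilon> (Suc (Suc n)) i (\<epsilon> (Suc n) (Suc i) A)"
    using i A conn_cancel_Suc[of A "Suc n" i]
    by (simp add: boundary_simps degen_comp_greater[symmetric] degen_degen')
  have "\<psi> (Suc (Suc (Suc n))) i ?G = \<epsilon> (Suc (Suc n)) i (\<epsilon> (Suc n) (Suc i) A)"
  proof (cases \<alpha>)
    case Neg
    then have "\<psi> (Suc (Suc (Suc n))) i ?G = (\<Gamma> (Suc (Suc n)) (Suc i) Pos (\<Gamma> (Suc n) i Pos A) \<star>\<langle>Suc (Suc (Suc n)),Suc i\<rangle>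
      \<Gamma> (Suc (Suc n)) (Suc i) Neg (\<Gamma> (Suc n) i Pos A)) \<star>\<langle>Suc (Suc (Suc n)),Suc i\<rangle>
       \<epsilon> (Suc (Suc n)) (Suc (Suc i)) (\<Gamma> (Suc n) i Neg A)"
      using False i A by (cases \<beta>) (simp_all add: psi_def boundary_simps conn_degen_less conn_conn_same')
    then show ?thesis
      by (simp only: cancel cancel')
  next
    case Pos
    then have "\<psi> (Suc (Suc (Suc n))) i ?G = \<epsilon> (Suc (Suc n)) (Suc (Suc i)) (\<Gamma> (Suc n) i Pos A) \<star>\<langle>Suc (Suc (Suc n)),Suc i\<rangle>
      (\<Gamma> (Suc (Suc n)) (Suc i) Pos (\<Gamma> (Suc n) i Neg A) \<star>\<langle>Suc (Suc (Suc n)),Suc i\<rangle>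
      \<Gamma> (Suc (Suc n)) (Suc i) Neg (\<Gamma> (Suc n) i Neg A))"
      using False i A by (cases \<beta>) (simp_all add: psi_def boundary_simps conn_degen_less conn_conn_same' comp_assoc')
    then show ?thesis
      by (simp only: cancel cancel')
  qed
  then show ?thesis
    using i A by (simp add: fold_thin_def conn_in degen_in)
qed

text \<open>Folding in direction \<open>i + 1\<close> gives a composite in direction
  \<open>i + 2\<close> of the connection itself and two iterated connections covered by
  \<open>fold_thin_conn_Suc_conn\<close>.\<close>

lemma thin_conn:
  assumes A: "A \<in> cells C (Suc (Suc n))"
  shows "thin (Suc (Suc (Suc n))) i (\<Gamma> (Suc (Suc n)) i \<alpha> A)"
  using assms i unfolding thin_def
  by (simp add: psi_def conn_in face_conn_greater, intro fold_thin_comp_greater fold_thin_conn_Suc_conn fold_thin_conn)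
   (simp_all add: boundary_simps)

lemma thin_psi:
  assumes "thin (Suc (Suc (Suc n))) i A"
  shows "thin (Suc (Suc (Suc n))) i (\<psi> (Suc (Suc (Suc n))) i A)"
proof -
  have A: "A \<in> cells C (Suc (Suc (Suc n)))"
    using assms by (simp add: thin_def)
  show ?thesis
    unfolding psi_def using A i assms
    by (simp, intro thin_comp_Suc thin_conn) (simp_all add: boundary_simps)
qed

text \<open>The double foldings are degenerate, so one face in direction \<open>i\<close> determines
  them, and this face is computed from the boundary. Applying \<open>psi_eqI\<close> twice then
  recovers the cells.\<close>

lemma thin_eqI:
  assumes "thin (Suc (Suc (Suc n))) i A" "thin (Suc (Suc (Suc n))) i B"
    and eq: "\<And>\<alpha>. \<partial> (Suc (Suc (Suc n))) i \<alpha> A = \<partial> (Suc (Suc (Suc n))) i \<alpha> B"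
    "\<And>\<alpha>. \<partial> (Suc (Suc (Suc n))) (Suc i) \<alpha> A = \<partial> (Suc (Suc (Suc n))) (Suc i) \<alpha> B"
    "\<And>\<alpha>. \<partial> (Suc (Suc (Suc n))) (Suc (Suc i)) \<alpha> A = \<partial> (Suc (Suc (Suc n))) (Suc (Suc i)) \<alpha> B"
  shows "A = B"
proof -
  let ?N = "Suc (Suc (Suc n))"
  have AB: "A \<in> cells C ?N" "B \<in> cells C ?N"
    "\<psi> ?N i (\<psi> ?N (Suc i) A) \<in> \<epsilon> (Suc (Suc n)) i ` cells C (Suc (Suc n))"
    "\<psi> ?N i (\<psi> ?N (Suc i) B) \<in> \<epsilon> (Suc (Suc n)) i ` cells C (Suc (Suc n))"
    using assms by (simp_all add: thin_def fold_thin_def)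
  have 1: "\<partial> ?N i \<alpha> (\<psi> ?N (Suc i) A) = \<partial> ?N i \<alpha> (\<psi> ?N (Suc i) B)" for \<alpha>
    using AB eq i by (simp add: thin_simps)
  have 2: "\<partial> ?N (Suc i) \<alpha> (\<psi> ?N (Suc i) A) = \<partial> ?N (Suc i) \<alpha> (\<psi> ?N (Suc i) B)" for \<alpha>
    using AB eq i by (cases \<alpha>) (simp_all add: thin_simps)
  have "\<psi> ?N i (\<psi> ?N (Suc i) A) = \<psi> ?N i (\<psi> ?N (Suc i) B)"
    by (rule degen_image_eqI[OF _ _ AB(3,4), of Neg])
      (use AB i 1 2 in \<open>simp_all add: psi_in face_psi[of "\<psi> ?N (Suc i) _"]\<close>)
  then have "\<psi> ?N (Suc i) A = \<psi> ?N (Suc i) B"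
    by (rule psi_eqI[rotated 4]) (use AB i 1 2 in \<open>simp_all add: psi_in\<close>)
  then show ?thesis
    by (rule psi_eqI[rotated 4]) (use AB i eq in \<open>simp_all add: psi_in\<close>)
qed

end

text \<open>The folding in direction \<open>i + 1\<close> commutes with composition and degeneracy
  in direction \<open>i\<close>, so it preserves inverses in that direction.\<close>

lemma thin_R_inverse:
  assumes inv: "R_inverse (Suc (Suc (Suc n))) i A B" and thin: "thin (Suc (Suc (Suc n))) i A"
    and i: "1 \<le> i" "i \<le> Suc n"
  shows "thin (Suc (Suc (Suc n))) i B"
proof -
  let ?N = "Suc (Suc (Suc n))"
  have *: "\<psi> ?N (Suc i) X \<star>\<langle>?N,i\<rangle> \<psi> ?N (Suc i) Y = \<epsilon> (Suc (Suc n)) i (\<partial> ?N i Neg (\<psi> ?N (Suc i) X))"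
    if "R_inverse ?N i X Y" for X Y
    using psi_comp_less[of X "Suc n" Y i "Suc i"] that i
    by (simp add: R_inverse_def psi_degen_le face_in face_psi_less)
  have "R_inverse ?N i (\<psi> ?N (Suc i) A) (\<psi> ?N (Suc i) B)"
    using *[OF inv] *[OF R_inverse_sym[OF inv]] inv i
    by (simp add: R_inverse_def psi_in face_psi_less)
  then have "fold_thin ?N i (\<psi> ?N (Suc i) B)"
    by (rule fold_thin_R_inverse[rotated 2]) (use thin i in \<open>simp_all add: thin_def\<close>)
  then show ?thesis
    using inv by (simp add: thin_def R_inverse_def)
qed

text \<open>The folding of \<open>H\<close> is inverse to that of \<open>Z\<close> and therefore
  thin. Unfolding builds \<open>H\<close> from it with degenerate cells and connections, all
  thin.\<close>

lemma thin_T_inverse: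
  assumes Z: "thin (Suc (Suc (Suc n))) i Z" and H: "is_T_inverse C (Suc (Suc (Suc n))) i Z H"
    and i: "1 \<le> i" "i \<le> Suc n"
  shows "thin (Suc (Suc (Suc n))) i H"
proof -
  let ?N = "Suc (Suc (Suc n))"
  have HN: "H \<in> cells C ?N"
    using H by (simp add: is_T_inverse_def)
  have "thin ?N i (\<psi> ?N i H)"
    using thin_R_inverse[OF is_T_inverse_psi[OF _ _ H]] thin_psi[OF i Z] i by simp
  moreover have i': "i \<le> Suc (Suc n)"
    using i by simp
  ultimately show ?thesis
    apply (subst psi_unfold[OF i(1) i' HN])
    using HN i by (simp, intro thin_comp_same thin_comp_Suc thin_degen thin_conn) (simp_all add: thin_simps)
qed

text \<open>The symmetry acts in direction \<open>i + 1\<close>, whose folding is already the inner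
  one of \<open>thin\<close>. Closure of \<open>fold_thin\<close> under inverses in direction
  \<open>i + 1\<close> thus suffices.\<close>

lemma thin_T_inverse_conn:
  assumes G: "is_T_inverse C (Suc (Suc (Suc n))) (Suc i) (\<Gamma> (Suc (Suc n)) i \<alpha> A) G"
    and A: "A \<in> cells C (Suc (Suc n))" "1 \<le> i" "i \<le> Suc n"
  shows "thin (Suc (Suc (Suc n))) i G"
proof -
  have "fold_thin (Suc (Suc (Suc n))) i (\<psi> (Suc (Suc (Suc n))) (Suc i) (\<Gamma> (Suc (Suc n)) i \<alpha> A))"
    using thin_conn A by (simp add: thin_def)
  then show ?thesis
    using is_T_inverse_psi[OF _ _ G] A G fold_thin_R_inverse_Suc[of i "Suc n"]
    by (auto simp: thin_def is_T_inverse_def)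
qed

end

section \<open>The symmetry of a cubical category with invertible cells\<close>

context cubical_omega_1_category
begin

section \<open>From the full folding to invertibility in every direction\<close>

text \<open>Induction on \<open>k\<close> peels off the innermost folding \<open>?B\<close>, which
  is first shown invertible in its own direction \<open>k\<close>. For \<open>i = k + 1\<close>
  transposition is used, for \<open>i = k\<close> plain unfolding. For \<open>i < k\<close> the
  induction hypothesis is applied to \<open>?B\<close> in direction \<open>i\<close> as
  well.\<close>

lemma R_invertible_if_foldr_psi:
  assumes IH: "\<And>A i. \<lbrakk>A \<in> cells C (Suc n); 1 \<le> i; i < Suc n\<rbrakk> \<Longrightarrow> R_invertible (Suc n) i (\<psi> (Suc n) i A)"
    and "A \<in> cells C (Suc (Suc n))" "1 \<le> i" "i \<le> k" "k \<le> Suc (Suc n)"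
    and "faces_invertible (Suc (Suc n)) i A"
    and "R_invertible (Suc (Suc n)) 1 (foldr (\<psi> (Suc (Suc n))) [1..<k] A)"
  shows "R_invertible (Suc (Suc n)) i A"
  using assms(2-)
proof (induction k arbitrary: A i)
  case (Suc k)
  show ?case
  proof (cases "k = 0")
    case True
    with Suc.prems show ?thesis
      by (auto simp: le_Suc_eq)
  next
    case False
    let ?B = "\<psi> (Suc (Suc n)) k A"
    have k: "1 \<le> k" "k \<le> Suc n"
      using False Suc.prems by simp_all
    have B: "?B \<in> cells C (Suc (Suc n))" "faces_invertible (Suc (Suc n)) k ?B"
      "R_invertible (Suc (Suc n)) 1 (foldr (\<psi> (Suc (Suc n))) [1..<k] ?B)"
      using Suc.prems k IH by (simp_all add: psi_in faces_invertible_psi_same)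
    have inv: "R_invertible (Suc n) (dn i j) (\<partial> (Suc (Suc n)) j \<alpha> A)"
      if "1 \<le> j" "j \<le> Suc (Suc n)" "j \<noteq> i" for j \<alpha>
      using Suc.prems that by (simp add: faces_invertible_def)
    have Bk: "R_invertible (Suc (Suc n)) k ?B"
      using Suc.IH[of ?B k] B k by simp
    consider "i = Suc k" | "i = k" | "i < k"
      using Suc.prems by linarith
    then show ?thesis
    proof cases
      case 1
      then show ?thesis
        using R_invertible_unfold_less[of k n A] inv[of k] Bk Suc.prems k by (simp add: dn_def)
    next
      case 2
      then show ?thesis
        using R_invertible_unfold_same[of k n A] inv[of "Suc k"] Bk Suc.prems k by (simp add: dn_def)
    next
      case 3
      then have "R_invertible (Suc (Suc n)) i ?B"
        using Suc.IH[of ?B i] B k Suc.prems by (simp add: faces_invertible_psi_greater)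
      with 3 show ?thesis
        using R_invertible_unfold_greater[of A n i k] inv[of k] inv[of "Suc k"] Suc.prems k by (simp add: dn_def)
    qed
  qed
qed simp

text \<open>Induction on the dimension: the faces of the folding outside direction \<open>i\<close>
  are invertible by \<open>faces_invertible_psi_same\<close>.\<close>

lemma R_invertible_psi: "\<lbrakk>A \<in> cells C n; 1 \<le> i; i < n\<rbrakk> \<Longrightarrow> R_invertible n i (\<psi> n i A)"
proof (induction n arbitrary: A i)
  case (Suc n)
  then obtain m where n: "n = Suc m"
    by (cases n) auto
  let ?B = "\<psi> (Suc (Suc m)) i A"
  have B: "?B \<in> cells C (Suc (Suc m))"
    using Suc.prems n by (simp add: psi_in)
  \<comment> \<open>The axiom is applied to the folding \<open>?B\<close> rather than to
    \<open>A\<close>, whose own faces need not be invertible.\<close>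
  have "R1_invertible C (Suc (Suc m)) (foldr (\<psi> (Suc (Suc m))) [1..<Suc (Suc m)] ?B)"
    using invertible[of "Suc (Suc m)" ?B] B by (simp add: invertible_cell_def)
  then have "R_invertible (Suc (Suc m)) 1 (foldr (\<psi> (Suc (Suc m))) [1..<Suc (Suc m)] ?B)"
    by (auto simp: R1_invertible_def R_invertible_def R_inverse_def composable_def)
  then show ?case
    using R_invertible_if_foldr_psi[of m ?B i "Suc (Suc m)"] faces_invertible_psi_same[of m A i]
      Suc B unfolding n by simp
qed simp

section \<open>The symmetries and their compatibility with the structure\<close>

abbreviation T :: "nat \<Rightarrow> nat \<Rightarrow> 'a \<Rightarrow> 'a" where
  "T \<equiv> T_inverse C"

text \<open>Through this rule every identity for \<open>T\<close> becomes a transport statement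
  about \<open>is_T_inverse\<close>.\<close>

lemma T_inverse_eqI: "is_T_inverse C n i A B \<Longrightarrow> T n i A = B"
  unfolding T_inverse_def using is_T_inverse_unique by (intro the_equality) auto

lemma ex1_T_inverse:
  assumes "A \<in> cells C n" "1 \<le> i" "i < n"
  shows "\<exists>!B. is_T_inverse C n i A B"
proof -
  obtain m where n: "n = Suc (Suc m)"
    using assms by (cases n; cases "n - 1") auto
  have "\<exists>B. is_T_inverse C n i A B"
    using is_T_inverse_exists[of i m A] R_invertible_psi[of A n i] assms n by simp
  then show ?thesis
    using is_T_inverse_unique by blast
qed

lemma is_T_inverse_T: "\<lbrakk>A \<in> cells C n; 1 \<le> i; i < n\<rbrakk> \<Longrightarrow> is_T_inverse C n i A (T n i A)"
  unfolding T_inverse_def by (rule theI') (rule ex1_T_inverse)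

lemma T_in: "\<lbrakk>A \<in> cells C n; 1 \<le> i; i < n\<rbrakk> \<Longrightarrow> T n i A \<in> cells C n"
  using is_T_inverse_T[of A n i] by (simp add: is_T_inverse_def)

lemma T_T: "\<lbrakk>A \<in> cells C n; 1 \<le> i; i < n\<rbrakk> \<Longrightarrow> T n i (T n i A) = A"
  using is_T_inverse_T is_T_inverse_sym T_inverse_eqI by blast

lemma face_T: "\<lbrakk>A \<in> cells C n; 1 \<le> i; i < n\<rbrakk> \<Longrightarrow> \<partial> n i \<alpha> (T n i A) = \<partial> n (Suc i) \<alpha> A"
  and face_T_Suc: "\<lbrakk>A \<in> cells C n; 1 \<le> i; i < n\<rbrakk> \<Longrightarrow> \<partial> n (Suc i) \<alpha> (T n i A) = \<partial> n i \<alpha> A"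
  using is_T_inverse_T[of A n i] by (simp_all add: is_T_inverse_def)

lemma face_T_less:
  assumes "A \<in> cells C (Suc (Suc (Suc n)))" "1 \<le> j" "j \<le> i" "i \<le> Suc n"
  shows "\<partial> (Suc (Suc (Suc n))) j \<alpha> (T (Suc (Suc (Suc n))) (Suc i) A) =
     T (Suc (Suc n)) i (\<partial> (Suc (Suc (Suc n))) j \<alpha> A)"
  using is_T_inverse_face_less[OF is_T_inverse_T, THEN T_inverse_eqI, symmetric] assms by simp

lemma face_T_greater:
  assumes "A \<in> cells C (Suc (Suc (Suc n)))" "1 \<le> i" "i < j" "j \<le> Suc (Suc n)"
  shows "\<partial> (Suc (Suc (Suc n))) (Suc j) \<alpha> (T (Suc (Suc (Suc n))) i A) =
     T (Suc (Suc n)) i (\<partial> (Suc (Suc (Suc n))) (Suc j) \<alpha> A)"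
  using is_T_inverse_face_greater[OF is_T_inverse_T, THEN T_inverse_eqI, symmetric] assms by simp

lemma T_degen: "\<lbrakk>A \<in> cells C (Suc n); 1 \<le> i; i \<le> Suc n\<rbrakk> \<Longrightarrow>
    T (Suc (Suc n)) i (\<epsilon> (Suc n) i A) = \<epsilon> (Suc n) (Suc i) A"
  and T_degen_Suc: "\<lbrakk>A \<in> cells C (Suc n); 1 \<le> i; i \<le> Suc n\<rbrakk> \<Longrightarrow>
    T (Suc (Suc n)) i (\<epsilon> (Suc n) (Suc i) A) = \<epsilon> (Suc n) i A"
  and T_conn: "\<lbrakk>A \<in> cells C (Suc n); 1 \<le> i; i \<le> Suc n\<rbrakk> \<Longrightarrow>
    T (Suc (Suc n)) i (\<Gamma> (Suc n) i \<alpha> A) = \<Gamma> (Suc n) i \<alpha> A"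
  using T_inverse_eqI is_T_inverse_degen is_T_inverse_conn is_T_inverse_sym by blast+

lemma T_degen_le: "\<lbrakk>A \<in> cells C (Suc (Suc n)); 1 \<le> j; j \<le> i; i \<le> Suc n\<rbrakk> \<Longrightarrow>
    T (Suc (Suc (Suc n))) (Suc i) (\<epsilon> (Suc (Suc n)) j A) = \<epsilon> (Suc (Suc n)) j (T (Suc (Suc n)) i A)"
  using is_T_inverse_degen_le[OF is_T_inverse_T, THEN T_inverse_eqI] by simp

lemma T_degen_greater: "\<lbrakk>A \<in> cells C (Suc (Suc n)); 1 \<le> i; i < j; j \<le> Suc (Suc n)\<rbrakk> \<Longrightarrow>
    T (Suc (Suc (Suc n))) i (\<epsilon> (Suc (Suc n)) (Suc j) A) = \<epsilon> (Suc (Suc n)) (Suc j) (T (Suc (Suc n)) i A)"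
  using is_T_inverse_degen_greater[OF is_T_inverse_T, THEN T_inverse_eqI] by simp

lemma T_conn_less: "\<lbrakk>A \<in> cells C (Suc (Suc n)); 1 \<le> j; j < i; i \<le> Suc n\<rbrakk> \<Longrightarrow>
    T (Suc (Suc (Suc n))) (Suc i) (\<Gamma> (Suc (Suc n)) j \<alpha> A) = \<Gamma> (Suc (Suc n)) j \<alpha> (T (Suc (Suc n)) i A)"
  using is_T_inverse_conn_less[OF is_T_inverse_T, THEN T_inverse_eqI] by simp

lemma T_conn_greater: "\<lbrakk>A \<in> cells C (Suc (Suc n)); 1 \<le> i; i < j; j \<le> Suc n\<rbrakk> \<Longrightarrow>
    T (Suc (Suc (Suc n))) i (\<Gamma> (Suc (Suc n)) (Suc j) \<alpha> A) = \<Gamma> (Suc (Suc n)) (Suc j) \<alpha> (T (Suc (Suc n)) i A)"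
  using is_T_inverse_conn_greater[OF is_T_inverse_T, THEN T_inverse_eqI] by simp

lemma T_comp_same: "\<lbrakk>A \<in> cells C (Suc (Suc n)); B \<in> cells C (Suc (Suc n));
    \<partial> (Suc (Suc n)) i Pos A = \<partial> (Suc (Suc n)) i Neg B; 1 \<le> i; i \<le> Suc n\<rbrakk> \<Longrightarrow>
   T (Suc (Suc n)) i (A \<star>\<langle>Suc (Suc n),i\<rangle> B) = T (Suc (Suc n)) i A \<star>\<langle>Suc (Suc n),Suc i\<rangle> T (Suc (Suc n)) i B"
  by (intro T_inverse_eqI is_T_inverse_comp_same is_T_inverse_T) simp_all

lemma T_comp_Suc: "\<lbrakk>A \<in> cells C (Suc (Suc n)); B \<in> cells C (Suc (Suc n));
    \<partial> (Suc (Suc n)) (Suc i) Pos A = \<partial> (Suc (Suc n)) (Suc i) Neg B; 1 \<le> i; i \<le> Suc n\<rbrakk> \<Longrightarrow>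
   T (Suc (Suc n)) i (A \<star>\<langle>Suc (Suc n),Suc i\<rangle> B) = T (Suc (Suc n)) i A \<star>\<langle>Suc (Suc n),i\<rangle> T (Suc (Suc n)) i B"
  by (intro T_inverse_eqI is_T_inverse_comp_Suc is_T_inverse_T) simp_all

text \<open>The composability of the transposes demanded by \<open>is_T_inverse_comp_greater\<close>
  comes from \<open>face_T_greater\<close>.\<close>

lemma T_comp_greater:
  assumes "A \<in> cells C (Suc (Suc n))" "B \<in> cells C (Suc (Suc n))"
    and eq: "\<partial> (Suc (Suc n)) (Suc j) Pos A = \<partial> (Suc (Suc n)) (Suc j) Neg B" and "1 \<le> i" "i < j" "j \<le> Suc n"
  shows "T (Suc (Suc n)) i (A \<star>\<langle>Suc (Suc n),Suc j\<rangle> B) = T (Suc (Suc n)) i A \<star>\<langle>Suc (Suc n),Suc j\<rangle> T (Suc (Suc n)) i B"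
proof -
  obtain m where n: "n = Suc m"
    using assms by (cases n) auto
  show ?thesis
    using assms eq unfolding n
    by (intro T_inverse_eqI is_T_inverse_comp_greater is_T_inverse_T) (simp_all add: face_T_greater)
qed

lemma T_comp_less:
  assumes "A \<in> cells C (Suc (Suc n))" "B \<in> cells C (Suc (Suc n))"
    and eq: "\<partial> (Suc (Suc n)) j Pos A = \<partial> (Suc (Suc n)) j Neg B" and "1 \<le> j" "j < i" "i \<le> Suc n"
  shows "T (Suc (Suc n)) i (A \<star>\<langle>Suc (Suc n),j\<rangle> B) = T (Suc (Suc n)) i A \<star>\<langle>Suc (Suc n),j\<rangle> T (Suc (Suc n)) i B"
proof -
  obtain m i' where n: "n = Suc m" and i: "i = Suc i'"
    using assms by (cases n; cases i) auto
  show ?thesis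
    using assms eq unfolding n i
    by (intro T_inverse_eqI is_T_inverse_comp_less is_T_inverse_T) (simp_all add: face_T_less)
qed

lemmas T_simps = T_in face_T face_T_Suc face_T_less face_T_greater T_degen T_degen_Suc T_conn
  T_degen_le T_degen_greater T_conn_less T_conn_greater T_comp_same T_comp_Suc T_comp_greater T_comp_less

text \<open>Both sides are thin and have the same faces in the directions \<open>i\<close>,
  \<open>i + 1\<close> and \<open>i + 2\<close>, so \<open>thin_eqI\<close> identifies them.\<close>

lemma T_conn_Suc_T:
  assumes A: "A \<in> cells C (Suc (Suc n))" "1 \<le> i" "i \<le> Suc n"
  shows "T (Suc (Suc (Suc n))) i (\<Gamma> (Suc (Suc n)) (Suc i) \<alpha> (T (Suc (Suc n)) i A)) =
    T (Suc (Suc (Suc n))) (Suc i) (\<Gamma> (Suc (Suc n)) i \<alpha> A)" (is "?H = ?G")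
proof (rule thin_eqI[of i n])
  let ?N = "Suc (Suc (Suc n))"
  let ?GG = "\<Gamma> (Suc (Suc n)) i \<alpha> A" and ?Z = "\<Gamma> (Suc (Suc n)) (Suc i) \<alpha> (T (Suc (Suc n)) i A)"
  have in_N: "?GG \<in> cells C ?N" "?Z \<in> cells C ?N" "T (Suc (Suc n)) i A \<in> cells C (Suc (Suc n))"
    using A by (simp_all add: conn_in T_in)
  show "thin ?N i ?H"
    using A in_N by (intro thin_T_inverse[OF thin_conn_Suc is_T_inverse_T]) simp_all
  show "thin ?N i ?G"
    using A in_N by (intro thin_T_inverse_conn[OF is_T_inverse_T]) simp_all
  \<comment> \<open>Whether \<open>\<beta> = \<alpha>\<close> decides if the relevant face of a
    connection is the original cell or degenerate.\<close>
  show "\<partial> ?N i \<beta> ?H = \<partial> ?N i \<beta> ?G" "\<partial> ?N (Suc i) \<beta> ?H = \<partial> ?N (Suc i) \<beta> ?G"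
    "\<partial> ?N (Suc (Suc i)) \<beta> ?H = \<partial> ?N (Suc (Suc i)) \<beta> ?G" for \<beta>
    using A in_N by (cases "\<beta> = \<alpha>"; simp add: T_simps T_T boundary_simps)+
qed (use A in simp_all)

text \<open>The symmetry in direction \<open>j\<close> preserves the structure in the directions
  \<open>i\<close> and \<open>i + 1\<close>; one dimension lower it acts in direction
  \<open>j - 1\<close>.\<close>

lemma T_commute_greater:
  assumes A: "A \<in> cells C n" "1 \<le> i" "i + 2 \<le> j" "j < n"
  shows "T n i (T n j A) = T n j (T n i A)"
proof (rule T_inverse_eqI)
  obtain m k where n: "n = Suc (Suc (Suc m))" and j: "j = Suc (Suc k)"
    using assms by (cases n; cases "n - 1"; cases "n - 2"; cases j; cases "j - 1") auto
  have "is_T_inverse C n i A (T n i A)"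
    using assms by (simp add: is_T_inverse_T)
  then show "is_T_inverse C n i (T n j A) (T n j (T n i A))"
    unfolding n j
    by (rule is_T_inverse_map[where G = "T (Suc (Suc m)) (Suc k)"])
      (use assms n j in \<open>simp_all add: T_simps\<close>)
qed

text \<open>The map \<open>T n i\<close> after \<open>T n (Suc i)\<close> carries the directions
  \<open>i\<close>, \<open>i + 1\<close> to \<open>i + 1\<close>, \<open>i + 2\<close>. It therefore
  sends the pair of \<open>A\<close> and \<open>T n i A\<close> to T-inverses in direction
  \<open>i + 1\<close>.\<close>

lemma T_braid:
  assumes A: "A \<in> cells C n" "1 \<le> i" "Suc i < n"
  shows "T n i (T n (Suc i) (T n i A)) = T n (Suc i) (T n i (T n (Suc i) A))"
proof (rule T_inverse_eqI[symmetric])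
  obtain m where n: "n = Suc (Suc (Suc m))"
    using assms by (cases n; cases "n - 1"; cases "n - 2") auto
  \<comment> \<open>Compatibility with connections is exactly \<open>T_conn_Suc_T\<close> followed
    by the involution law.\<close>
  have conn: "T (Suc (Suc (Suc m))) i (T (Suc (Suc (Suc m))) (Suc i) (\<Gamma> (Suc (Suc m)) i \<alpha> x)) =
     \<Gamma> (Suc (Suc m)) (Suc i) \<alpha> (T (Suc (Suc m)) i x)" if "x \<in> cells C (Suc (Suc m))" for x \<alpha>
    using that A n by (simp add: T_conn_Suc_T[symmetric] T_T T_in conn_in)
  have "is_T_inverse C n i A (T n i A)"
    using assms by (simp add: is_T_inverse_T)
  then show "is_T_inverse C n (Suc i) (T n i (T n (Suc i) A)) (T n i (T n (Suc i) (T n i A)))"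
    unfolding n
    by (rule is_T_inverse_map[where G = "T (Suc (Suc m)) i"])
      (use assms n in \<open>simp_all add: T_simps conn\<close>)
qed

lemma symmetric_T_inverse: "symmetric_cubical_omega_category C T"
proof
  fix A n i j \<alpha>
  show "T n i A \<in> cells C n" if "A \<in> cells C n" "1 \<le> i" "i < n"
    using that by (rule T_in)
  show "\<partial> n i \<alpha> (T n j A) = T (n - 1) (dn j i) (\<partial> n i \<alpha> A)"
    if ij: "A \<in> cells C n" "1 \<le> j" "j < n" "1 \<le> i" "i \<le> n" "i \<noteq> j" "i \<noteq> j + 1"
  proof -
    \<comment> \<open>A direction other than \<open>j\<close> and \<open>j + 1\<close> exists only
      from dimension 3 on.\<close>
    have "3 \<le> n"
      using that by linarith
    then obtain m where n: "n = Suc (Suc (Suc m))"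
      by (metis Suc_le_D numeral_3_eq_3 Suc_le_mono)
    show ?thesis
    proof (cases "i < j")
      case True
      then obtain k where "j = Suc k"
        by (cases j) auto
      with True that n show ?thesis
        by (simp add: dn_def face_T_less)
    next
      case False
      then obtain k where "i = Suc k" "j < k"
        using ij by (cases i) auto
      with False that n show ?thesis
        by (simp add: dn_def face_T_greater)
    qed
  qed
  show "\<partial> n j \<alpha> (T n j A) = \<partial> n (j + 1) \<alpha> A" "\<partial> n (j + 1) \<alpha> (T n j A) = \<partial> n j \<alpha> A"
    if "A \<in> cells C n" "1 \<le> j" "j < n"
    using that by (simp_all add: face_T face_T_Suc)
  show "T (n + 1) j (\<epsilon> n j A) = \<epsilon> n (j + 1) A" "T (n + 1) j (\<Gamma> n j \<alpha> A) = \<Gamma> n j \<alpha> A"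
    if "A \<in> cells C n" "1 \<le> j" "j \<le> n"
    using that by (cases n; simp add: T_degen T_conn)+
  show "T (n + 1) (j - 1) (\<epsilon> n j A) = \<epsilon> n (j - 1) A" if "A \<in> cells C n" "2 \<le> j" "j \<le> n + 1"
    using that by (cases n; cases j) (simp_all add: T_degen_Suc)
  show "T (n + 1) (up i j) (\<epsilon> n j A) = \<epsilon> n j (T n i A)"
    if ij: "A \<in> cells C n" "1 \<le> i" "i < n" "1 \<le> j" "j \<le> n + 1" "i + 1 \<noteq> j"
  proof -
    obtain m where n: "n = Suc (Suc m)"
      using ij by (cases n; cases "n - 1") auto
    show ?thesis
      using that by (cases j; cases "i < j") (auto simp: n up_def T_degen_le T_degen_greater)
  qed
  show "T (n + 1) (up i j) (\<Gamma> n j \<alpha> A) = \<Gamma> n j \<alpha> (T n i A)"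
    if ij: "A \<in> cells C n" "1 \<le> i" "i < n" "1 \<le> j" "j \<le> n" "j \<noteq> i" "j \<noteq> i + 1"
  proof -
    obtain m where n: "n = Suc (Suc m)"
      using ij by (cases n; cases "n - 1") auto
    show ?thesis
      using that by (cases j; cases "i < j") (auto simp: n up_def T_conn_less T_conn_greater)
  qed
  show T_conn_Suc: "T (n + 1) i (\<Gamma> n (i + 1) \<alpha> (T n i A)) = T (n + 1) (i + 1) (\<Gamma> n i \<alpha> A)"
    if "A \<in> cells C n" "1 \<le> i" "i < n" for A
    using that by (cases n; cases "n - 1") (auto simp: T_conn_Suc_T)
  \<comment> \<open>This is the preceding law for \<open>T n i A\<close> in place of
    \<open>A\<close>, since \<open>T n i\<close> is an involution.\<close>
  show "T (n + 1) (i + 1) (\<Gamma> n i \<alpha> (T n i A)) = T (n + 1) i (\<Gamma> n (i + 1) \<alpha> A)"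
    if "A \<in> cells C n" "1 \<le> i" "i < n"
    using that T_conn_Suc[of "T n i A"] by (simp add: T_in T_T)
  show "T n i (A \<star>\<langle>n,i\<rangle> B) = T n i A \<star>\<langle>n,i + 1\<rangle> T n i B" if "composable C n i A B" "i < n" for B
    using that by (cases n; cases "n - 1") (auto simp: composable_def T_comp_same)
  show "T n i (A \<star>\<langle>n,i + 1\<rangle> B) = T n i A \<star>\<langle>n,i\<rangle> T n i B" if "composable C n (i + 1) A B" "1 \<le> i" for B
    using that by (cases n; cases "n - 1") (auto simp: composable_def T_comp_Suc)
  show "T n i (A \<star>\<langle>n,j\<rangle> B) = T n i A \<star>\<langle>n,j\<rangle> T n i B"
    if ij: "composable C n j A B" "1 \<le> i" "i < n" "j \<noteq> i" "j \<noteq> i + 1" for B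
  proof -
    obtain m where n: "n = Suc (Suc m)"
      using ij by (cases n; cases "n - 1") auto
    show ?thesis
      using that by (cases j; cases "j < i") (auto simp: n composable_def T_comp_less T_comp_greater)
  qed
  show "T n i (T n i A) = A" if "A \<in> cells C n" "1 \<le> i" "i < n"
    using that by (rule T_T)
  show "T n i (T n (i + 1) (T n i A)) = T n (i + 1) (T n i (T n (i + 1) A))"
    if "A \<in> cells C n" "1 \<le> i" "i + 1 < n"
    using T_braid that by simp
  show "T n i (T n j A) = T n j (T n i A)"
    if "A \<in> cells C n" "1 \<le> i" "i < n" "1 \<le> j" "j < n" "i + 2 \<le> j \<or> j + 2 \<le> i"
    using that T_commute_greater[of A n i j] T_commute_greater[of A n j i] by auto
qed

end

theorem proposition5p1p9:
  fixes C :: "'a cubical"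
  assumes "cubical_omega_1_category C"
  shows "(\<forall>n\<ge>2. \<forall>i\<in>{1..n - 1}. \<forall>A\<in>cells C n. \<exists>!B. is_T_inverse C n i A B) \<and>
         symmetric_cubical_omega_category C (T_inverse C)"
proof -
  interpret cubical_omega_1_category C
    by fact
  show ?thesis
    using symmetric_T_inverse by (intro conjI allI impI ballI ex1_T_inverse) auto
qed

end
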